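(* Let $n\in\mathbb{N}$ and let $\{x_i\}_{i\in\mathbb{N}}$ be a seminormalized weakly null sequence in $\mathfrak{X}_{0,1}^n$. Then one of the following holds. (i) $\{x_i\}_{i\in\mathbb{N}}$ admits $c_0$ as a spreading model. (ii) There exists $1\leqslant k\leqslant n$ such that $\{x_i\}_{i\in\mathbb{N}}$ admits an $\ell_1^k$ spreading model and it does not admit an $\ell_1^{k+1}$ one.
   Context: $c_{00}$ is the space of finitely supported real sequences with unit vector basis $\{e_i\}_{i\in\mathbb{N}}$; $E<F$ for finite sets means $\max E<\min F$, and $f<g$ for vectors means $\operatorname{supp}f<\operatorname{supp}g$. Schreier families: $\mathcal{S}_0=\{\{m\}:m\in\mathbb{N}\}$, $\mathcal{S}_1=\{F\subset\mathbb{N}:\#F\leqslant\min F\}$, and $\mathcal{S}_{m+1}=\{F_1\cup\cdots\cup F_k: F_1<\cdots<F_k\in\mathcal{S}_m,\ k\leqslant\min F_1\}$. The space $\mathfrak{X}_{0,1}^n$ ($n\geqslant1$): For $G\subset c_{00}$, an $\alpha$-average in $G$ is a vector $\alpha\in G$ of the form $\alpha=\frac1\ell\sum_{q=1}^d f_q$ with $f_1<\cdots<f_d\in G$, $d\leqslant\ell$, $\ell\geqslant2$; its size is $s(\alpha)=\ell$ (an $\alpha$-average is considered together with such a representation). A sequence $\{\alpha_q\}_{q=1}^d$ of $\alpha$-averages is $\mathcal{S}_k$-admissible if $\alpha_1<\cdots<\alpha_d$ and $\{\min\operatorname{supp}\alpha_q:q=1,\ldots,d\}\in\mathcal{S}_k$;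 a (finite or infinite) sequence of $\alpha$-averages is very fast growing if $\alpha_1<\alpha_2<\cdots$, $s(\alpha_1)<s(\alpha_2)<\cdots$ and $s(\alpha_q)>\max\operatorname{supp}\alpha_{q-1}$ for $q>1$. Set $W_0=\{\pm e_i\}_{i\in\mathbb{N}}$ and $W_{m+1}=W_m\cup W^\alpha_{m+1}\cup W^S_{m+1}$, where $W^\alpha_{m+1}=\{\frac1\ell\sum_{q=1}^d f_q: f_1<\cdots<f_d\in W_m,\ \ell\geqslant2,\ \ell\geqslant d\}$ and $W^S_{m+1}=\{\sum_{q=1}^d\alpha_q:\{\alpha_q\}_{q=1}^d\subset W_m$ an $\mathcal{S}_n$-admissible and very fast growing sequence of $\alpha$-averages$\}$. Let $W=\bigcup_m W_m$, acting on $c_{00}$ by the usual duality, $\|x\|=\sup\{f(x):f\in W\}$, and $\mathfrak{X}_{0,1}^n$ the completion of $(c_{00},\|\cdot\|)$. A sequence $\{x_i\}$ in a Banach space generates an $\ell_1^k$ (resp. $c_0^k$) spreading model if there is $C\geqslant1$ such that for every $F\in\mathcal{S}_k$, $\{x_i\}_{i\in F}$ is $C$-equivalent to the usual basis of $(\mathbb{R}^{\#F},\|\cdot\|_1)$ (resp. $(\mathbb{R}^{\#F},\|\cdot\|_\infty)$). A $c_0$ spreading model means a $c_0^1$ one. A sequence admits a spreading model of a given type if some subsequence of it generates one. *)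

theory Defs
  imports "HOL-Analysis.Analysis"
begin

(* The index set of the paper is {1, 2, ...}. Here c00 vectors and Schreier sets live on nat and
   avoid 0; a sequence is a function on nat whose value at 0 is never used. *)

definition set_less :: "nat set \<Rightarrow> nat set \<Rightarrow> bool" where
  "set_less E F \<longleftrightarrow> Max E < Min F"

(* Only nonempty sets are members, so Min and Max are always meaningful; in the second equation
   0 < card F and card F \<le> Min F already exclude 0 from F. *)
fun schreier :: "nat \<Rightarrow> nat set set" where
  "schreier 0 = {{m} | m. 1 \<le> m}"
| "schreier (Suc 0) = {F. finite F \<and> F \<noteq> {} \<and> card F \<le> Min F}"
| "schreier (Suc (Suc m)) =
    {\<Union>(set Fs) | Fs. Fs \<noteq> [] \<and> set Fs \<subseteq> schreier (Suc m) \<and> sorted_wrt set_less Fs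
                    \<and> length Fs \<le> Min (hd Fs)}"

definition supp :: "(nat \<Rightarrow> real) \<Rightarrow> nat set" where
  "supp f = {i. f i \<noteq> 0}"

definition c00 :: "(nat \<Rightarrow> real) set" where
  "c00 = {f. finite (supp f) \<and> f 0 = 0}"

definition unit_vec :: "nat \<Rightarrow> nat \<Rightarrow> real" where
  "unit_vec i = (\<lambda>j. if j = i then 1 else 0)"

definition vec_less :: "(nat \<Rightarrow> real) \<Rightarrow> (nat \<Rightarrow> real) \<Rightarrow> bool" where
  "vec_less f g \<longleftrightarrow> set_less (supp f) (supp g)"

definition average :: "nat \<Rightarrow> (nat \<Rightarrow> real) list \<Rightarrow> nat \<Rightarrow> real" where
  "average l fs = (\<lambda>i. (1 / real l) * (\<Sum>f\<leftarrow>fs. f i))"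

(* The set of all (1/l) (f_1 + ... + f_d) with f_1 < ... < f_d in G, 1 \<le> d \<le> l and l \<ge> 2. *)
definition averages_of_size :: "(nat \<Rightarrow> real) set \<Rightarrow> nat \<Rightarrow> (nat \<Rightarrow> real) set" where
  "averages_of_size G l =
    {average l fs | fs. fs \<noteq> [] \<and> set fs \<subseteq> G \<and> sorted_wrt vec_less fs \<and> length fs \<le> l \<and> 2 \<le> l}"

(* One vector may be an average with several sizes, so an alpha-average is a pair of the vector
   and the size of the chosen representation. *)
type_synonym sized_average = "(nat \<Rightarrow> real) \<times> nat"

definition alpha_average :: "(nat \<Rightarrow> real) set \<Rightarrow> sized_average \<Rightarrow> bool" where
  "alpha_average G a \<longleftrightarrow> fst a \<in> G \<and> fst a \<in> averages_of_size G (snd a)"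

definition admissible :: "nat \<Rightarrow> sized_average list \<Rightarrow> bool" where
  "admissible k as \<longleftrightarrow> sorted_wrt vec_less (map fst as) \<and> (\<lambda>a. Min (supp (fst a))) ` set as \<in> schreier k"

definition very_fast_growing :: "sized_average list \<Rightarrow> bool" where
  "very_fast_growing as \<longleftrightarrow>
     sorted_wrt vec_less (map fst as) \<and> sorted_wrt (<) (map snd as) \<and>
     (\<forall>q. Suc q < length as \<longrightarrow> Max (supp (fst (as ! q))) < snd (as ! Suc q))"

definition W_alpha :: "(nat \<Rightarrow> real) set \<Rightarrow> (nat \<Rightarrow> real) set" where
  "W_alpha G = (\<Union>l. averages_of_size G l)"

definition W_schreier :: "nat \<Rightarrow> (nat \<Rightarrow> real) set \<Rightarrow> (nat \<Rightarrow> real) set" where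
  "W_schreier n G =
    {(\<lambda>i. \<Sum>a\<leftarrow>as. fst a i) | as. as \<noteq> [] \<and> (\<forall>a\<in>set as. alpha_average G a) \<and>
                                admissible n as \<and> very_fast_growing as}"

primrec W_level :: "nat \<Rightarrow> nat \<Rightarrow> (nat \<Rightarrow> real) set" where
  "W_level n 0 = {unit_vec i | i. 1 \<le> i} \<union> {(\<lambda>j. - unit_vec i j) | i. 1 \<le> i}"
| "W_level n (Suc m) = W_level n m \<union> W_alpha (W_level n m) \<union> W_schreier n (W_level n m)"

definition norming_set :: "nat \<Rightarrow> (nat \<Rightarrow> real) set" where
  "norming_set n = (\<Union>m. W_level n m)"

definition dual_pair :: "(nat \<Rightarrow> real) \<Rightarrow> (nat \<Rightarrow> real) \<Rightarrow> real" where
  "dual_pair f x = (\<Sum>i\<in>supp x. f i * x i)"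

(* For x in c00 the supremum is over a bounded set, as |f i| \<le> 1 for all f in the norming set. *)
definition X01_norm :: "nat \<Rightarrow> (nat \<Rightarrow> real) \<Rightarrow> real" where
  "X01_norm n x = (SUP f\<in>norming_set n. dual_pair f x)"

(* The Banach space 'a, with the embedding J of c00, is the completion of c00 under X01_norm n.
   This determines 'a up to a unique isometric isomorphism compatible with J. The values of J
   outside c00 are irrelevant. *)
definition is_X01_completion :: "nat \<Rightarrow> ((nat \<Rightarrow> real) \<Rightarrow> 'a::banach) \<Rightarrow> bool" where
  "is_X01_completion n J \<longleftrightarrow>
     (\<forall>x\<in>c00. \<forall>y\<in>c00. J (\<lambda>i. x i + y i) = J x + J y) \<and>
     (\<forall>t. \<forall>x\<in>c00. J (\<lambda>i. t * x i) = t *\<^sub>R J x) \<and>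
     (\<forall>x\<in>c00. norm (J x) = X01_norm n x) \<and>
     closure (J ` c00) = UNIV"

definition seminormalized :: "(nat \<Rightarrow> 'a::real_normed_vector) \<Rightarrow> bool" where
  "seminormalized x \<longleftrightarrow> (\<exists>c>0. \<exists>C. \<forall>i\<ge>1. c \<le> norm (x i) \<and> norm (x i) \<le> C)"

definition weakly_null :: "(nat \<Rightarrow> 'a::real_normed_vector) \<Rightarrow> bool" where
  "weakly_null x \<longleftrightarrow> (\<forall>f :: 'a \<Rightarrow> real. bounded_linear f \<longrightarrow> (\<lambda>i. f (x i)) \<longlonglongrightarrow> 0)"

(* (x_i), i in F, is C-equivalent to the unit vector basis of R^F under the norm N, where N takes
   the family of coefficients. *)
definition C_equivalent ::
  "real \<Rightarrow> nat set \<Rightarrow> (nat \<Rightarrow> 'a::real_normed_vector) \<Rightarrow> ((nat \<Rightarrow> real) \<Rightarrow> real) \<Rightarrow> bool" where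
  "C_equivalent C F x N \<longleftrightarrow>
     (\<forall>a. (1 / C) * N a \<le> norm (\<Sum>i\<in>F. a i *\<^sub>R x i) \<and> norm (\<Sum>i\<in>F. a i *\<^sub>R x i) \<le> C * N a)"

definition generates_l1_spreading_model :: "nat \<Rightarrow> (nat \<Rightarrow> 'a::real_normed_vector) \<Rightarrow> bool" where
  "generates_l1_spreading_model k x \<longleftrightarrow>
     (\<exists>C\<ge>1. \<forall>F\<in>schreier k. C_equivalent C F x (\<lambda>a. \<Sum>i\<in>F. \<bar>a i\<bar>))"

definition generates_c0_spreading_model :: "nat \<Rightarrow> (nat \<Rightarrow> 'a::real_normed_vector) \<Rightarrow> bool" where
  "generates_c0_spreading_model k x \<longleftrightarrow>
     (\<exists>C\<ge>1. \<forall>F\<in>schreier k. C_equivalent C F x (\<lambda>a. Max ((\<lambda>i. \<bar>a i\<bar>) ` F)))"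

(* A subsequence is x \<circ> r with r strictly increasing; then r 1 \<ge> 1, and every strictly increasing
   map of {1, 2, ...} into itself extends to such an r by r 0 = 0. *)
definition admits_l1_spreading_model :: "nat \<Rightarrow> (nat \<Rightarrow> 'a::real_normed_vector) \<Rightarrow> bool" where
  "admits_l1_spreading_model k x \<longleftrightarrow>
     (\<exists>r :: nat \<Rightarrow> nat. strict_mono r \<and> generates_l1_spreading_model k (x \<circ> r))"

definition admits_c0_spreading_model :: "nat \<Rightarrow> (nat \<Rightarrow> 'a::real_normed_vector) \<Rightarrow> bool" where
  "admits_c0_spreading_model k x \<longleftrightarrow>
     (\<exists>r :: nat \<Rightarrow> nat. strict_mono r \<and> generates_c0_spreading_model k (x \<circ> r))"

end

(* Let k be the largest number in {1,...,n} such that some subsequence generates an l_1^k spreading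
   model. It suffices to show that no weakly null sequence admits l_1^(n+1), and that a weakly null
   sequence without a c_0 spreading model admits l_1^1. A gliding hump argument reduces both claims
   to block sequences (y_i).

   If for some eps > 0 arbitrarily late y_i are hit by more than eps in total by S_(n-1)-admissible
   very fast growing averages of arbitrarily large size, then such families, restricted to the
   ranges of sparse y_i, can be united over Schreier sets to S_n-admissible ones, which gives l_1^1.
   Otherwise consider a functional alpha_1 + alpha_2 + ... of the norming set. Apart from the first
   alpha that acts on the y_i at all, the averages have sizes exceeding the supports already passed,
   so their total contribution is negligible, while the first one is an average, over at least two
   parts, of functionals of lower complexity. Induction over the norming set bounds sums of y_i over
   Schreier sets, which gives c_0. The same induction shows that special convex combinations over
   S_(n+1)-sets have small norm, which excludes l_1^(n+1). *)

theory Submission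
  imports Defs
begin

section \<open>Schreier families\<close>

text \<open>The obstacle is the depth of a functional in W. A bound proved level by level would lose
  a constant at each level, and the first average of a Schreier sum may have size only 2. Both upper
  estimates therefore show, for every f in W and for all sets J of blocks at once, a bound A + b *
  mu J, where mu adds up majorants of the block norms. The constant A is the same at every level.
  Even an average of size 2 halves the coefficient b, and what is saved pays for the errors made at
  that level, so nothing accumulates with depth. All J have to be treated together because an
  average distributes the blocks among its parts. In the c_0 case b is of order 1 / Min F while mu F
  is at most Min F * M, so b * mu F stays bounded. For special convex combinations mu F is fixed; b
  is chosen small first, and only then is the combination made so fine that A is small, although A
  contains 1 / b.\<close>

lemma schreier_basic:
  assumes "F \<in> schreier k"
  shows "finite F" "F \<noteq> {}" "0 \<notin> F"
proof -
  have "F \<in> schreier k \<Longrightarrow> finite F \<and> F \<noteq> {} \<and> 0 \<notin> F"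
  proof (induction k arbitrary: F rule: schreier.induct)
    case 2
    then have "finite F" "F \<noteq> {}" "card F \<le> Min F" by auto
    moreover from this have "0 < card F" by (simp add: card_gt_0_iff)
    ultimately show ?case using Min_le[of F 0] by auto
  next
    case (3 m)
    then obtain Fs where Fs: "F = \<Union>(set Fs)" "Fs \<noteq> []" "set Fs \<subseteq> schreier (Suc m)" by auto
    with 3(1) have *: "finite H \<and> H \<noteq> {} \<and> 0 \<notin> H" if "H \<in> set Fs" for H using that by blast
    then show ?case using Fs(1,2) by (cases Fs) auto
  qed auto
  with assms show "finite F" "F \<noteq> {}" "0 \<notin> F" by auto
qed

lemma set_lessD: "set_less E F \<Longrightarrow> finite E \<Longrightarrow> finite F \<Longrightarrow> e \<in> E \<Longrightarrow> f \<in> F \<Longrightarrow> e < f"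
  unfolding set_less_def by (meson Max_ge Min_le le_less_trans less_le_trans)

lemma set_lessI:
  assumes "finite E" "finite F" "E \<noteq> {}" "F \<noteq> {}" "\<And>e f. e \<in> E \<Longrightarrow> f \<in> F \<Longrightarrow> e < f"
  shows "set_less E F"
  unfolding set_less_def using assms by (simp add: Max_in Min_in)

text \<open>Turns the bound \<open>length Fs \<le> Min (hd Fs)\<close> into a bound by any chosen
  element of the union, which is how the number of pieces is controlled below.\<close>

lemma Min_hd_le:
  assumes "sorted_wrt set_less Fs" "\<And>H. H \<in> set Fs \<Longrightarrow> finite H \<and> H \<noteq> {}" "x \<in> \<Union>(set Fs)"
  shows "Min (hd Fs) \<le> x"
proof (cases Fs)
  case (Cons H Hs)
  obtain H' where H': "H' \<in> set Fs" "x \<in> H'" using assms(3) by blast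
  show ?thesis
  proof (cases "H' = H")
    case True
    then show ?thesis using Cons assms(2) H' by simp
  next
    case False
    then have "set_less H H'" using Cons assms(1) H' by auto
    then have "Min H < x" using Cons assms(2) H' by (intro set_lessD[of H H']) auto
    then show ?thesis using Cons by simp
  qed
qed (use assms in auto)

text \<open>The defining equations treat S_1 separately. Writing an S_1 set as the successive union
  of its singletons makes the recursion uniform from S_0 on, so that later inductions need no extra
  case.\<close>

lemma schreier_Suc:
  "F \<in> schreier (Suc k) \<longleftrightarrow>
    (\<exists>Fs. Fs \<noteq> [] \<and> set Fs \<subseteq> schreier k \<and> sorted_wrt set_less Fs \<and> length Fs \<le> Min (hd Fs)
      \<and> F = \<Union>(set Fs))"
proof (cases k)
  case (Suc m)
  then show ?thesis by auto
next
  case 0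
  have "\<exists>Fs. Fs \<noteq> [] \<and> set Fs \<subseteq> schreier k \<and> sorted_wrt set_less Fs \<and> length Fs \<le> Min (hd Fs)
      \<and> F = \<Union>(set Fs)" if F: "F \<in> schreier (Suc 0)"
  proof -
    have fin: "finite F" "F \<noteq> {}" "0 \<notin> F" using schreier_basic[OF F] by auto
    have c: "card F \<le> Min F" using F by auto
    let ?xs = "sorted_list_of_set F"
    have ne: "?xs \<noteq> []" using fin by simp
    have hd: "hd ?xs = Min F" using sorted_list_of_set_nonempty[of F] fin by simp
    show ?thesis
    proof (intro exI[of _ "map (\<lambda>m. {m}) ?xs"] conjI)
      show "set (map (\<lambda>m. {m}) ?xs) \<subseteq> schreier k"
        using 0 fin by (force simp: Suc_le_eq intro: gr0I)
      have "sorted_wrt (<) ?xs" by simp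
      then show "sorted_wrt set_less (map (\<lambda>m. {m}) ?xs)"
        by (simp add: sorted_wrt_map set_less_def)
    qed (use ne hd c fin in \<open>auto simp: hd_map\<close>)
  qed
  moreover have "F \<in> schreier (Suc 0)" if Fs: "Fs \<noteq> []" "set Fs \<subseteq> schreier k"
    "sorted_wrt set_less Fs" "length Fs \<le> Min (hd Fs)" "F = \<Union>(set Fs)" for Fs
  proof -
    have sing: "\<exists>m\<ge>1. H = {m}" if "H \<in> set Fs" for H using that Fs(2) 0 by auto
    then have fin: "finite F" using Fs(5) by auto
    obtain H Hs where H: "Fs = H # Hs" using Fs(1) by (cases Fs) auto
    obtain m where m: "H = {m}" using sing H by auto
    have "F \<noteq> {}" using Fs(5) H m by auto
    have "card F \<le> (\<Sum>H\<in>set Fs. card H)"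
      unfolding Fs(5) by (rule card_Union_le_sum_card)
    also have "\<dots> = (\<Sum>H\<in>set Fs. 1)" by (rule sum.cong) (use sing in fastforce)+
    also have "\<dots> \<le> length Fs" by (simp add: card_length)
    also have "\<dots> \<le> m" using Fs(4) H m by simp
    also have "m \<le> Min F"
    proof (rule Min.boundedI)
      fix a assume "a \<in> F"
      then obtain K where K: "K \<in> set Fs" "a \<in> K" using Fs(5) by auto
      then obtain b where "K = {b}" using sing by auto
      then show "m \<le> a" using K H m Fs(3) by (auto simp: set_less_def less_imp_le)
    qed fact+
    finally show ?thesis using fin \<open>F \<noteq> {}\<close> by simp
  qed
  ultimately show ?thesis using 0 by metis
qed

text \<open>The Schreier families are both hereditary and spreading; using an auxiliary index set
  \<open>G\<close> lets one lemma cover both.\<close>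

lemma schreier_spread:
  fixes \<psi> \<phi> :: "nat \<Rightarrow> nat"
  assumes "F \<in> schreier k" "finite G" "G \<noteq> {}" "strict_mono_on G \<psi>" "strict_mono_on G \<phi>"
    "\<psi> ` G \<subseteq> F" "\<And>g. g \<in> G \<Longrightarrow> \<psi> g \<le> \<phi> g"
  shows "\<phi> ` G \<in> schreier k"
  using assms
proof (induction k arbitrary: F G)
  case 0
  then obtain m where m: "F = {m}" "1 \<le> m" by auto
  obtain g where g: "g \<in> G" using 0 by auto
  have "inj_on \<psi> G" using 0 by (simp add: strict_mono_on_imp_inj_on)
  with 0 m g have "G = {g}" by (auto simp: inj_on_def image_subset_iff)
  then show ?case using 0 m by force
next
  case (Suc k)
  then obtain Fs where Fs: "Fs \<noteq> []" "set Fs \<subseteq> schreier k" "sorted_wrt set_less Fs"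
    "length Fs \<le> Min (hd Fs)" "F = \<Union>(set Fs)" unfolding schreier_Suc by blast
  have finF: "finite H" "H \<noteq> {}" if "H \<in> set Fs" for H using that Fs(2) schreier_basic by blast+
  let ?G = "\<lambda>H. {g \<in> G. \<psi> g \<in> H}"
  let ?hit = "\<lambda>H. \<exists>g\<in>G. \<psi> g \<in> H"
  \<comment> \<open>The decomposition of \<open>F\<close> is pulled back by \<psi> and pushed
    forward by \<phi>; pieces that the image under \<psi> misses are dropped.\<close>
  define Gs where "Gs = map (\<lambda>H. \<phi> ` ?G H) (filter ?hit Fs)"
  have un: "\<phi> ` G = \<Union>(set Gs)" using Suc.prems(6) Fs(5) by (force simp: Gs_def)
  have ne: "Gs \<noteq> []"
    using un Suc.prems(3) by auto
  have sch: "\<phi> ` ?G H \<in> schreier k" if H: "H \<in> set Fs" "?hit H" for H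
    by (rule Suc.IH[of H])
      (use H Fs(2) Suc.prems in \<open>auto simp: strict_mono_on_def\<close>)
  have sorted: "sorted_wrt set_less Gs"
    unfolding Gs_def sorted_wrt_map
  proof (rule sorted_wrt_mono_rel[OF _ sorted_wrt_filter[OF Fs(3)]])
    fix H H' assume *: "H \<in> set (filter ?hit Fs)" "H' \<in> set (filter ?hit Fs)" "set_less H H'"
    show "set_less (\<phi> ` ?G H) (\<phi> ` ?G H')"
    proof (rule set_lessI)
      fix e f assume "e \<in> \<phi> ` ?G H" "f \<in> \<phi> ` ?G H'"
      then obtain g g' where g: "g \<in> G" "\<psi> g \<in> H" "e = \<phi> g" "g' \<in> G" "\<psi> g' \<in> H'" "f = \<phi> g'" by auto
      have "\<psi> g < \<psi> g'" using set_lessD[OF *(3)] * g finF by auto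
      then have "g < g'" using Suc.prems(4) g by (metis strict_mono_on_less)
      then show "e < f" using Suc.prems(5) g by (metis strict_mono_onD)
    qed (use * Suc.prems(2) in auto)
  qed
  have "hd Gs \<in> set Gs" using ne by simp
  then obtain H where H: "hd Gs = \<phi> ` ?G H" "H \<in> set Fs" "?hit H" by (auto simp: Gs_def)
  have "Min (hd Gs) \<in> hd Gs" unfolding H using H Suc.prems(2) by (intro Min_in) auto
  then obtain g where g: "g \<in> G" "\<psi> g \<in> H" "Min (hd Gs) = \<phi> g" using H by auto
  \<comment> \<open>Moving points to the right can only raise the minimum, and the number of pieces
    has not grown.\<close>
  have "length Gs \<le> length Fs" by (simp add: Gs_def)
  also have "\<dots> \<le> Min (hd Fs)" by fact
  also have "\<dots> \<le> \<psi> g"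
    by (rule Min_hd_le[OF Fs(3)]) (use finF H(2) g(2) in auto)
  also have "\<dots> \<le> Min (hd Gs)" using g Suc.prems(7) by simp
  finally have len: "length Gs \<le> Min (hd Gs)" .
  have "set Gs \<subseteq> schreier k" using sch by (auto simp: Gs_def)
  with un ne sorted len show ?case unfolding schreier_Suc by blast
qed

lemma schreier_subset: "F \<in> schreier k \<Longrightarrow> G \<subseteq> F \<Longrightarrow> G \<noteq> {} \<Longrightarrow> G \<in> schreier k"
  using schreier_spread[of F k G id id] schreier_basic(1)[of F k]
  by (auto simp: strict_mono_on_def dest: finite_subset)

lemma schreier_strict_mono_image:
  assumes "F \<in> schreier k" "strict_mono r"
  shows "r ` F \<in> schreier k"
  using schreier_spread[of F k F id r] schreier_basic[of F k] assms
  by (auto simp: strict_mono_on_def strict_mono_def strict_mono_imp_increasing)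

lemma schreier_singleton: "1 \<le> m \<Longrightarrow> {m} \<in> schreier k"
proof (induction k)
  case (Suc k)
  then show ?case unfolding schreier_Suc by (intro exI[of _ "[{m}]"]) auto
qed auto

section \<open>Special convex combinations\<close>

lemma sum_Union_le_sum:
  fixes f :: "'a \<Rightarrow> real"
  assumes "finite I" "\<And>i. i \<in> I \<Longrightarrow> finite (B i)" "\<And>x. 0 \<le> f x"
  shows "sum f (\<Union>i\<in>I. B i) \<le> (\<Sum>i\<in>I. sum f (B i))"
  using assms(1,2)
proof (induction I rule: finite_induct)
  case (insert i I)
  have "sum f (\<Union>i\<in>insert i I. B i) \<le> sum f (B i) + sum f (\<Union>i\<in>I. B i)"
    using insert sum.union_inter[of "B i" "\<Union>i\<in>I. B i" f] sum_nonneg[of "B i \<inter> (\<Union>i\<in>I. B i)" f] assms(3)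
    by (simp add: insert.prems)
  then show ?case using insert by (simp add: insert.prems)
qed simp

text \<open>The relabelling \<open>t\<close> is needed because \<open>F\<close> is a set of indices of a block sequence, while smallness
  is tested on sets of positions in the supports of the blocks.\<close>

lemma special_convex_combination:
  fixes t :: "nat \<Rightarrow> nat"
  assumes t: "strict_mono t" "\<And>i. i < t i" and "0 < \<epsilon>"
  shows "\<exists>F w. F \<in> schreier (Suc k) \<and> N \<le> Min F \<and> (\<forall>i. 0 \<le> (w i :: real)) \<and> (\<forall>i. i \<notin> F \<longrightarrow> w i = 0)
    \<and> sum w F = 1 \<and> (\<forall>G\<subseteq>F. t ` G \<in> schreier k \<longrightarrow> sum w G \<le> \<epsilon>)"
  using \<open>0 < \<epsilon>\<close>
proof (induction k arbitrary: \<epsilon> N)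
  case 0
  obtain K where K: "1 / \<epsilon> < real K" using reals_Archimedean2 by blast
  define L where "L = Suc (max N K)"
  \<comment> \<open>Uniform weights on an interval that is an S_1 set because it has L elements and
    minimum L.\<close>
  let ?F = "{L..<2*L}"
  define w where "w = (\<lambda>i. if i \<in> ?F then 1 / real L else 0)"
  have L: "0 < L" "N \<le> L" "1 / real L \<le> \<epsilon>"
  proof -
    have "1 < \<epsilon> * real K" using K 0 by (simp add: field_simps)
    also have "\<dots> \<le> \<epsilon> * real L" using 0 by (intro mult_left_mono) (auto simp: L_def)
    finally show "1 / real L \<le> \<epsilon>" by (simp add: L_def field_simps)
  qed (auto simp: L_def)
  have Min: "Min ?F = L" using L by (intro Min_eqI) auto
  have "sum w G \<le> \<epsilon>" if G: "G \<subseteq> ?F" "t ` G \<in> schreier 0" for G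
  proof -
    obtain m where m: "t ` G = {m}" using G by auto
    have "inj t" using t by (simp add: strict_mono_imp_inj_on)
    then have "card G = 1" using m by (metis card_image inj_on_subset is_singletonI is_singleton_altdef subset_UNIV)
    then obtain g where "G = {g}" by (auto simp: card_1_singleton_iff)
    then show ?thesis using L G by (auto simp: w_def)
  qed
  then show ?case using L Min by (intro exI[of _ ?F] exI[of _ w]) (auto simp: w_def)
next
  case (Suc k)
  obtain K0 where K0: "2 / \<epsilon> < real K0" using reals_Archimedean2 by blast
  \<comment> \<open>K successive special combinations will be averaged. Before division by K, the
    first one met by a test set costs at most 1 and each later one at most \<epsilon> / 2; hence the
    requirement 1 / K \<le> \<epsilon> / 2. Starting beyond K makes the union of the K sets a
    Schreier set of the next order.\<close>
  define K where "K = Suc (max N K0)"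
  have K: "0 < K" "N \<le> K" "1 / real K \<le> \<epsilon> / 2" 
  proof -
    have "2 < \<epsilon> * real K0" using K0 Suc.prems by (simp add: field_simps)
    also have "\<dots> \<le> \<epsilon> * real K" using Suc.prems by (intro mult_left_mono) (auto simp: K_def)
    finally show "1 / real K \<le> \<epsilon> / 2" by (simp add: K_def field_simps)
  qed (auto simp: K_def)
  define good where "good = (\<lambda>(d::real) (F, w :: nat \<Rightarrow> real). F \<in> schreier (Suc k) \<and> (\<forall>i. 0 \<le> w i) \<and>
      (\<forall>i. i \<notin> F \<longrightarrow> w i = 0) \<and> sum w F = 1 \<and> (\<forall>G\<subseteq>F. t ` G \<in> schreier k \<longrightarrow> sum w G \<le> d))"
  have ex: "\<exists>A. good d A \<and> N' \<le> Min (fst A)" if "0 < d" for d N'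
    using Suc.IH[OF that, of N'] by (auto simp: good_def)
  \<comment> \<open>Tolerance for the next combination. A test set with image in S_(k+1) that
    already meets the current combination splits into at most t (Max (fst A)) pieces of S_k, so its
    share of the next combination is at most \<epsilon> / 2.\<close>
  let ?d = "\<lambda>A :: nat set \<times> (nat \<Rightarrow> real). \<epsilon> / (2 * real (t (Max (fst A))))"
  have dpos: "0 < ?d A" for A using t(2)[of "Max (fst A)"] Suc.prems by simp
  have "\<exists>A. \<forall>j. (K \<le> Min (fst (A j)) \<and> (\<exists>d. good d (A j))) \<and>
      (Max (fst (A j)) < Min (fst (A (Suc j))) \<and> good (?d (A j)) (A (Suc j)))"
  proof (rule dependent_nat_choice)
    show "\<exists>A. K \<le> Min (fst A) \<and> (\<exists>d. good d A)" using ex[of 1 K] by auto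
    fix A :: "nat set \<times> (nat \<Rightarrow> real)" and j :: nat
    show "\<exists>B. (K \<le> Min (fst B) \<and> (\<exists>d. good d B)) \<and> (Max (fst A) < Min (fst B) \<and> good (?d A) B)"
      using ex[OF dpos[of A], of "max K (Suc (Max (fst A)))"] by (metis Suc_le_eq max.bounded_iff)
  qed
  then obtain A where A: "\<And>j. K \<le> Min (fst (A j))" "\<And>j. \<exists>d. good d (A j)"
    "\<And>j. Max (fst (A j)) < Min (fst (A (Suc j)))" "\<And>j. good (?d (A j)) (A (Suc j))"
    by blast
  define F where "F = (\<lambda>j. fst (A j))"
  define v where "v = (\<lambda>j. snd (A j))"
  have F: "F j \<in> schreier (Suc k)" and v0: "0 \<le> v j i" and vF: "i \<notin> F j \<Longrightarrow> v j i = 0"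
    and vsum: "sum (v j) (F j) = 1" for i j
    using A(2)[of j] by (auto simp: good_def F_def v_def case_prod_beta)
  have small: "sum (v (Suc j)) G \<le> \<epsilon> / (2 * real (t (Max (F j))))" if "G \<subseteq> F (Suc j)" "t ` G \<in> schreier k" for G j
    using A(4)[of j] that by (auto simp: good_def F_def v_def case_prod_beta)
  have fin: "finite (F j)" and ne: "F j \<noteq> {}" for j using schreier_basic[OF F] by auto
  have step: "Max (F j) < Min (F (Suc j))" for j using A(3) by (simp add: F_def)
  have less: "Max (F i) < Min (F j)" if "i < j" for i j
    using that
  proof (induction j)
    case (Suc j)
    have "Max (F i) \<le> Max (F j)"
    proof (cases "i = j")
      case False
      with Suc have "Max (F i) < Min (F j)" by simp
      also have "Min (F j) \<le> Max (F j)" using fin ne by simp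
      finally show ?thesis by simp
    qed simp
    then show ?case using step[of j] by simp
  qed simp
  have disj: "F i \<inter> F j = {}" if "i \<noteq> j" for i j
  proof -
    have "F i \<inter> F j = {}" if "i < j" for i j
      using less[OF that] set_lessD[of "F i" "F j"] fin by (fastforce simp: set_less_def)
    then show ?thesis using \<open>i \<noteq> j\<close> by (metis inf_commute linorder_neqE_nat)
  qed
  define U where "U = (\<Union>j<K. F j)"
  define w where "w = (\<lambda>i. (\<Sum>j<K. v j i) / real K)"
  have sumw: "sum w G = (\<Sum>j<K. sum (v j) (G \<inter> F j)) / real K" if "finite G" for G
  proof -
    have "sum w G = (\<Sum>j<K. sum (v j) G) / real K"
      unfolding w_def by (simp add: sum_divide_distrib[symmetric] sum.swap[of _ G])
    also have "(\<Sum>j<K. sum (v j) G) = (\<Sum>j<K. sum (v j) (G \<inter> F j))"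
      by (intro sum.cong refl sum.mono_neutral_right) (use that vF in auto)
    finally show ?thesis .
  qed
  have "U \<in> schreier (Suc (Suc k))"
    unfolding schreier_Suc[of _ "Suc k"]
  proof (intro exI[of _ "map F [0..<K]"] conjI)
    show "sorted_wrt set_less (map F [0..<K])"
      unfolding sorted_wrt_map by (rule sorted_wrt_mono_rel[OF _ sorted_wrt_upt]) (simp add: set_less_def less)
    have "hd (map F [0..<K]) = F 0" using K by (simp add: hd_map)
    then show "length (map F [0..<K]) \<le> Min (hd (map F [0..<K]))" using A(1)[of 0] by (simp add: F_def)
  qed (use K F in \<open>auto simp: U_def\<close>)
  note finU = schreier_basic(1)[OF this] and neU = schreier_basic(2)[OF this]
  have "N \<le> Min U"
  proof (rule Min.boundedI[OF finU neU])
    fix a assume "a \<in> U"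
    then obtain j where "a \<in> F j" by (auto simp: U_def)
    then have "Min (F j) \<le> a" using fin by simp
    then show "N \<le> a" using A(1)[of j] K by (simp add: F_def)
  qed
  moreover have "sum w U = 1"
  proof -
    have "U \<inter> F j = F j" if "j < K" for j using that by (auto simp: U_def)
    then show ?thesis using sumw[OF finU] vsum K by simp
  qed
  moreover have "sum w G \<le> \<epsilon>" if G: "G \<subseteq> U" "t ` G \<in> schreier (Suc k)" for G
  proof -
    have finG: "finite G" using G finU finite_subset by blast
    have neG: "G \<noteq> {}" using schreier_basic(2)[OF G(2)] by auto
    then have exj: "\<exists>j. j < K \<and> G \<inter> F j \<noteq> {}" using G(1) by (auto simp: U_def)
    \<comment> \<open>The combination in which the test set starts; its position bounds the number
      of S_k pieces.\<close>
    define j0 where "j0 = (LEAST j. j < K \<and> G \<inter> F j \<noteq> {})"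
    have j0: "j0 < K" "G \<inter> F j0 \<noteq> {}" using LeastI_ex[OF exj] by (auto simp: j0_def)
    have before: "G \<inter> F j = {}" if "j < j0" for j using not_less_Least[OF that[unfolded j0_def]] that j0(1) by simp
    obtain Hs where Hs: "Hs \<noteq> []" "set Hs \<subseteq> schreier k" "sorted_wrt set_less Hs" "length Hs \<le> Min (hd Hs)"
      "t ` G = \<Union>(set Hs)" using G(2) unfolding schreier_Suc by blast
    obtain g0 where g0: "g0 \<in> G" "g0 \<in> F j0" using j0 by auto
    have len: "length Hs \<le> t (Max (F j0))"
    proof -
      have "finite H \<and> H \<noteq> {}" if "H \<in> set Hs" for H using that Hs(2) schreier_basic by blast
      moreover have "t g0 \<in> \<Union>(set Hs)" using g0 Hs(5) by auto
      ultimately have "Min (hd Hs) \<le> t g0" using Min_hd_le[OF Hs(3)] by blast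
      moreover have "t g0 \<le> t (Max (F j0))" using g0 fin t by (simp add: strict_mono_less_eq)
      ultimately show ?thesis using Hs(4) by simp
    qed
    have later: "sum (v j) (G \<inter> F j) \<le> \<epsilon> / 2" if "j0 < j" for j
    proof -
      define i where "i = j - 1"
      have i: "j = Suc i" "j0 \<le> i" using that by (auto simp: i_def)
      have "Max (F j0) \<le> Max (F i)"
        using less[of j0 i] i fin ne by (cases "j0 = i") (auto intro: order_trans[OF less_imp_le Min_le[OF _ Max_in]])
      then have ti: "t (Max (F j0)) \<le> t (Max (F i))" using t by (simp add: strict_mono_less_eq)
      have "sum (v j) (G \<inter> F j) \<le> sum (v j) (\<Union>H\<in>set Hs. {g \<in> G \<inter> F j. t g \<in> H})"
        by (rule sum_mono2) (use finG Hs(5) v0 in auto)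
      also have "\<dots> \<le> (\<Sum>H\<in>set Hs. sum (v j) {g \<in> G \<inter> F j. t g \<in> H})"
        by (rule sum_Union_le_sum) (use finG v0 in auto)
      also have "\<dots> \<le> (\<Sum>H\<in>set Hs. \<epsilon> / (2 * real (t (Max (F i)))))"
      proof (rule sum_mono)
        fix H assume H: "H \<in> set Hs"
        show "sum (v j) {g \<in> G \<inter> F j. t g \<in> H} \<le> \<epsilon> / (2 * real (t (Max (F i))))"
        proof (cases "{g \<in> G \<inter> F j. t g \<in> H} = {}")
          case True
          then show ?thesis unfolding True using Suc.prems by simp
        next
          case False
          then have "t ` {g \<in> G \<inter> F j. t g \<in> H} \<in> schreier k"
            using H Hs(2) schreier_subset[of H k "t ` {g \<in> G \<inter> F j. t g \<in> H}"] by blast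
          then show ?thesis using small[of "{g \<in> G \<inter> F j. t g \<in> H}" i] i(1) by blast
        qed
      qed
      also have "\<dots> = real (card (set Hs)) * (\<epsilon> / (2 * real (t (Max (F i)))))" by simp
      also have "\<dots> \<le> real (t (Max (F i))) * (\<epsilon> / (2 * real (t (Max (F i)))))"
        using len ti card_length[of Hs] Suc.prems by (intro mult_right_mono) auto
      also have "\<dots> = \<epsilon> / 2" using t(2)[of "Max (F i)"] by simp
      finally show ?thesis .
    qed
    have "(\<Sum>j<K. sum (v j) (G \<inter> F j)) \<le> (\<Sum>j<K. (if j = j0 then 1 else 0) + \<epsilon> / 2)"
    proof (rule sum_mono)
      fix j assume "j \<in> {..<K}"
      consider "j < j0" | "j = j0" | "j0 < j" by linarith
      then show "sum (v j) (G \<inter> F j) \<le> (if j = j0 then 1 else 0) + \<epsilon> / 2"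
      proof cases
        case 1
        then show ?thesis using before Suc.prems by simp
      next
        case 2
        have "sum (v j) (G \<inter> F j) \<le> sum (v j) (F j)" by (rule sum_mono2) (use fin v0 in auto)
        then show ?thesis using 2 vsum Suc.prems by simp
      next
        case 3
        then show ?thesis using later by simp
      qed
    qed
    also have "\<dots> = 1 + real K * (\<epsilon> / 2)" using j0 by (simp add: sum.distrib sum.delta)
    finally have "sum w G \<le> (1 + real K * (\<epsilon> / 2)) / real K"
      unfolding sumw[OF finG] by (rule divide_right_mono) simp
    also have "\<dots> = 1 / real K + \<epsilon> / 2" using K by (simp add: field_simps)
    finally show ?thesis using K by simp
  qed
  moreover have "\<forall>i. 0 \<le> w i" by (auto simp: w_def v0 sum_nonneg)
  moreover have "\<forall>i. i \<notin> U \<longrightarrow> w i = 0" by (auto simp: w_def U_def vF)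
  ultimately show ?case using \<open>U \<in> _\<close> by (intro exI[of _ U] exI[of _ w]) blast
qed

section \<open>The norming set\<close>

text \<open>\<open>vec_less\<close>, \<open>Min\<close> and \<open>Max\<close> are meaningful only
  for finite nonempty supports; without this, \<open>vec_less f g\<close> would not separate the two
  supports.\<close>

definition proper :: "(nat \<Rightarrow> real) \<Rightarrow> bool" where
  "proper f \<longleftrightarrow> finite (supp f) \<and> supp f \<noteq> {} \<and> f 0 = 0"

lemma vec_lessD: "vec_less f g \<Longrightarrow> proper f \<Longrightarrow> proper g \<Longrightarrow> i \<in> supp f \<Longrightarrow> j \<in> supp g \<Longrightarrow> i < j"
  unfolding vec_less_def proper_def using set_lessD by blast

lemma vec_lessI: "proper f \<Longrightarrow> proper g \<Longrightarrow> (\<And>i j. i \<in> supp f \<Longrightarrow> j \<in> supp g \<Longrightarrow> i < j) \<Longrightarrow> vec_less f g"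
  unfolding vec_less_def proper_def by (intro set_lessI) auto

lemma proper_Min: "proper f \<Longrightarrow> Min (supp f) \<in> supp f"
  and proper_Max: "proper f \<Longrightarrow> Max (supp f) \<in> supp f"
  by (simp_all add: proper_def Min_in Max_in)

lemma proper_ge_1: "proper f \<Longrightarrow> i \<in> supp f \<Longrightarrow> 1 \<le> i"
  by (cases i) (auto simp: proper_def supp_def)

lemma successive_sum_zero:
  assumes "\<And>f. f \<in> set fs \<Longrightarrow> i \<notin> supp f"
  shows "(\<Sum>f\<leftarrow>fs. f i) = 0"
  using assms by (induction fs) (auto simp: supp_def)

lemma successive_sum_eq:
  assumes "sorted_wrt vec_less fs" "\<And>f. f \<in> set fs \<Longrightarrow> proper f" "f \<in> set fs" "i \<in> supp f"
  shows "(\<Sum>f\<leftarrow>fs. f i) = f i"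
  using assms
proof (induction fs)
  case (Cons g fs)
  show ?case
  proof (cases "f = g")
    case True
    have "i \<notin> supp h" if "h \<in> set fs" for h
    proof
      assume "i \<in> supp h"
      then have "i < i" using Cons.prems that True by (intro vec_lessD[of g h]) auto
      then show False by simp
    qed
    then show ?thesis using True successive_sum_zero[of fs i] by simp
  next
    case False
    then have f: "f \<in> set fs" using Cons.prems by simp
    have "i \<notin> supp g"
    proof
      assume "i \<in> supp g"
      then have "i < i" using Cons.prems f by (intro vec_lessD[of g f]) auto
      then show False by simp
    qed
    then show ?thesis using Cons f by (simp add: supp_def)
  qed
qed simp

lemma successive_sum_cases:
  assumes "sorted_wrt vec_less fs" "\<And>f. f \<in> set fs \<Longrightarrow> proper f"
  obtains f where "f \<in> set fs" "i \<in> supp f" "(\<Sum>f\<leftarrow>fs. f i) = f i"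
  | "\<And>f. f \<in> set fs \<Longrightarrow> i \<notin> supp f" "(\<Sum>f\<leftarrow>fs. f i) = 0"
  using successive_sum_eq[OF assms, of _ i] successive_sum_zero[of fs i] by blast

lemma successive_sum_supp:
  assumes "sorted_wrt vec_less fs" "\<And>f. f \<in> set fs \<Longrightarrow> proper f"
  shows "supp (\<lambda>i. \<Sum>f\<leftarrow>fs. f i) = (\<Union>f\<in>set fs. supp f)"
proof (intro set_eqI iffI)
  fix i assume "i \<in> supp (\<lambda>i. \<Sum>f\<leftarrow>fs. f i)"
  then have "(\<Sum>f\<leftarrow>fs. f i) \<noteq> 0" by (simp add: supp_def)
  then show "i \<in> (\<Union>f\<in>set fs. supp f)" using successive_sum_zero[of fs i] by blast
next
  fix i assume "i \<in> (\<Union>f\<in>set fs. supp f)"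
  then obtain f where f: "f \<in> set fs" "i \<in> supp f" by auto
  then have "(\<Sum>f\<leftarrow>fs. f i) = f i" using successive_sum_eq[OF assms] by blast
  then show "i \<in> supp (\<lambda>i. \<Sum>f\<leftarrow>fs. f i)" using f by (simp add: supp_def)
qed

lemma successive_sum_proper:
  assumes "sorted_wrt vec_less fs" "\<And>f. f \<in> set fs \<Longrightarrow> proper f" "fs \<noteq> []"
  shows "proper (\<lambda>i. \<Sum>f\<leftarrow>fs. f i)"
  unfolding proper_def successive_sum_supp[OF assms(1,2), simplified]
proof (intro conjI)
  show "finite (\<Union>f\<in>set fs. supp f)" "(\<Union>f\<in>set fs. supp f) \<noteq> {}"
    using assms by (auto simp: proper_def)
  show "(\<Sum>f\<leftarrow>fs. f 0) = 0" using assms(2) by (intro successive_sum_zero) (auto simp: proper_def supp_def)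
qed

lemma average_proper:
  assumes "sorted_wrt vec_less fs" "\<And>f. f \<in> set fs \<Longrightarrow> proper f" "fs \<noteq> []" "2 \<le> l"
  shows "proper (average l fs)"
proof -
  have "supp (average l fs) = supp (\<lambda>i. \<Sum>f\<leftarrow>fs. f i)"
    using assms(4) by (auto simp: supp_def average_def)
  then show ?thesis using successive_sum_proper[OF assms(1-3)] by (simp add: proper_def average_def)
qed

lemma unit_vec_supp [simp]: "supp (unit_vec i) = {i}" "supp (\<lambda>j. - unit_vec i j) = {i}"
  by (auto simp: supp_def unit_vec_def)

text \<open>Very fast growing sequences are described pairwise rather than by consecutive terms, so that
  the condition visibly passes to subsequences.\<close>

definition growing :: "sized_average \<Rightarrow> sized_average \<Rightarrow> bool" where
  "growing a b \<longleftrightarrow> vec_less (fst a) (fst b) \<and> snd a < snd b \<and> Max (supp (fst a)) < snd b"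

lemma vec_less_imp_Max_less:
  assumes "vec_less f g" "proper f" "proper g"
  shows "Max (supp f) < Max (supp g)"
  using vec_lessD[OF assms] proper_Max assms by blast

lemma growing_Min_less:
  assumes "growing a b" "proper (fst a)" "proper (fst b)"
  shows "Min (supp (fst a)) < Min (supp (fst b))"
  using vec_lessD[of "fst a" "fst b"] proper_Min assms unfolding growing_def by blast

text \<open>The maxima of the supports increase along successive vectors, so a size exceeding the
  maximum of the immediate predecessor exceeds those of all predecessors.\<close>

lemma very_fast_growing_iff:
  assumes "\<And>a. a \<in> set as \<Longrightarrow> proper (fst a)"
  shows "very_fast_growing as \<longleftrightarrow> sorted_wrt growing as"
proof
  assume vfg: "very_fast_growing as"
  then have vl: "sorted_wrt vec_less (map fst as)" and sz: "sorted_wrt (<) (map snd as)"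
    and mx: "\<And>q. Suc q < length as \<Longrightarrow> Max (supp (fst (as ! q))) < snd (as ! Suc q)"
    by (auto simp: very_fast_growing_def)
  show "sorted_wrt growing as"
    unfolding sorted_wrt_iff_nth_less
  proof (intro allI impI)
    fix i j assume ij: "i < j" "j < length as"
    have v: "vec_less (fst (as ! p)) (fst (as ! q))" if "p < q" "q < length as" for p q
      using vl that by (auto simp: sorted_wrt_iff_nth_less)
    have "Max (supp (fst (as ! i))) \<le> Max (supp (fst (as ! (j - 1))))"
    proof (cases "i = j - 1")
      case False
      then show ?thesis using ij assms by (intro less_imp_le vec_less_imp_Max_less v) auto
    qed simp
    also have "\<dots> < snd (as ! j)" using mx[of "j - 1"] ij by simp
    finally show "growing (as ! i) (as ! j)"
      using v[OF ij] sz ij by (auto simp: growing_def sorted_wrt_iff_nth_less)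
  qed
next
  assume "sorted_wrt growing as"
  then show "very_fast_growing as"
    by (auto simp: very_fast_growing_def sorted_wrt_iff_nth_less growing_def)
qed

section \<open>The norming set without its levels\<close>

lemma W_level_mono: "m \<le> m' \<Longrightarrow> W_level n m \<subseteq> W_level n m'"
  by (induction m' rule: dec_induct) auto

text \<open>An average or a Schreier sum involves only finitely many functionals, so one level
  contains them all; this closes the union of the levels under both operations.\<close>

lemma finite_subset_W_level:
  assumes "finite X" "X \<subseteq> norming_set n"
  shows "\<exists>m. X \<subseteq> W_level n m"
  using assms
proof (induction X rule: finite_induct)
  case (insert f X)
  then obtain m m' where "X \<subseteq> W_level n m" "f \<in> W_level n m'" by (auto simp: norming_set_def)
  then have "insert f X \<subseteq> W_level n (max m m')"
    using W_level_mono[of m "max m m'" n] W_level_mono[of m' "max m m'" n] by auto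
  then show ?case by blast
qed auto

text \<open>Keeps the list of parts visible, which \<open>averages_of_size\<close> hides behind a
  quantifier; the estimates act on the parts.\<close>

definition average_of :: "(nat \<Rightarrow> real) set \<Rightarrow> sized_average \<Rightarrow> (nat \<Rightarrow> real) list \<Rightarrow> bool" where
  "average_of G a fs \<longleftrightarrow> fst a = average (snd a) fs \<and> fs \<noteq> [] \<and> set fs \<subseteq> G \<and> sorted_wrt vec_less fs
    \<and> length fs \<le> snd a \<and> 2 \<le> snd a"

lemma averages_of_size_iff: "f \<in> averages_of_size G l \<longleftrightarrow> (\<exists>fs. average_of G (f, l) fs)"
  by (auto simp: averages_of_size_def average_of_def)

lemma average_of_mono: "average_of G a fs \<Longrightarrow> G \<subseteq> H \<Longrightarrow> average_of H a fs"
  by (auto simp: average_of_def)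

text \<open>The \<open>\<S>\<^sub>k\<close>-admissible very fast growing sequences of \<open>\<alpha>\<close>-averages in \<open>W\<close>.\<close>

definition family :: "nat \<Rightarrow> nat \<Rightarrow> sized_average list \<Rightarrow> bool" where
  "family n k as \<longleftrightarrow> (\<forall>a\<in>set as. \<exists>fs. average_of (norming_set n) a fs) \<and> sorted_wrt growing as \<and>
    (\<lambda>a. Min (supp (fst a))) ` set as \<in> schreier k"

abbreviation list_sum :: "sized_average list \<Rightarrow> nat \<Rightarrow> real" where
  "list_sum as \<equiv> (\<lambda>i. \<Sum>a\<leftarrow>as. fst a i)"

lemma proper_unit: "1 \<le> i \<Longrightarrow> proper (unit_vec i)" "1 \<le> i \<Longrightarrow> proper (\<lambda>j. - unit_vec i j)"
  by (simp_all add: proper_def) (simp_all add: unit_vec_def)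

lemma list_sum_eq: "list_sum as = (\<lambda>i. \<Sum>f\<leftarrow>map fst as. f i)"
  by (simp add: comp_def)

lemma norming_set_proper: "f \<in> norming_set n \<Longrightarrow> proper f"
proof -
  have "f \<in> W_level n m \<Longrightarrow> proper f" for m
  proof (induction m arbitrary: f)
    case 0
    then show ?case using proper_unit by auto
  next
    case (Suc m)
    then consider "f \<in> W_level n m" | "f \<in> W_alpha (W_level n m)" | "f \<in> W_schreier n (W_level n m)" by auto
    then show ?case
    proof cases
      case 2
      then obtain l fs where "average_of (W_level n m) (f, l) fs"
        by (auto simp: W_alpha_def averages_of_size_iff)
      then show ?thesis using Suc.IH by (auto simp: average_of_def intro!: average_proper)
    next
      case 3
      then obtain as where as: "f = list_sum as" "as \<noteq> []" "\<forall>a\<in>set as. alpha_average (W_level n m) a" "admissible n as"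
        by (auto simp: W_schreier_def)
      show ?thesis unfolding as(1) list_sum_eq
        by (rule successive_sum_proper) (use as Suc.IH in \<open>auto simp: admissible_def alpha_average_def\<close>)
    qed (use Suc in auto)
  qed
  moreover assume "f \<in> norming_set n"
  ultimately show ?thesis by (auto simp: norming_set_def)
qed

lemma average_of_proper: "average_of (norming_set n) a fs \<Longrightarrow> proper (fst a)"
  using norming_set_proper by (auto simp: average_of_def intro!: average_proper)

lemma family_proper: "family n k as \<Longrightarrow> a \<in> set as \<Longrightarrow> proper (fst a)"
  unfolding family_def using average_of_proper by blast

lemma unit_vec_in_norming_set: "1 \<le> i \<Longrightarrow> unit_vec i \<in> norming_set n"
  and neg_unit_vec_in_norming_set: "1 \<le> i \<Longrightarrow> (\<lambda>j. - unit_vec i j) \<in> norming_set n"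
  unfolding norming_set_def by (rule UN_I[of 0], simp, force)+

lemma average_in_norming_set:
  assumes "average_of (norming_set n) a fs"
  shows "fst a \<in> norming_set n"
proof -
  obtain m where "set fs \<subseteq> W_level n m"
    using finite_subset_W_level[of "set fs" n] assms by (auto simp: average_of_def)
  then have "average_of (W_level n m) (fst a, snd a) fs" using assms by (simp add: average_of_def)
  then have "fst a \<in> averages_of_size (W_level n m) (snd a)" using averages_of_size_iff by blast
  then have "fst a \<in> W_level n (Suc m)" by (auto simp: W_alpha_def)
  then show ?thesis unfolding norming_set_def by blast
qed

lemma family_sum_in_norming_set:
  assumes "family n n as"
  shows "list_sum as \<in> norming_set n"
proof -
  obtain fs where fs: "\<And>a. a \<in> set as \<Longrightarrow> average_of (norming_set n) a (fs a)"
    using assms unfolding family_def by metis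
  let ?X = "fst ` set as \<union> (\<Union>a\<in>set as. set (fs a))"
  have "fst a \<in> norming_set n" "set (fs a) \<subseteq> norming_set n" if "a \<in> set as" for a
    using average_in_norming_set[OF fs[OF that]] fs[OF that] by (auto simp: average_of_def)
  then have "?X \<subseteq> norming_set n" by blast
  then obtain m where m: "?X \<subseteq> W_level n m" using finite_subset_W_level[of ?X n] by auto
  have al: "alpha_average (W_level n m) a" if "a \<in> set as" for a
  proof -
    have "average_of (W_level n m) (fst a, snd a) (fs a)" using fs[OF that] m that by (auto simp: average_of_def)
    then show ?thesis using m that averages_of_size_iff by (auto simp: alpha_average_def)
  qed
  have "very_fast_growing as"
    using very_fast_growing_iff[of as] family_proper[OF assms] assms by (auto simp: family_def)
  moreover have "admissible n as"
    using assms by (auto simp: family_def admissible_def sorted_wrt_map growing_def elim: sorted_wrt_mono_rel[rotated])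
  moreover have "as \<noteq> []" using assms schreier_basic(2)[of "{}" n] by (auto simp: family_def)
  ultimately have "list_sum as \<in> W_level n (Suc m)" using al by (auto simp: W_schreier_def)
  then show ?thesis unfolding norming_set_def by blast
qed

text \<open>In the Schreier case the hypothesis is available for the parts of each average and not
  merely for the average itself. This is possible because an \<alpha>-average and its parts come
  from the same level, the one below the sum. The later estimates use it to regain the factor 1 / 2
  that an average provides.\<close>

lemma norming_set_induct [consumes 1, case_names unit neg_unit average schreier]:
  assumes f: "f \<in> norming_set n"
    and unit: "\<And>i. 1 \<le> i \<Longrightarrow> P (unit_vec i)"
    and neg: "\<And>i. 1 \<le> i \<Longrightarrow> P (\<lambda>j. - unit_vec i j)"
    and avg: "\<And>a fs. average_of (norming_set n) a fs \<Longrightarrow> (\<And>g. g \<in> set fs \<Longrightarrow> P g) \<Longrightarrow> P (fst a)"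
    and sch: "\<And>as. family n n as \<Longrightarrow>
      (\<And>a. a \<in> set as \<Longrightarrow> \<exists>fs. average_of (norming_set n) a fs \<and> (\<forall>g\<in>set fs. P g)) \<Longrightarrow> P (list_sum as)"
  shows "P f"
proof -
  have "f \<in> W_level n m \<Longrightarrow> P f" for m
  proof (induction m arbitrary: f)
    case 0
    then show ?case using unit neg by auto
  next
    case (Suc m)
    have sub: "W_level n m \<subseteq> norming_set n" by (auto simp: norming_set_def)
    from Suc.prems consider "f \<in> W_level n m" | "f \<in> W_alpha (W_level n m)" | "f \<in> W_schreier n (W_level n m)" by auto
    then show ?case
    proof cases
      case 2
      then obtain l fs where fs: "average_of (W_level n m) (f, l) fs"
        by (auto simp: W_alpha_def averages_of_size_iff)
      have "P (fst (f, l))"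
        by (rule avg[OF average_of_mono[OF fs sub]]) (use fs Suc.IH in \<open>auto simp: average_of_def\<close>)
      then show ?thesis by simp
    next
      case 3
      then obtain as where as: "f = list_sum as" "as \<noteq> []" "\<forall>a\<in>set as. alpha_average (W_level n m) a" "admissible n as"
        "very_fast_growing as"
        by (auto simp: W_schreier_def)
      have ex: "\<exists>fs. average_of (W_level n m) a fs" if "a \<in> set as" for a
        using as(3) that averages_of_size_iff[of "fst a" _ "snd a"] by (auto simp: alpha_average_def)
      have "proper (fst a)" if "a \<in> set as" for a
        using ex[OF that] sub average_of_mono average_of_proper by blast
      then have "sorted_wrt growing as" using as(5) very_fast_growing_iff by blast
      then have fam: "family n n as"
        using as(4) ex average_of_mono[OF _ sub] by (fastforce simp: family_def admissible_def)
      show ?thesis unfolding as(1)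
      proof (rule sch[OF fam])
        fix a assume "a \<in> set as"
        then obtain fs where fs: "average_of (W_level n m) a fs" using ex by blast
        then show "\<exists>fs. average_of (norming_set n) a fs \<and> (\<forall>g\<in>set fs. P g)"
          using Suc.IH average_of_mono[OF fs sub] unfolding average_of_def by blast
      qed
    qed (use Suc in auto)
  qed
  then show ?thesis using f by (auto simp: norming_set_def)
qed

text \<open>Successive functionals have disjoint supports, so at most one term of a sum is nonzero
  at a given coordinate. The bound makes the supremum in \<open>X01_norm\<close> finite.\<close>

lemma norming_set_abs_le_1:
  assumes "f \<in> norming_set n"
  shows "\<bar>f i\<bar> \<le> 1"
  using assms
proof (induction rule: norming_set_induct)
  case (average a fs)
  then have *: "sorted_wrt vec_less fs" "fst a = average (snd a) fs" "2 \<le> snd a" "\<And>f. f \<in> set fs \<Longrightarrow> proper f"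
    using norming_set_proper by (auto simp: average_of_def)
  have "\<bar>\<Sum>f\<leftarrow>fs. f i\<bar> \<le> 1"
    by (rule successive_sum_cases[OF *(1,4), of i]) (use average in auto)
  then have "\<bar>\<Sum>f\<leftarrow>fs. f i\<bar> \<le> real (snd a)" using *(3) by simp
  then show ?case using *(3) by (simp add: *(2) average_def abs_mult)
next
  case (schreier as)
  have *: "sorted_wrt vec_less (map fst as)" "\<And>f. f \<in> set (map fst as) \<Longrightarrow> proper f"
    using schreier(1) family_proper[OF schreier(1)]
    by (auto simp: family_def sorted_wrt_map growing_def elim: sorted_wrt_mono_rel[rotated])
  have b: "\<bar>fst a i\<bar> \<le> 1" if a: "a \<in> set as" for a
  proof -
    obtain fs where fs: "average_of (norming_set n) a fs" "\<forall>g\<in>set fs. \<bar>g i\<bar> \<le> 1" using schreier(2)[OF a] by blast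
    then have **: "sorted_wrt vec_less fs" "fst a = average (snd a) fs" "2 \<le> snd a" "\<And>f. f \<in> set fs \<Longrightarrow> proper f"
      using norming_set_proper by (auto simp: average_of_def)
    have "\<bar>\<Sum>f\<leftarrow>fs. f i\<bar> \<le> 1"
      by (rule successive_sum_cases[OF **(1,4), of i]) (use fs in auto)
    then have "\<bar>\<Sum>f\<leftarrow>fs. f i\<bar> \<le> real (snd a)" using **(3) by simp
    then show ?thesis using **(3) by (simp add: **(2) average_def abs_mult)
  qed
  show ?case
    unfolding list_sum_eq
    by (rule successive_sum_cases[OF *, of i]) (use b in \<open>auto simp: comp_def\<close>)
qed (auto simp: unit_vec_def)

text \<open>Restriction and sign change in one operation, so that a single closure proof gives both
  the symmetry of W and the restriction of functionals to intervals.\<close>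

definition clip :: "real \<Rightarrow> nat set \<Rightarrow> (nat \<Rightarrow> real) \<Rightarrow> nat \<Rightarrow> real" where
  "clip s I f = (\<lambda>i. s * (if i \<in> I then f i else 0))"

lemma clip_supp: "s \<noteq> 0 \<Longrightarrow> supp (clip s I f) = supp f \<inter> I"
  by (auto simp: clip_def supp_def)

lemma clip_proper: "proper f \<Longrightarrow> s \<noteq> 0 \<Longrightarrow> supp (clip s I f) \<noteq> {} \<Longrightarrow> proper (clip s I f)"
  unfolding proper_def by (simp add: clip_supp) (simp add: clip_def)

text \<open>Parts that miss \<open>I\<close> are dropped while the size is kept, which is legitimate
  because an average may have fewer parts than its size. The hypothesis on the parts stays open
  because the lemma is used inside the induction that establishes it.\<close>

lemma clip_average:
  assumes "average_of (norming_set n) a fs" "s \<in> {1, -1}" "supp (clip s I (fst a)) \<noteq> {}"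
    "\<And>g. g \<in> set fs \<Longrightarrow> supp (clip s I g) = {} \<or> clip s I g \<in> norming_set n"
  shows "\<exists>gs. average_of (norming_set n) (clip s I (fst a), snd a) gs"
proof -
  define gs where "gs = filter (\<lambda>g. supp g \<noteq> {}) (map (clip s I) fs)"
  have a: "sorted_wrt vec_less fs" "fst a = average (snd a) fs" "2 \<le> snd a" "length fs \<le> snd a"
    "\<And>f. f \<in> set fs \<Longrightarrow> proper f"
    using assms(1) norming_set_proper by (auto simp: average_of_def)
  have z: "supp g = {} \<Longrightarrow> g i = 0" for g :: "nat \<Rightarrow> real" and i by (auto simp: supp_def)
  have sum: "(\<Sum>g\<leftarrow>filter (\<lambda>g. supp g \<noteq> {}) (map (clip s I) hs). g i) = s * (if i \<in> I then (\<Sum>g\<leftarrow>hs. g i) else 0)"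
    for i hs
  proof (induction hs)
    case (Cons h hs)
    then show ?case using z[of "clip s I h" i] by (auto simp: clip_def algebra_simps)
  qed (simp add: clip_def)
  have eq: "clip s I (fst a) = average (snd a) gs"
    by (rule ext) (simp add: gs_def average_def sum, simp add: clip_def a(2) average_def)
  have "gs \<noteq> []"
  proof
    assume "gs = []"
    then show False using assms(3) unfolding eq by (simp add: average_def supp_def)
  qed
  moreover have "sorted_wrt vec_less gs"
    unfolding gs_def filter_map sorted_wrt_map
  proof (rule sorted_wrt_mono_rel[OF _ sorted_wrt_filter[OF a(1)]])
    fix f g assume *: "f \<in> set (filter ((\<lambda>g. supp g \<noteq> {}) \<circ> clip s I) fs)" "g \<in> set (filter ((\<lambda>g. supp g \<noteq> {}) \<circ> clip s I) fs)"
      "vec_less f g"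
    show "vec_less (clip s I f) (clip s I g)"
    proof (rule vec_lessI)
      fix i j assume "i \<in> supp (clip s I f)" "j \<in> supp (clip s I g)"
      then have "i \<in> supp f" "j \<in> supp g" using clip_supp[of s I] assms(2) by auto
      then show "i < j" using vec_lessD[OF *(3), of i j] * a(5) by auto
    qed (use * a(5) assms(2) in \<open>auto intro!: clip_proper\<close>)
  qed
  moreover have "set gs \<subseteq> norming_set n" using assms(4) by (auto simp: gs_def)
  moreover have "length gs \<le> snd a" using a(4) by (simp add: gs_def le_trans[OF length_filter_le])
  ultimately show ?thesis using a(3) eq by (auto simp: average_of_def)
qed

text \<open>Clipping a family changes the minima of the supports only by moving them to the right, so
  admissibility survives by the spreading property.\<close>

lemma clip_family:
  assumes fam: "family n k as" and s: "\<And>a. a \<in> set as \<Longrightarrow> s a \<in> {1, -1}"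
    and bs: "bs = filter (\<lambda>b. supp (fst b) \<noteq> {}) (map (\<lambda>a. (clip (s a) I (fst a), snd a)) as)" "bs \<noteq> []"
    and avg: "\<And>a. a \<in> set as \<Longrightarrow> supp (clip (s a) I (fst a)) \<noteq> {} \<Longrightarrow>
      \<exists>gs. average_of (norming_set n) (clip (s a) I (fst a), snd a) gs"
  shows "family n k bs"
  unfolding family_def
proof (intro conjI ballI)
  let ?T = "\<lambda>a. (clip (s a) I (fst a), snd a)"
  let ?ne = "\<lambda>b. supp (fst b) \<noteq> {}"
  fix b assume "b \<in> set bs"
  then have "b \<in> ?T ` set as" "?ne b" unfolding bs(1) by simp_all
  then obtain a where "a \<in> set as" "b = ?T a" "supp (clip (s a) I (fst a)) \<noteq> {}" by force
  then show "\<exists>fs. average_of (norming_set n) b fs" using avg by blast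
next
  let ?T = "\<lambda>a. (clip (s a) I (fst a), snd a)"
  let ?ne = "\<lambda>b. supp (fst b) \<noteq> {}"
  have as: "sorted_wrt growing as" "(\<lambda>a. Min (supp (fst a))) ` set as \<in> schreier k"
    using fam by (auto simp: family_def)
  note pr = family_proper[OF fam]
  have s0: "s a \<noteq> 0" if "a \<in> set as" for a using s[OF that] by auto
  have prT: "proper (fst (?T a))" if "a \<in> set as" "?ne (?T a)" for a
    using clip_proper[OF pr[OF that(1)] s0[OF that(1)]] that by auto
  have sub: "supp (fst (?T a)) \<subseteq> supp (fst a)" if "a \<in> set as" for a
    using clip_supp[OF s0[OF that]] by auto
  have gr: "growing (?T a) (?T b)" if "a \<in> set as" "b \<in> set as" "?ne (?T a)" "?ne (?T b)" "growing a b" for a b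
  proof -
    have "vec_less (fst (?T a)) (fst (?T b))"
    proof (rule vec_lessI[OF prT prT])
      fix i j assume "i \<in> supp (fst (?T a))" "j \<in> supp (fst (?T b))"
      then show "i < j" using vec_lessD[of "fst a" "fst b" i j] that pr sub[OF that(1)] sub[OF that(2)]
        by (auto simp: growing_def)
    qed fact+
    moreover have "Max (supp (fst (?T a))) \<le> Max (supp (fst a))"
      using pr[OF that(1)] sub[OF that(1)] that(3) by (intro Max_mono) (auto simp: proper_def)
    ultimately show ?thesis using that(5) by (simp add: growing_def)
  qed
  show "sorted_wrt growing bs"
    unfolding bs(1) filter_map sorted_wrt_map
    by (rule sorted_wrt_mono_rel[OF _ sorted_wrt_filter[OF as(1)]]) (use gr in auto)
  \<comment> \<open>Positions of the averages that survive the restriction. Indexing by positions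
    lets the old and the new minima be compared as two increasing functions on one set.\<close>
  let ?G = "{q. q < length as \<and> ?ne (?T (as ! q))}"
  have "(\<lambda>q. Min (supp (fst (?T (as ! q))))) ` ?G \<in> schreier k"
  proof (rule schreier_spread[OF as(2), where \<psi> = "\<lambda>q. Min (supp (fst (as ! q)))"])
    show "?G \<noteq> {}" using bs by (force simp: in_set_conv_nth filter_empty_conv)
    show "strict_mono_on ?G (\<lambda>q. Min (supp (fst (as ! q))))"
    proof (rule strict_mono_onI)
      fix p q assume "p \<in> ?G" "q \<in> ?G" "p < q"
      then have "growing (as ! p) (as ! q)" "as ! p \<in> set as" "as ! q \<in> set as"
        using as(1) by (auto simp: sorted_wrt_iff_nth_less)
      then show "Min (supp (fst (as ! p))) < Min (supp (fst (as ! q)))"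
        using growing_Min_less pr by blast
    qed
    show "strict_mono_on ?G (\<lambda>q. Min (supp (fst (?T (as ! q)))))"
    proof (rule strict_mono_onI)
      fix p q assume pq: "p \<in> ?G" "q \<in> ?G" "p < q"
      then have m: "as ! p \<in> set as" "as ! q \<in> set as" "?ne (?T (as ! p))" "?ne (?T (as ! q))"
        and "growing (as ! p) (as ! q)"
        using as(1) unfolding sorted_wrt_iff_nth_less by simp_all
      then have "growing (?T (as ! p)) (?T (as ! q))" using gr by blast
      then show "Min (supp (fst (?T (as ! p)))) < Min (supp (fst (?T (as ! q))))"
        using growing_Min_less prT[OF m(1,3)] prT[OF m(2,4)] by blast
    qed
    fix q assume "q \<in> ?G"
    then show "Min (supp (fst (as ! q))) \<le> Min (supp (fst (?T (as ! q))))"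
      using pr[of "as ! q"] sub[of "as ! q"] by (intro Min_antimono) (auto simp: proper_def)
  qed auto
  also have "(\<lambda>q. Min (supp (fst (?T (as ! q))))) ` ?G = (\<lambda>a. Min (supp (fst a))) ` set bs"
    unfolding bs(1) by (force simp: in_set_conv_nth image_iff)
  finally show "(\<lambda>a. Min (supp (fst a))) ` set bs \<in> schreier k" .
qed

lemma clip_list_sum:
  assumes "bs = filter (\<lambda>b. supp (fst b) \<noteq> {}) (map (\<lambda>a. (clip (s a) I (fst a), snd a)) as)"
  shows "list_sum bs = (\<lambda>i. \<Sum>a\<leftarrow>as. clip (s a) I (fst a) i)"
proof
  fix i
  have z: "supp g = {} \<Longrightarrow> g i = 0" for g :: "nat \<Rightarrow> real" by (auto simp: supp_def)
  show "list_sum bs i = (\<Sum>a\<leftarrow>as. clip (s a) I (fst a) i)"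
    unfolding assms by (induction as) (auto simp: z)
qed

text \<open>W does not contain the zero vector, so the induction carries the alternative that
  nothing of the support remains.\<close>

lemma clip_in_norming_set:
  assumes "f \<in> norming_set n" "s \<in> {1, -1}" "supp (clip s I f) \<noteq> {}"
  shows "clip s I f \<in> norming_set n"
proof -
  have "supp (clip s I f) = {} \<or> clip s I f \<in> norming_set n"
    using assms(1)
  proof (induction rule: norming_set_induct)
    case (unit i)
    have "clip s I (unit_vec i) = unit_vec i \<or> clip s I (unit_vec i) = (\<lambda>j. - unit_vec i j) \<or> supp (clip s I (unit_vec i)) = {}"
      using assms(2) by (cases "i \<in> I") (auto simp: clip_def unit_vec_def fun_eq_iff supp_def)
    then show ?case using unit_vec_in_norming_set neg_unit_vec_in_norming_set unit by metis
  next
    case (neg_unit i)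
    have "clip s I (\<lambda>j. - unit_vec i j) = unit_vec i \<or> clip s I (\<lambda>j. - unit_vec i j) = (\<lambda>j. - unit_vec i j)
        \<or> supp (clip s I (\<lambda>j. - unit_vec i j)) = {}"
      using assms(2) by (cases "i \<in> I") (auto simp: clip_def unit_vec_def fun_eq_iff supp_def)
    then show ?case using unit_vec_in_norming_set neg_unit_vec_in_norming_set neg_unit by metis
  next
    case (average a fs)
    show ?case
    proof (cases "supp (clip s I (fst a)) = {}")
      case False
      then obtain gs where "average_of (norming_set n) (clip s I (fst a), snd a) gs"
        using clip_average[OF average(1) assms(2)] average(2) by blast
      from average_in_norming_set[OF this] show ?thesis by simp
    qed simp
  next
    case (schreier as)
    define bs where "bs = filter (\<lambda>b. supp (fst b) \<noteq> {}) (map (\<lambda>a. (clip s I (fst a), snd a)) as)"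
    have "clip s I (list_sum as) = (\<lambda>i. \<Sum>a\<leftarrow>as. clip s I (fst a) i)"
      unfolding clip_def by (rule ext) (simp add: sum_list_const_mult)
    then have eq: "clip s I (list_sum as) = list_sum bs"
      using clip_list_sum[OF bs_def] by simp
    show ?case
    proof (cases "bs = []")
      case True
      then show ?thesis unfolding eq by (simp add: supp_def)
    next
      case False
      have "family n n bs"
      proof (rule clip_family[OF schreier(1) assms(2) bs_def False])
        fix a assume a: "a \<in> set as" "supp (clip s I (fst a)) \<noteq> {}"
        obtain fs where fs: "average_of (norming_set n) a fs"
          "\<forall>g\<in>set fs. supp (clip s I g) = {} \<or> clip s I g \<in> norming_set n"
          using schreier(2)[OF a(1)] by blast
        show "\<exists>gs. average_of (norming_set n) (clip s I (fst a), snd a) gs"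
          by (rule clip_average[OF fs(1) assms(2) a(2)]) (use fs(2) in blast)
      qed
      then show ?thesis unfolding eq using family_sum_in_norming_set by blast
    qed
  qed
  then show ?thesis using assms(3) by simp
qed

text \<open>\<open>clip_family\<close> with its hypothesis on averages discharged by
  \<open>clip_in_norming_set\<close>. The signs may differ from one average to the next, which later
  turns a sum of absolute values into the value of one functional.\<close>

lemma family_clip:
  assumes fam: "family n k as" and s: "\<And>a. a \<in> set as \<Longrightarrow> s a \<in> {1, -1}"
    and bs: "bs = filter (\<lambda>b. supp (fst b) \<noteq> {}) (map (\<lambda>a. (clip (s a) I (fst a), snd a)) as)" "bs \<noteq> []"
  shows "family n k bs"
proof (rule clip_family[OF assms])
  fix a assume a: "a \<in> set as" "supp (clip (s a) I (fst a)) \<noteq> {}"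
  then obtain fs where fs: "average_of (norming_set n) a fs" using fam unfolding family_def by blast
  show "\<exists>gs. average_of (norming_set n) (clip (s a) I (fst a), snd a) gs"
  proof (rule clip_average[OF fs s[OF a(1)] a(2)])
    fix g assume "g \<in> set fs"
    then have "g \<in> norming_set n" using fs by (auto simp: average_of_def)
    then show "supp (clip (s a) I g) = {} \<or> clip (s a) I g \<in> norming_set n"
      using clip_in_norming_set[OF _ s[OF a(1)]] by blast
  qed
qed

lemma uminus_in_norming_set:
  assumes "f \<in> norming_set n"
  shows "(\<lambda>i. - f i) \<in> norming_set n"
proof -
  have eq: "clip (-1) UNIV f = (\<lambda>i. - f i)" by (rule ext) (simp add: clip_def)
  have "supp (clip (-1) UNIV f) \<noteq> {}"
    using norming_set_proper[OF assms] clip_supp[of "-1" UNIV f] unfolding proper_def by simp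
  from clip_in_norming_set[OF assms _ this] show ?thesis unfolding eq by simp
qed

section \<open>The norm and the completion\<close>

lemma dual_pair_superset: "finite S \<Longrightarrow> supp x \<subseteq> S \<Longrightarrow> dual_pair f x = (\<Sum>i\<in>S. f i * x i)"
  unfolding dual_pair_def by (rule sum.mono_neutral_left) (auto simp: supp_def)

lemma supp_sum_subset: "supp (\<lambda>i. \<Sum>j\<in>F. a j * y j i) \<subseteq> (\<Union>j\<in>F. supp (y j))"
  by (auto simp: supp_def intro: sum.neutral)

lemma c00_sum:
  assumes "finite F" "\<And>j. j \<in> F \<Longrightarrow> y j \<in> c00"
  shows "(\<lambda>i. \<Sum>j\<in>F. a j * y j i) \<in> c00"
  using assms by (auto simp: c00_def intro: finite_subset[OF supp_sum_subset])

lemma dual_pair_sum: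
  assumes "finite F" "\<And>j. j \<in> F \<Longrightarrow> y j \<in> c00"
  shows "dual_pair f (\<lambda>i. \<Sum>j\<in>F. a j * y j i) = (\<Sum>j\<in>F. a j * dual_pair f (y j))"
proof -
  let ?S = "\<Union>j\<in>F. supp (y j)"
  have S: "finite ?S" using assms by (auto simp: c00_def)
  have "dual_pair f (\<lambda>i. \<Sum>j\<in>F. a j * y j i) = (\<Sum>i\<in>?S. f i * (\<Sum>j\<in>F. a j * y j i))"
    by (rule dual_pair_superset[OF S supp_sum_subset])
  also have "\<dots> = (\<Sum>j\<in>F. a j * (\<Sum>i\<in>?S. f i * y j i))"
    by (simp add: sum_distrib_left sum.swap[of _ ?S] algebra_simps)
  also have "\<dots> = (\<Sum>j\<in>F. a j * dual_pair f (y j))"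
    by (intro sum.cong refl arg_cong2[where f = "(*)"] dual_pair_superset[symmetric, OF S]) auto
  finally show ?thesis .
qed

lemma dual_pair_list_sum: "dual_pair (\<lambda>i. \<Sum>a\<leftarrow>as. g a i) x = (\<Sum>a\<leftarrow>as. dual_pair (g a) x)"
  by (induction as) (simp_all add: dual_pair_def distrib_right sum.distrib)

lemma dual_pair_average: "dual_pair (average l fs) x = (\<Sum>f\<leftarrow>fs. dual_pair f x) / real l"
proof -
  have "dual_pair (average l fs) x = dual_pair (\<lambda>i. \<Sum>f\<leftarrow>fs. f i) x / real l"
    by (simp add: dual_pair_def average_def sum_divide_distrib)
  then show ?thesis using dual_pair_list_sum[of "\<lambda>f. f" fs x] by simp
qed

lemma dual_pair_uminus: "dual_pair (\<lambda>i. - f i) x = - dual_pair f x"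
  by (simp add: dual_pair_def sum_negf)

lemma dual_pair_zero: "supp f \<inter> supp x = {} \<Longrightarrow> dual_pair f x = 0"
  unfolding dual_pair_def by (intro sum.neutral) (auto simp: supp_def)

lemma dual_pair_clip: "supp x \<subseteq> I \<Longrightarrow> dual_pair (clip s I f) x = s * dual_pair f x"
  unfolding dual_pair_def sum_distrib_left by (intro sum.cong) (auto simp: clip_def)

lemma dual_pair_unit: "x \<in> c00 \<Longrightarrow> dual_pair (unit_vec i) x = x i"
  by (cases "i \<in> supp x")
    (auto simp: dual_pair_def unit_vec_def c00_def supp_def if_distrib[of "\<lambda>a. a * _"] cong: if_cong)

lemma abs_dual_pair_le_l1: "f \<in> norming_set n \<Longrightarrow> \<bar>dual_pair f x\<bar> \<le> (\<Sum>i\<in>supp x. \<bar>x i\<bar>)"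
  unfolding dual_pair_def
  by (rule order_trans[OF sum_abs], rule sum_mono)
    (use norming_set_abs_le_1 in \<open>force simp: abs_mult intro: mult_left_le_one_le\<close>)

lemma norming_set_nonempty: "norming_set n \<noteq> {}"
  using unit_vec_in_norming_set[of 1 n] by auto

lemma dual_pair_le_norm:
  assumes "f \<in> norming_set n"
  shows "\<bar>dual_pair f x\<bar> \<le> X01_norm n x"
proof -
  have bdd: "bdd_above ((\<lambda>f. dual_pair f x) ` norming_set n)"
    using abs_dual_pair_le_l1[of _ n x] by (auto simp: bdd_above_def) (metis abs_le_D1)
  have "dual_pair f x \<le> X01_norm n x"
    unfolding X01_norm_def by (rule cSUP_upper[OF assms bdd])
  moreover have "dual_pair (\<lambda>i. - f i) x \<le> X01_norm n x"
    unfolding X01_norm_def by (rule cSUP_upper[OF uminus_in_norming_set[OF assms] bdd])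
  ultimately show ?thesis by (simp add: dual_pair_uminus)
qed

lemma norm_le_dual_pair:
  assumes "\<And>f. f \<in> norming_set n \<Longrightarrow> dual_pair f x \<le> B"
  shows "X01_norm n x \<le> B"
  unfolding X01_norm_def by (rule cSUP_least[OF norming_set_nonempty]) (use assms in auto)

lemma norm_le_l1: "X01_norm n x \<le> (\<Sum>i\<in>supp x. \<bar>x i\<bar>)"
  by (rule norm_le_dual_pair) (use abs_dual_pair_le_l1 abs_le_D1 in blast)

text \<open>Holds because W contains the unit vectors. It bounds the coordinate functionals and
  makes \<open>J\<close> injective on \<open>c00\<close>.\<close>

lemma coordinate_le_norm: "x \<in> c00 \<Longrightarrow> \<bar>x i\<bar> \<le> X01_norm n x"
proof (cases "i = 0")
  case True
  assume "x \<in> c00"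
  then have "\<bar>x i\<bar> = 0" using True by (simp add: c00_def)
  then show ?thesis
    using dual_pair_le_norm[OF unit_vec_in_norming_set[of 1 n], of x] by linarith
next
  case False
  assume "x \<in> c00"
  then show ?thesis
    using dual_pair_le_norm[OF unit_vec_in_norming_set[of i n], of x] False dual_pair_unit[of x i] by simp
qed

section \<open>Coordinate functionals and the gliding hump in the completion\<close>

locale X01_completion =
  fixes n :: nat and J :: "(nat \<Rightarrow> real) \<Rightarrow> 'a::banach"
  assumes compl: "is_X01_completion n J"
begin

lemma J_add: "x \<in> c00 \<Longrightarrow> y \<in> c00 \<Longrightarrow> J (\<lambda>i. x i + y i) = J x + J y"
  and J_scale: "x \<in> c00 \<Longrightarrow> J (\<lambda>i. t * x i) = t *\<^sub>R J x"
  and J_norm: "x \<in> c00 \<Longrightarrow> norm (J x) = X01_norm n x"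
  and J_dense: "closure (J ` c00) = UNIV"
  using compl by (auto simp: is_X01_completion_def)

lemma J_sum:
  assumes "finite F" "\<And>j. j \<in> F \<Longrightarrow> y j \<in> c00"
  shows "J (\<lambda>i. \<Sum>j\<in>F. a j * y j i) = (\<Sum>j\<in>F. a j *\<^sub>R J (y j))"
  using assms
proof (induction F rule: finite_induct)
  case empty
  have "(\<lambda>i. 0) \<in> c00" by (simp add: c00_def supp_def)
  then show ?case using J_scale[of "\<lambda>i. 0" 0] by simp
next
  case (insert k F)
  have "(\<lambda>i. a k * y k i) \<in> c00" using c00_sum[of "{k}" y a] insert.prems by simp
  then show ?case
    using insert J_add[of "\<lambda>i. a k * y k i" "\<lambda>i. \<Sum>j\<in>F. a j * y j i"] J_scale[of "y k" "a k"] c00_sum[of F y a]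
    by simp
qed

lemma norm_J_sum:
  assumes "finite F" "\<And>j. j \<in> F \<Longrightarrow> y j \<in> c00"
  shows "norm (\<Sum>j\<in>F. a j *\<^sub>R J (y j)) = X01_norm n (\<lambda>i. \<Sum>j\<in>F. a j * y j i)"
  using J_sum[OF assms, where a = a] J_norm[OF c00_sum[OF assms, where a = a]] by simp

lemma J_diff: "x \<in> c00 \<Longrightarrow> y \<in> c00 \<Longrightarrow> (\<lambda>i. x i - y i) \<in> c00 \<and> J (\<lambda>i. x i - y i) = J x - J y"
proof -
  assume xy: "x \<in> c00" "y \<in> c00"
  \<comment> \<open>The difference is written as a combination over a two-element index set, so that
    \<open>J_sum\<close> and \<open>c00_sum\<close> apply.\<close>
  have eq: "(\<lambda>i. \<Sum>j\<in>{0::nat,1}. (if j = 0 then 1 else -1) * (if j = 0 then x else y) i) = (\<lambda>i. x i - y i)"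
    by (rule ext) simp
  show ?thesis
    using J_sum[of "{0::nat,1}" "\<lambda>j. if j = 0 then x else y" "\<lambda>j. if j = 0 then 1 else -1"]
      c00_sum[of "{0::nat,1}" "\<lambda>j. if j = 0 then x else y" "\<lambda>j. if j = 0 then 1 else -1"] xy
    unfolding eq by simp
qed

text \<open>Weak nullness concerns functionals on the whole space, so the coordinates have to be
  extended from the dense image of \<open>c00\<close>; there they are 1-Lipschitz by
  \<open>coordinate_le_norm\<close>.\<close>

lemma coordinate_functional:
  obtains f :: "'a \<Rightarrow> real" where "bounded_linear f" "\<And>x. x \<in> c00 \<Longrightarrow> f (J x) = x i" "\<And>u. \<bar>f u\<bar> \<le> norm u"
proof -
  have dist: "\<bar>x i - y i\<bar> \<le> dist (J x) (J y)" if "x \<in> c00" "y \<in> c00" for x y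
    using J_diff[OF that] coordinate_le_norm[of "\<lambda>i. x i - y i" i n] J_norm[of "\<lambda>i. x i - y i"] by (simp add: dist_norm)
  \<comment> \<open>The choice is harmless: \<open>dist\<close> shows that x i depends only on J
    x.\<close>
  define g where "g u = (SOME t. \<exists>x\<in>c00. u = J x \<and> t = x i)" for u
  have g: "g (J x) = x i" if "x \<in> c00" for x
  proof -
    have "\<exists>t. \<exists>y\<in>c00. J x = J y \<and> t = y i" using that by blast
    then have "\<exists>y\<in>c00. J x = J y \<and> g (J x) = y i" unfolding g_def by (rule someI_ex)
    then obtain y where y: "y \<in> c00" "J x = J y" "g (J x) = y i" by blast
    then show ?thesis using dist[OF that y(1)] by simp
  qed
  have "uniformly_continuous_on (J ` c00) g"
    unfolding uniformly_continuous_on_def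
  proof (intro allI impI)
    fix e :: real assume "0 < e"
    then show "\<exists>d>0. \<forall>u\<in>J ` c00. \<forall>v\<in>J ` c00. dist v u < d \<longrightarrow> dist (g v) (g u) < e"
      using dist g by (intro exI[of _ e]) (force simp: dist_real_def)
  qed
  then obtain f where f: "uniformly_continuous_on (closure (J ` c00)) f" "\<And>u. u \<in> J ` c00 \<Longrightarrow> g u = f u"
    by (rule uniformly_continuous_on_extension_on_closure) metis
  have cont: "continuous_on UNIV f" using f(1) J_dense by (simp add: uniformly_continuous_imp_continuous)
  have fJ: "f (J x) = x i" if "x \<in> c00" for x using f(2) g that by (metis image_eqI)
  have lim: "\<exists>x. (\<forall>k. x k \<in> c00) \<and> (\<lambda>k. J (x k)) \<longlonglongrightarrow> u" for u
  proof -
    have "u \<in> closure (J ` c00)" using J_dense by simp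
    then obtain v where v: "\<forall>k. v k \<in> J ` c00" "v \<longlonglongrightarrow> u" unfolding closure_sequential by blast
    then have "\<forall>k. \<exists>z. z \<in> c00 \<and> v k = J z" by blast
    from choice[OF this] obtain x where x: "\<forall>k. x k \<in> c00 \<and> v k = J (x k)" by blast
    then have "v = (\<lambda>k. J (x k))" by auto
    then show ?thesis using v(2) x by blast
  qed
  have flim: "(\<lambda>k. f (v k)) \<longlonglongrightarrow> f u" if "v \<longlonglongrightarrow> u" for v u
    using continuous_on_tendsto_compose[OF cont that] by simp
  have bd: "\<bar>f u\<bar> \<le> norm u" for u
  proof -
    obtain x where x: "\<And>k. x k \<in> c00" "(\<lambda>k. J (x k)) \<longlonglongrightarrow> u" using lim by blast
    show ?thesis
    proof (rule LIMSEQ_le[OF tendsto_rabs[OF flim[OF x(2)]] tendsto_norm[OF x(2)]])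
      show "\<exists>N. \<forall>k\<ge>N. \<bar>f (J (x k))\<bar> \<le> norm (J (x k))"
        using fJ[OF x(1)] J_norm[OF x(1)] coordinate_le_norm[OF x(1)] by simp
    qed
  qed
  have add: "f (u + v) = f u + f v" for u v
  proof -
    obtain x where x: "\<And>k. x k \<in> c00" "(\<lambda>k. J (x k)) \<longlonglongrightarrow> u" using lim[of u] by blast
    obtain y where y: "\<And>k. y k \<in> c00" "(\<lambda>k. J (y k)) \<longlonglongrightarrow> v" using lim[of v] by blast
    have "f (J (x k) + J (y k)) = f (J (x k)) + f (J (y k))" for k
      using J_add[OF x(1) y(1)] fJ[of "\<lambda>i. x k i + y k i"] fJ[OF x(1)] fJ[OF y(1)]
        c00_sum[of "{0::nat,1}" "\<lambda>j. if j = 0 then x k else y k" "\<lambda>j. 1"] x(1) y(1) by simp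
    then have "(\<lambda>k. f (J (x k) + J (y k))) \<longlonglongrightarrow> f u + f v"
      using tendsto_add[OF flim[OF x(2)] flim[OF y(2)]] by simp
    moreover have "(\<lambda>k. f (J (x k) + J (y k))) \<longlonglongrightarrow> f (u + v)"
      by (rule flim[OF tendsto_add[OF x(2) y(2)]])
    ultimately show ?thesis using LIMSEQ_unique by blast
  qed
  have scale: "f (t *\<^sub>R u) = t * f u" for t u
  proof -
    obtain x where x: "\<And>k. x k \<in> c00" "(\<lambda>k. J (x k)) \<longlonglongrightarrow> u" using lim by blast
    have "f (t *\<^sub>R J (x k)) = t * f (J (x k))" for k
      using J_scale[OF x(1)] fJ[of "\<lambda>i. t * x k i"] fJ[OF x(1)] c00_sum[of "{0::nat}" "\<lambda>j. x k" "\<lambda>j. t"] x(1)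
      by simp
    then have "(\<lambda>k. f (t *\<^sub>R J (x k))) \<longlonglongrightarrow> t * f u"
      using tendsto_mult_left[OF flim[OF x(2)]] by simp
    moreover have "(\<lambda>k. f (t *\<^sub>R J (x k))) \<longlonglongrightarrow> f (t *\<^sub>R u)"
      by (rule flim[OF tendsto_scaleR[OF tendsto_const x(2)]])
    ultimately show ?thesis using LIMSEQ_unique by blast
  qed
  have "bounded_linear f"
    by (rule bounded_linear_intro[where K = 1]) (use add scale bd in auto)
  then show ?thesis using that fJ bd by blast
qed

text \<open>Weak nullness makes the first coordinates of x r small for late r. A nearby vector of
  \<open>c00\<close> is then stripped of these coordinates, at a cost bounded by the l_1 norm of
  what is removed.\<close>

lemma gliding_hump_step:
  assumes "weakly_null x" "0 < \<eta>"
  shows "\<exists>r>R. \<exists>y\<in>c00. supp y \<subseteq> {N<..} \<and> norm (x r - J y) \<le> \<eta>"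
proof -
  have "\<exists>f. bounded_linear f \<and> (\<forall>x\<in>c00. f (J x) = x i) \<and> (\<forall>u. \<bar>f u\<bar> \<le> norm u)" for i
    by (rule coordinate_functional[of i]) blast
  then have "\<forall>i. \<exists>f. bounded_linear f \<and> (\<forall>x\<in>c00. f (J x) = x i) \<and> (\<forall>u. \<bar>f u\<bar> \<le> norm u)" by blast
  from choice[OF this] obtain e where
    e: "\<And>i. bounded_linear (e i)" "\<And>i x. x \<in> c00 \<Longrightarrow> e i (J x) = x i" "\<And>i u. \<bar>e i u\<bar> \<le> norm (u::'a)"
    by blast
  have "(\<lambda>r. \<Sum>i\<le>N. \<bar>e i (x r)\<bar>) \<longlonglongrightarrow> (\<Sum>i\<le>N. \<bar>0\<bar>)"
    using assms(1) e(1) by (intro tendsto_sum tendsto_rabs) (auto simp: weakly_null_def)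
  then have "eventually (\<lambda>r. (\<Sum>i\<le>N. \<bar>e i (x r)\<bar>) < \<eta> / 4) sequentially"
    using assms(2) by (intro order_tendstoD(2)) auto
  then have "eventually (\<lambda>r. (\<Sum>i\<le>N. \<bar>e i (x r)\<bar>) < \<eta> / 4 \<and> R < r) sequentially"
    by (intro eventually_conj eventually_gt_at_top)
  then obtain r where r: "(\<Sum>i\<le>N. \<bar>e i (x r)\<bar>) < \<eta> / 4" "R < r"
    by (auto dest: eventually_happens)
  \<comment> \<open>Each of the N + 1 removed coordinates of z differs from that of x r by at most
    d, and these errors are to add up to \<eta> / 4.\<close>
  define d where "d = \<eta> / (4 * (real N + 1))"
  have d: "0 < d" "d \<le> \<eta> / 4" "real (N + 1) * d = \<eta> / 4"
    using assms(2) by (auto simp: d_def field_simps)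
  have "x r \<in> closure (J ` c00)" using J_dense by simp
  then obtain z where z: "z \<in> c00" "dist (J z) (x r) < d" using d(1) unfolding closure_approachable by blast
  define y where "y = (\<lambda>i. if i \<le> N then 0 else z i)"
  have y: "y \<in> c00" "supp y \<subseteq> {N<..}" using z(1)
    by (auto simp: y_def c00_def supp_def intro: finite_subset[of _ "supp z"])
  have zi: "\<bar>z i\<bar> \<le> \<bar>e i (x r)\<bar> + d" for i
  proof -
    interpret bounded_linear "e i" by fact
    have "\<bar>e i (J z) - e i (x r)\<bar> \<le> d" using e(3)[of i "J z - x r"] z(2) by (simp add: diff dist_norm)
    then show ?thesis using e(2)[OF z(1), of i] by linarith
  qed
  have "norm (J z - J y) = X01_norm n (\<lambda>i. z i - y i)"
    using J_diff[OF z(1) y(1)] J_norm[of "\<lambda>i. z i - y i"] by simp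
  also have "\<dots> \<le> (\<Sum>i\<in>supp (\<lambda>i. z i - y i). \<bar>z i - y i\<bar>)" by (rule norm_le_l1)
  also have "\<dots> \<le> (\<Sum>i\<le>N. \<bar>z i - y i\<bar>)"
    by (rule sum_mono2) (auto simp: supp_def y_def split: if_splits)
  also have "\<dots> \<le> (\<Sum>i\<le>N. \<bar>e i (x r)\<bar> + d)" by (rule sum_mono) (use zi in \<open>auto simp: y_def\<close>)
  also have "\<dots> = (\<Sum>i\<le>N. \<bar>e i (x r)\<bar>) + real (N + 1) * d" by (simp add: sum.distrib)
  also have "\<dots> \<le> \<eta> / 2" using r(1) d(3) by linarith
  finally have "norm (J z - J y) \<le> \<eta> / 2" .
  moreover have "norm (x r - J y) \<le> norm (x r - J z) + norm (J z - J y)" 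
    using norm_triangle_ineq[of "x r - J z" "J z - J y"] by simp
  ultimately have "norm (x r - J y) \<le> \<eta>" using z(2) d(2) assms(2) by (simp add: dist_norm norm_minus_commute)
  then show ?thesis using r(2) y by blast
qed

lemma gliding_hump:
  assumes "weakly_null x" "\<And>i. 0 < \<eta> i"
  obtains r y lo hi where "strict_mono r" "1 \<le> r 0" "\<And>i. y i \<in> c00" "\<And>i. supp (y i) \<subseteq> {lo i..hi i}"
    "\<And>i. 1 \<le> lo i" "\<And>i. lo i \<le> hi i" "\<And>i. hi i < lo (Suc i)"
    "\<And>i :: nat. norm (x (r i) - J (y i)) \<le> \<eta> i"
proof -
  define P where "P = (\<lambda>i (r, y, lo, hi). 1 \<le> r \<and> y \<in> c00 \<and> supp y \<subseteq> {lo..hi} \<and> 1 \<le> lo \<and> lo \<le> hi \<and>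
    norm (x r - J y) \<le> \<eta> i)"
  define Q where "Q = (\<lambda>(r, y :: nat \<Rightarrow> real, lo :: nat, hi :: nat) (r' :: nat, y' :: nat \<Rightarrow> real, lo', hi' :: nat). r < r' \<and> hi < lo')"
  have step: "\<exists>s. P i s \<and> Q (r, y, lo, hi) s" for i r y lo hi
  proof -
    obtain r' y' where *: "r < r'" "y' \<in> c00" "supp y' \<subseteq> {hi<..}" "norm (x r' - J y') \<le> \<eta> i"
      using gliding_hump_step[OF assms(1) assms(2), of r hi i] by blast
    \<comment> \<open>The outer maximum keeps the interval nonempty even if y' is zero.\<close>
    have "supp y' \<subseteq> {Suc hi..max (Suc hi) (Max (supp y'))}"
    proof
      fix k assume "k \<in> supp y'"
      then have "hi < k" "k \<le> Max (supp y')" using * by (auto simp: c00_def)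
      then show "k \<in> {Suc hi..max (Suc hi) (Max (supp y'))}" by simp
    qed
    then have "P i (r', y', Suc hi, max (Suc hi) (Max (supp y')))"
      using * by (auto simp: P_def)
    then show ?thesis using * by (force simp: Q_def)
  qed
  have "\<exists>s. \<forall>i. P i (s i) \<and> Q (s i) (s (Suc i))"
  proof (rule dependent_nat_choice)
    show "\<exists>s. P 0 s" using step by blast
    show "\<exists>s'. P (Suc i) s' \<and> Q s s'" for i s using step by (cases s) blast
  qed
  then obtain s where s: "\<And>i. P i (s i)" "\<And>i. Q (s i) (s (Suc i))" by blast
  show ?thesis
  proof (rule that[of "\<lambda>i. fst (s i)" "\<lambda>i. fst (snd (s i))" "\<lambda>i. fst (snd (snd (s i)))" "\<lambda>i. snd (snd (snd (s i)))"])
    show "strict_mono (\<lambda>i. fst (s i))"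
      using s(2) by (auto simp: strict_mono_Suc_iff Q_def case_prod_beta)
  qed (use s in \<open>auto simp: P_def Q_def case_prod_beta\<close>)
qed

end

section \<open>Estimates on blocks\<close>

lemma sorted_wrt_cases:
  "sorted_wrt R xs \<Longrightarrow> a \<in> set xs \<Longrightarrow> b \<in> set xs \<Longrightarrow> a = b \<or> R a b \<or> R b a"
  by (induction xs) auto

lemma sum_list_abs_le: "\<bar>\<Sum>x\<leftarrow>xs. f x\<bar> \<le> (\<Sum>x\<leftarrow>xs. \<bar>f x :: real\<bar>)"
  by (induction xs) auto

lemma sum_list_mono_on: "(\<And>x. x \<in> set xs \<Longrightarrow> f x \<le> (g x :: real)) \<Longrightarrow> (\<Sum>x\<leftarrow>xs. f x) \<le> (\<Sum>x\<leftarrow>xs. g x)"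
  by (induction xs) (auto intro: add_mono)

lemma sum_list_zero: "(\<And>x. x \<in> set xs \<Longrightarrow> f x = (0 :: real)) \<Longrightarrow> (\<Sum>x\<leftarrow>xs. f x) = 0"
  by (induction xs) auto

text \<open>Serves to split the sum over an S_(p+1)-admissible list along a decomposition of its
  minima into S_p sets.\<close>

lemma sum_list_filter_cover:
  assumes "\<And>x. x \<in> set xs \<Longrightarrow> h x \<in> \<Union>(set Hs)" "\<And>x. 0 \<le> (g x :: real)"
  shows "(\<Sum>x\<leftarrow>xs. g x) \<le> (\<Sum>H\<leftarrow>Hs. \<Sum>x\<leftarrow>filter (\<lambda>x. h x \<in> H) xs. g x)"
  using assms(1)
proof (induction xs)
  case (Cons x xs)
  have eq: "(\<Sum>H\<leftarrow>Hs. \<Sum>x\<leftarrow>filter (\<lambda>x. h x \<in> H) (x # xs). g x)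
      = (\<Sum>H\<leftarrow>Hs. if h x \<in> H then g x else 0) + (\<Sum>H\<leftarrow>Hs. \<Sum>x\<leftarrow>filter (\<lambda>x. h x \<in> H) xs. g x)"
    by (subst sum_list_addf[symmetric]) (rule arg_cong[where f = sum_list], simp)
  obtain H where "H \<in> set Hs" "h x \<in> H" using Cons.prems by auto
  then have "g x \<le> (\<Sum>H\<leftarrow>Hs. if h x \<in> H then g x else 0)"
    using member_le_sum_list[of "g x" "map (\<lambda>H. if h x \<in> H then g x else 0) Hs"] assms(2)
    by (force simp: image_iff)
  then show ?case using Cons eq by simp
qed (simp add: sum_list_zero)

lemma sum_list_disjoint_le:
  fixes w :: "nat \<Rightarrow> real"
  assumes "sorted_wrt (\<lambda>a b. S a \<inter> S b = {}) xs" "\<And>a. a \<in> set xs \<Longrightarrow> S a \<subseteq> K" "finite K"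
    "\<And>j. j \<in> K \<Longrightarrow> 0 \<le> w j"
  shows "(\<Sum>a\<leftarrow>xs. sum w (S a)) \<le> sum w K"
  using assms
proof (induction xs arbitrary: K)
  case Nil
  then show ?case by (simp add: sum_nonneg)
next
  case (Cons a xs)
  have "(\<Sum>a\<leftarrow>xs. sum w (S a)) \<le> sum w (K - S a)"
    using Cons.prems by (intro Cons.IH) auto
  moreover have "sum w K = sum w (S a) + sum w (K - S a)"
    using Cons.prems by (simp add: sum.subset_diff[of "S a" K])
  ultimately show ?case by simp
qed

text \<open>The common setting of both upper estimates. \<open>z j\<close> is a block already
  multiplied by its coefficient, and \<open>w j\<close> majorizes its norm; the majorants are
  constant for the c_0 estimate and proportional to the convex weights for special
  combinations.\<close>

locale blocks =
  fixes n :: nat and lo hi :: "nat \<Rightarrow> nat" and z :: "nat \<Rightarrow> nat \<Rightarrow> real" and w :: "nat \<Rightarrow> real" and F :: "nat set"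
  assumes fin: "finite F"
    and z_supp: "j \<in> F \<Longrightarrow> supp (z j) \<subseteq> {lo j..hi j}"
    and lo_ge_1: "1 \<le> lo j" and lo_le_hi: "lo j \<le> hi j" and hi_less_lo: "j < k \<Longrightarrow> hi j < lo k"
    and bound: "j \<in> F \<Longrightarrow> f \<in> norming_set n \<Longrightarrow> \<bar>dual_pair f (z j)\<bar> \<le> w j"
begin

text \<open>Tested on the interval of a block and not on the support of \<open>z j\<close>: the
  intervals are nonempty and ordered, so blocks hit by successive functionals can be
  compared.\<close>

definition hits :: "(nat \<Rightarrow> real) \<Rightarrow> nat \<Rightarrow> bool" where
  "hits f j \<longleftrightarrow> (\<exists>i\<in>supp f. lo j \<le> i \<and> i \<le> hi j)"

definition val :: "(nat \<Rightarrow> real) \<Rightarrow> nat set \<Rightarrow> real" where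
  "val f J = (\<Sum>j\<in>J. dual_pair f (z j))"

abbreviation mu :: "nat set \<Rightarrow> real" where
  "mu \<equiv> sum w"

lemma w_nonneg: "j \<in> F \<Longrightarrow> 0 \<le> w j"
  using bound[of j] norming_set_nonempty[of n] by (meson abs_ge_zero all_not_in_conv order_trans)

lemma mu_nonneg: "J \<subseteq> F \<Longrightarrow> 0 \<le> mu J"
  using w_nonneg by (auto intro: sum_nonneg)

lemma mu_mono: "K \<subseteq> J \<Longrightarrow> J \<subseteq> F \<Longrightarrow> mu K \<le> mu J"
  by (rule sum_mono2) (use w_nonneg fin finite_subset in auto)

lemma not_hits: "j \<in> F \<Longrightarrow> \<not> hits f j \<Longrightarrow> dual_pair f (z j) = 0"
  by (rule dual_pair_zero) (use z_supp[of j] in \<open>fastforce simp: hits_def\<close>)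

lemma val_hits: "J \<subseteq> F \<Longrightarrow> val f J = val f {j \<in> J. hits f j}"
  unfolding val_def by (rule sum.mono_neutral_right) (use fin finite_subset not_hits in blast)+

lemma val_le_mu: "J \<subseteq> F \<Longrightarrow> f \<in> norming_set n \<Longrightarrow> \<bar>val f J\<bar> \<le> mu J"
  unfolding val_def by (rule order_trans[OF sum_abs], rule sum_mono) (use bound in auto)

text \<open>Consequently two successive functionals have at most one hit block in common.\<close>

lemma hits_order: "vec_less f g \<Longrightarrow> proper f \<Longrightarrow> proper g \<Longrightarrow> hits f j \<Longrightarrow> hits g k \<Longrightarrow> j \<le> k"
proof (rule ccontr)
  assume *: "vec_less f g" "proper f" "proper g" "hits f j" "hits g k" "\<not> j \<le> k"
  then obtain a b where "a \<in> supp f" "lo j \<le> a" "b \<in> supp g" "b \<le> hi k" by (auto simp: hits_def)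
  then show False using vec_lessD[OF *(1-3)] hi_less_lo[of k j] *(6) by fastforce
qed

lemma not_hits_left: "vec_less f g \<Longrightarrow> proper f \<Longrightarrow> proper g \<Longrightarrow> hits f k \<Longrightarrow> j < k \<Longrightarrow> \<not> hits g j"
  using hits_order[of f g k j] by auto

text \<open>Only the last block hit by some \<open>f\<close> in the list can be hit again by a later functional.\<close>

lemma sum_mu_hits:
  assumes "sorted_wrt vec_less fs" "\<And>f. f \<in> set fs \<Longrightarrow> proper f" "J \<subseteq> F" "0 \<le> M" "\<And>j. j \<in> J \<Longrightarrow> w j \<le> M"
  shows "(\<Sum>f\<leftarrow>fs. mu {j \<in> J. hits f j}) \<le> mu J + real (length fs) * M"
  using assms
proof (induction fs arbitrary: J)
  case Nil
  then show ?case using mu_nonneg by simp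
next
  case (Cons f fs)
  let ?Jf = "{j \<in> J. hits f j}"
  have finJ: "finite J" using Cons.prems fin finite_subset by blast
  show ?case
  proof (cases "?Jf = {}")
    case True
    have "(\<Sum>f\<leftarrow>fs. mu {j \<in> J. hits f j}) \<le> mu J + real (length fs) * M"
      using Cons.prems by (intro Cons.IH) auto
    moreover have "mu ?Jf = 0" unfolding True by simp
    ultimately show ?thesis using \<open>0 \<le> M\<close> by (simp add: algebra_simps)
  next
    case False
    define m where "m = Max ?Jf"
    have m: "m \<in> ?Jf" "\<And>j. j \<in> ?Jf \<Longrightarrow> j \<le> m" using False finJ Max_in[of ?Jf] by (auto simp: m_def)
    \<comment> \<open>All blocks hit by f except the last one are removed; no later functional hits
      them. The last one is counted again, at a cost of at most M.\<close>
    define J' where "J' = J - (?Jf - {m})"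
    have "{j \<in> J. hits g j} = {j \<in> J'. hits g j}" if g: "g \<in> set fs" for g
    proof -
      have "\<not> hits g j" if "j \<in> ?Jf - {m}" for j
      proof -
        have "j < m" using m(2)[of j] that by auto
        then show ?thesis by (intro not_hits_left[of f g m]) (use Cons.prems g m(1) in auto)
      qed
      then show ?thesis by (auto simp: J'_def)
    qed
    then have "(\<Sum>g\<leftarrow>fs. mu {j \<in> J. hits g j}) = (\<Sum>g\<leftarrow>fs. mu {j \<in> J'. hits g j})"
      by (intro arg_cong[where f = sum_list] map_cong) auto
    also have "\<dots> \<le> mu J' + real (length fs) * M"
      using Cons.prems by (intro Cons.IH) (auto simp: J'_def)
    finally have "(\<Sum>g\<leftarrow>fs. mu {j \<in> J. hits g j}) \<le> mu J' + real (length fs) * M" .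
    moreover have "mu ?Jf = w m + mu (?Jf - {m})" using m finJ by (intro sum.remove) auto
    moreover have "mu J = mu J' + mu (?Jf - {m})"
      unfolding J'_def using finJ by (intro sum.subset_diff) auto
    moreover have "w m \<le> M" using m Cons.prems by auto
    ultimately show ?thesis by (simp add: algebra_simps)
  qed
qed

text \<open>A part acts only on the blocks that it hits. By \<open>sum_mu_hits\<close> the masses of
  these sets add up to at most mu J plus M for each part, and division by the size leaves mu J /
  size and a single M. The constants A are merely averaged, since there are no more parts than the
  size.\<close>

lemma average_estimate:
  assumes a: "average_of (norming_set n) a fs" and J: "J \<subseteq> F" and M: "0 \<le> M" "\<And>j. j \<in> J \<Longrightarrow> w j \<le> M"
    and "0 \<le> A" "0 \<le> b" and est: "\<And>f J'. f \<in> set fs \<Longrightarrow> J' \<subseteq> J \<Longrightarrow> \<bar>val f J'\<bar> \<le> A + b * mu J'"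
  shows "\<bar>val (fst a) J\<bar> \<le> A + b * (mu J / real (snd a) + M)"
proof -
  let ?l = "real (snd a)" and ?d = "real (length fs)"
  have fs: "fst a = average (snd a) fs" "sorted_wrt vec_less fs" "0 < ?l" "?d \<le> ?l" "\<And>f. f \<in> set fs \<Longrightarrow> proper f"
    using a norming_set_proper by (auto simp: average_of_def)
  have "val (fst a) J = (\<Sum>f\<leftarrow>fs. val f J) / ?l"
    unfolding val_def fs(1) dual_pair_average sum_divide_distrib[symmetric]
    by (induction fs) (simp_all add: sum.distrib)
  then have "\<bar>val (fst a) J\<bar> = \<bar>\<Sum>f\<leftarrow>fs. val f J\<bar> / ?l" by simp
  also have "\<bar>\<Sum>f\<leftarrow>fs. val f J\<bar> \<le> (\<Sum>f\<leftarrow>fs. \<bar>val f J\<bar>)" by (rule sum_list_abs_le)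
  also have "\<dots> \<le> (\<Sum>f\<leftarrow>fs. A + b * mu {j \<in> J. hits f j})"
    by (rule sum_list_mono_on) (use val_hits[OF J] est in auto)
  also have "\<dots> = ?d * A + b * (\<Sum>f\<leftarrow>fs. mu {j \<in> J. hits f j})"
    by (simp add: sum_list_addf sum_list_const_mult sum_list_triv)
  also have "\<dots> \<le> ?d * A + b * (mu J + ?d * M)"
    by (intro add_left_mono mult_left_mono sum_mu_hits) (use fs J M \<open>0 \<le> b\<close> in auto)
  also have "\<dots> \<le> ?l * A + b * (mu J + ?l * M)"
    by (intro add_mono mult_left_mono mult_right_mono) (use fs M \<open>0 \<le> A\<close> \<open>0 \<le> b\<close> in auto)
  finally have "\<bar>val (fst a) J\<bar> \<le> (?l * A + b * (mu J + ?l * M)) / ?l"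
    using fs(3) by (simp add: divide_right_mono)
  also have "\<dots> = A + b * (mu J / ?l + M)" using fs(3) by (simp add: field_simps)
  finally show ?thesis .
qed

text \<open>The proportional term \<open>b * mu J\<close> absorbs all errors: it is halved by an average, and when
  \<open>mu J \<le> A\<close> there is nothing to prove, so the error terms may be taken relative to \<open>A\<close>.\<close>

lemma main_estimate:
  assumes M: "0 \<le> M" "\<And>j. j \<in> F \<Longrightarrow> w j \<le> M" and b: "0 \<le> b" "d \<le> b / 4"
    and A: "E0 \<le> A" "0 \<le> E" "b * M + E \<le> b / 4 * A" "M \<le> A"
    and sch: "\<And>as J. family n n as \<Longrightarrow> J \<subseteq> F \<Longrightarrow>
      \<exists>a\<in>set as. \<bar>val (list_sum as) J\<bar> \<le> max E0 (\<bar>val (fst a) J\<bar> + E) + d * mu J"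
    and f: "f \<in> norming_set n" and J: "J \<subseteq> F"
  shows "\<bar>val f J\<bar> \<le> A + b * mu J"
proof -
  have A0: "0 \<le> A" using M(1) A(4) by simp
  \<comment> \<open>A unit vector meets the interval of at most one block, so its value is at most M
    \<le> A.\<close>
  have single: "\<bar>val f J\<bar> \<le> A + b * mu J" if fW: "f \<in> norming_set n" and "supp f = {i}" "J \<subseteq> F" for f i J
  proof -
    let ?K = "{j \<in> J. hits f j}"
    have one: "j = k" if "j \<in> ?K" "k \<in> ?K" for j k
      using that hi_less_lo[of j k] hi_less_lo[of k j] \<open>supp f = {i}\<close> by (fastforce simp: hits_def)
    have K: "?K \<subseteq> F" using that by auto
    have "mu ?K \<le> M"
    proof (cases "?K = {}")
      case False
      then obtain k where "k \<in> ?K" by blast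
      then have "?K = {k}" using one by blast
      then show ?thesis using M(2) K by auto
    next
      case True
      show ?thesis unfolding True using M by simp
    qed
    then have "\<bar>val f J\<bar> \<le> A" using val_hits[OF that(3), of f] val_le_mu[OF K fW] A(4) by simp
    then show ?thesis using b(1) mu_nonneg[OF that(3)] by (simp add: add_increasing2)
  qed
  have avg: "\<bar>val (fst a) J\<bar> \<le> A + b / 2 * mu J + b * M"
    if a: "average_of (norming_set n) a fs" "\<And>g J. g \<in> set fs \<Longrightarrow> J \<subseteq> F \<Longrightarrow> \<bar>val g J\<bar> \<le> A + b * mu J"
      and J: "J \<subseteq> F" for a fs J
  proof -
    have l: "2 \<le> real (snd a)" using a(1) by (auto simp: average_of_def)
    have "\<bar>val (fst a) J\<bar> \<le> A + b * (mu J / real (snd a) + M)"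
      by (rule average_estimate[OF a(1)]) (use a J M A0 b in auto)
    also have "\<dots> \<le> A + b * (mu J / 2 + M)"
      using b(1) l mu_nonneg[OF J] by (intro add_left_mono mult_left_mono add_right_mono divide_left_mono) auto
    finally show ?thesis by (simp add: algebra_simps)
  qed
  have "\<forall>J\<subseteq>F. \<bar>val f J\<bar> \<le> A + b * mu J"
    using f
  proof (induction rule: norming_set_induct)
    case (unit i)
    then show ?case by (auto intro!: single[OF unit_vec_in_norming_set])
  next
    case (neg_unit i)
    then show ?case by (auto intro!: single[OF neg_unit_vec_in_norming_set])
  next
    case (average a fs)
    show ?case
    proof (intro allI impI)
      fix J assume J: "J \<subseteq> F"
      show "\<bar>val (fst a) J\<bar> \<le> A + b * mu J"
      proof (cases "mu J \<le> A")
        case True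
        then show ?thesis using val_le_mu[OF J average_in_norming_set[OF average(1)]] b(1) mu_nonneg[OF J]
          by (simp add: add_increasing2)
      next
        case False
        have "\<bar>val (fst a) J\<bar> \<le> A + b / 2 * mu J + b * M" using average J by (intro avg) auto
        moreover have "b / 4 * A \<le> b / 4 * mu J" using False b(1) by (intro mult_left_mono) auto
        moreover have "0 \<le> b * mu J" using b(1) mu_nonneg[OF J] by simp
        ultimately show ?thesis using A(2,3) by simp
      qed
    qed
  next
    case (schreier as)
    show ?case
    proof (intro allI impI)
      fix J assume J: "J \<subseteq> F"
      show "\<bar>val (list_sum as) J\<bar> \<le> A + b * mu J"
      proof (cases "mu J \<le> A")
        case True
        then show ?thesis using val_le_mu[OF J family_sum_in_norming_set[OF schreier(1)]] b(1) mu_nonneg[OF J]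
          by (simp add: add_increasing2)
      next
        case False
        obtain a where a: "a \<in> set as" "\<bar>val (list_sum as) J\<bar> \<le> max E0 (\<bar>val (fst a) J\<bar> + E) + d * mu J"
          using sch[OF schreier(1) J] by blast
        \<comment> \<open>The parts of \<open>a\<close> obey the induction hypothesis, so averaging
          leaves b / 2 * mu J to spare: one half of it covers b * M + E because A < mu J, the other
          half covers d * mu J. If the maximum is E0, then E0 \<le> A is enough.\<close>
        obtain fs where fs: "average_of (norming_set n) a fs" "\<forall>g\<in>set fs. \<forall>J\<subseteq>F. \<bar>val g J\<bar> \<le> A + b * mu J"
          using schreier(2)[OF a(1)] by blast
        have "\<bar>val (fst a) J\<bar> \<le> A + b / 2 * mu J + b * M" by (rule avg[OF fs(1)]) (use fs J in auto)
        moreover have "b / 4 * A \<le> b / 4 * mu J" using False b(1) by (intro mult_left_mono) auto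
        moreover have "d * mu J \<le> b / 4 * mu J" using b(2) mu_nonneg[OF J] by (intro mult_right_mono) auto
        moreover have "0 \<le> b * mu J" using b(1) mu_nonneg[OF J] by simp
        ultimately show ?thesis using a(2) A(1-3) by (simp add: max_def split: if_splits)
      qed
    qed
  qed
  then show ?thesis using J by blast
qed

end

section \<open>The tail of a Schreier sum acting on blocks\<close>

context blocks
begin

lemma family_proper_fst: "family n k as \<Longrightarrow> a \<in> set as \<Longrightarrow> fst a \<in> norming_set n \<and> proper (fst a)"
  using average_in_norming_set family_proper unfolding family_def by blast

lemma val_list_sum: "val (list_sum as) J = (\<Sum>a\<leftarrow>as. val (fst a) J)"
  unfolding val_def dual_pair_list_sum by (induction as) (simp_all add: sum.distrib)

lemma val_Diff: "K \<subseteq> J \<Longrightarrow> J \<subseteq> F \<Longrightarrow> val f J = val f K + val f (J - K)"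
  unfolding val_def using fin by (subst add.commute) (rule sum.subset_diff, auto dest: finite_subset)

text \<open>The first \<open>\<alpha>\<close>-average \<open>a\<close> that acts on the blocks may have small size; the sizes of all later
  ones exceed \<open>lo\<close> of the first block.\<close>

lemma first_hit:
  assumes fam: "family n k as" and J: "J \<subseteq> F"
  obtains "\<And>b. b \<in> set as \<Longrightarrow> val (fst b) J = 0"
  | us a vs j where "as = us @ a # vs" "\<And>b K. b \<in> set us \<Longrightarrow> K \<subseteq> J \<Longrightarrow> val (fst b) K = 0"
    "j \<in> J" "hits (fst a) j"
proof (cases "\<exists>a\<in>set as. \<exists>j\<in>J. hits (fst a) j")
  case True
  then obtain us a vs where *: "as = us @ a # vs" "\<exists>j\<in>J. hits (fst a) j" "\<forall>b\<in>set us. \<not> (\<exists>j\<in>J. hits (fst b) j)"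
    using split_list_first_prop[of as "\<lambda>a. \<exists>j\<in>J. hits (fst a) j"] by blast
  have "val (fst b) K = 0" if "b \<in> set us" "K \<subseteq> J" for b K
    unfolding val_def by (rule sum.neutral) (use * that J not_hits in blast)
  then show ?thesis using that(2) * by blast
next
  case False
  have "val (fst b) J = 0" if "b \<in> set as" for b
    unfolding val_def by (rule sum.neutral) (use False that J not_hits in blast)
  then show ?thesis using that(1) by blast
qed

text \<open>Let a be the first average that hits a block, and j1 the first block it hits. On all
  other blocks the later averages contribute only an error, since their sizes are large. If a
  reaches beyond j1, no later average meets j1, and the sum equals the value of a up to this error.
  Otherwise a acts on j1 alone, and the whole sum is the action on the single block j1, at most M,
  up to the same error.\<close>

lemma c0_estimate:
  assumes n: "n = Suc p" and w: "\<And>j. j \<in> F \<Longrightarrow> w j = M" and M: "0 \<le> M"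
    and \<epsilon>: "\<And>i. i \<in> F \<Longrightarrow> \<epsilon> i \<le> d" "\<And>i j. i \<in> F \<Longrightarrow> j \<in> F \<Longrightarrow> i < j \<Longrightarrow> real (hi i) * \<epsilon> j \<le> d"
      "\<And>i. 0 \<le> \<epsilon> i" and d: "0 \<le> d" "real (card F) * d \<le> 1"
    and small: "\<And>i j bs. i \<in> F \<Longrightarrow> j \<in> F \<Longrightarrow> i \<le> j \<Longrightarrow> family n p bs \<Longrightarrow> (\<And>b. b \<in> set bs \<Longrightarrow> lo i < snd b) \<Longrightarrow>
      (\<Sum>b\<leftarrow>bs. \<bar>dual_pair (fst b) (z j)\<bar>) \<le> M * \<epsilon> i"
    and f: "f \<in> norming_set n"
  shows "\<bar>val f F\<bar> \<le> 12 * M"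
proof -
  have muJ: "mu J = real (card J) * M" if "J \<subseteq> F" for J using w that by (simp add: subset_iff)
  have sch: "\<exists>a\<in>set as. \<bar>val (list_sum as) J\<bar> \<le> max M (\<bar>val (fst a) J\<bar> + 0) + 2 * d * mu J"
    if fam: "family n n as" and J: "J \<subseteq> F" for as J
    using fam J
  proof (cases rule: first_hit)
    case 1
    have "as \<noteq> []" using fam schreier_basic(2)[of "{}" n] by (auto simp: family_def)
    then have "hd as \<in> set as" by simp
    moreover have "val (list_sum as) J = 0" unfolding val_list_sum using 1 by (simp add: sum_list_zero)
    ultimately show ?thesis using M d mu_nonneg[OF J] by (intro bexI[of _ "hd as"]) auto
  next
    case (2 us a vs j0)
    have finJ: "finite J" using J fin finite_subset by blast
    let ?H = "{j \<in> J. hits (fst a) j}"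
    define j1 where "j1 = Min ?H"
    have j1: "j1 \<in> J" "hits (fst a) j1" "\<And>j. j \<in> ?H \<Longrightarrow> j1 \<le> j"
      using Min_in[of ?H] 2 finJ by (auto simp: j1_def)
    have a: "a \<in> set as" using 2 by simp
    have sorted: "sorted_wrt growing (a # vs)" using fam 2(1) by (auto simp: family_def sorted_wrt_append)
    have gr: "growing a b" if "b \<in> set vs" for b using sorted that by simp
    have W: "fst b \<in> norming_set n" "proper (fst b)" if "b \<in> set (a # vs)" for b
      using family_proper_fst[OF fam, of b] that 2(1) by auto
    have vl: "vec_less (fst a) (fst b)" if "b \<in> set vs" for b using gr[OF that] by (simp add: growing_def)
    define R where "R j = (\<Sum>b\<leftarrow>vs. dual_pair (fst b) (z j))" for j
    have Min_a: "Min (supp (fst a)) \<le> hi j1" and Max_a: "lo j1 \<le> Max (supp (fst a))"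
      using j1(2) W(2)[of a] by (auto simp: hits_def proper_def intro: order_trans[OF Min_le] order_trans[OF _ Max_ge])
    \<comment> \<open>The first later average hitting j is only known to have size beyond lo j1, and
      it is estimated by itself with \<epsilon> j1. Those after it have size beyond lo j, so that
      even hi j1 many S_p families of them are small by the choice of \<epsilon> j.\<close>
    have R: "\<bar>R j\<bar> \<le> 2 * d * M" if j: "j \<in> J" "j \<noteq> j1" for j
    proof (cases "\<exists>b\<in>set vs. hits (fst b) j")
      case False
      have "R j = 0" unfolding R_def by (rule sum_list_zero) (use False j J not_hits in blast)
      then show ?thesis using M d by simp
    next
      case True
      then obtain us' b ws where *: "vs = us' @ b # ws" "hits (fst b) j" "\<forall>c\<in>set us'. \<not> hits (fst c) j"
        using split_list_first_prop[of vs "\<lambda>b. hits (fst b) j"] by blast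
      have b: "b \<in> set vs" using * by simp
      have "j1 \<le> j" using hits_order[OF vl[OF b] W(2) W(2) j1(2) *(2)] b by simp
      then have less: "j1 < j" using j by simp
      have F: "j \<in> F" "j1 \<in> F" using j j1 J by auto
      have "(\<Sum>c\<leftarrow>us'. dual_pair (fst c) (z j)) = 0"
        by (rule sum_list_zero) (use * F not_hits in blast)
      then have "R j = dual_pair (fst b) (z j) + (\<Sum>c\<leftarrow>ws. dual_pair (fst c) (z j))"
        unfolding R_def *(1) by simp
      moreover have "\<bar>dual_pair (fst b) (z j)\<bar> \<le> M * d"
      proof -
        have "family n p [b]"
          using fam b 2(1) proper_ge_1[OF W(2) proper_Min[OF W(2)], of b]
          by (auto simp: family_def intro!: schreier_singleton)
        then have "(\<Sum>c\<leftarrow>[b]. \<bar>dual_pair (fst c) (z j)\<bar>) \<le> M * \<epsilon> j1"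
          by (rule small[rotated 3]) (use F less gr[OF b] Max_a in \<open>auto simp: growing_def\<close>)
        also have "\<dots> \<le> M * d" using \<epsilon>(1) F M by (intro mult_left_mono) auto
        finally show ?thesis by simp
      qed
      moreover have "\<bar>\<Sum>c\<leftarrow>ws. dual_pair (fst c) (z j)\<bar> \<le> M * d"
      proof -
        \<comment> \<open>Decomposing the minima from \<open>a\<close> on, and not only those of
          \<open>ws\<close>, bounds the number of S_p pieces by the minimum of the support of
          \<open>a\<close>, hence by hi j1, independently of j.\<close>
        let ?m = "\<lambda>c. Min (supp (fst c))"
        have "?m ` set (a # vs) \<in> schreier (Suc p)"
          using fam n 2(1) schreier_subset[of "?m ` set as" n "?m ` set (a # vs)"] by (auto simp: family_def)
        then obtain Hs where Hs: "Hs \<noteq> []" "set Hs \<subseteq> schreier p" "sorted_wrt set_less Hs"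
          "length Hs \<le> Min (hd Hs)" "?m ` set (a # vs) = \<Union>(set Hs)" unfolding schreier_Suc by blast
        have "Min (hd Hs) \<le> ?m a"
        proof (rule Min_hd_le[OF Hs(3)])
          show "finite H \<and> H \<noteq> {}" if "H \<in> set Hs" for H using schreier_basic[of H p] that Hs(2) by blast
          show "?m a \<in> \<Union>(set Hs)" unfolding Hs(5)[symmetric] by simp
        qed
        then have len: "length Hs \<le> hi j1" using Hs(4) Min_a by simp
        have part: "(\<Sum>c\<leftarrow>filter (\<lambda>c. ?m c \<in> H) ws. \<bar>dual_pair (fst c) (z j)\<bar>) \<le> M * \<epsilon> j" if H: "H \<in> set Hs" for H
        proof (cases "filter (\<lambda>c. ?m c \<in> H) ws = []")
          case True
          then show ?thesis unfolding True using M \<epsilon>(3) by simp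
        next
          case False
          have sub: "set ws \<subseteq> set as" using *(1) 2(1) by auto
          have sw: "sorted_wrt growing (b # ws)" using sorted *(1) by (simp add: sorted_wrt_append)
          have "family n p (filter (\<lambda>c. ?m c \<in> H) ws)"
            unfolding family_def
          proof (intro conjI)
            show "\<forall>c\<in>set (filter (\<lambda>c. ?m c \<in> H) ws). \<exists>fs. average_of (norming_set n) c fs"
              using fam sub by (auto simp: family_def)
            show "sorted_wrt growing (filter (\<lambda>c. ?m c \<in> H) ws)" using sw by (simp add: sorted_wrt_filter)
            show "?m ` set (filter (\<lambda>c. ?m c \<in> H) ws) \<in> schreier p"
            proof (rule schreier_subset)
              show "H \<in> schreier p" using H Hs(2) by blast
              show "?m ` set (filter (\<lambda>c. ?m c \<in> H) ws) \<subseteq> H" by auto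
              show "?m ` set (filter (\<lambda>c. ?m c \<in> H) ws) \<noteq> {}" using False by (simp only: image_is_empty set_empty)simp
            qed
          qed
          then show ?thesis
          proof (rule small[rotated 3])
            fix c assume "c \<in> set (filter (\<lambda>c. ?m c \<in> H) ws)"
            then have "growing b c" using sw by simp
            moreover have "lo j \<le> Max (supp (fst b))"
            proof -
              obtain i where "i \<in> supp (fst b)" "lo j \<le> i" using *(2) by (auto simp: hits_def)
              moreover from this have "i \<le> Max (supp (fst b))" using W(2)[of b] b by (simp add: proper_def)
              ultimately show ?thesis by linarith
            qed
            ultimately show "lo j < snd c" by (simp add: growing_def)
          qed (use F in auto)
        qed
        have "\<bar>\<Sum>c\<leftarrow>ws. dual_pair (fst c) (z j)\<bar> \<le> (\<Sum>c\<leftarrow>ws. \<bar>dual_pair (fst c) (z j)\<bar>)" by (rule sum_list_abs_le)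
        also have "\<dots> \<le> (\<Sum>H\<leftarrow>Hs. \<Sum>c\<leftarrow>filter (\<lambda>c. ?m c \<in> H) ws. \<bar>dual_pair (fst c) (z j)\<bar>)"
        proof (rule sum_list_filter_cover)
          fix c assume "c \<in> set ws"
          then have "?m c \<in> ?m ` set (a # vs)" using *(1) by auto
          then show "?m c \<in> \<Union>(set Hs)" by (simp only: Hs(5))
        qed simp
        also have "\<dots> \<le> (\<Sum>H\<leftarrow>Hs. M * \<epsilon> j)" by (rule sum_list_mono_on) (rule part)
        also have "\<dots> = M * (real (length Hs) * \<epsilon> j)" by (simp add: sum_list_triv)
        also have "\<dots> \<le> M * (real (hi j1) * \<epsilon> j)" using len M \<epsilon>(3) by (intro mult_left_mono mult_right_mono) auto
        also have "\<dots> \<le> M * d" using \<epsilon>(2)[OF F(2,1) less] M by (intro mult_left_mono) auto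
        finally show ?thesis .
      qed
      moreover have "2 * d * M = M * d + M * d" by simp
      ultimately show ?thesis by linarith
    qed
    have us0: "(\<Sum>b\<leftarrow>us. val (fst b) K) = 0" if "K \<subseteq> J" for K
      by (rule sum_list_zero) (use 2(2) that in blast)
    have val_eq: "val (list_sum as) K = val (fst a) K + (\<Sum>j\<in>K. R j)" if "K \<subseteq> J" for K
    proof -
      have "(\<Sum>b\<leftarrow>vs. val (fst b) K) = (\<Sum>j\<in>K. R j)"
        unfolding R_def val_def by (induction vs) (simp_all add: sum.distrib)
      then show ?thesis unfolding val_list_sum 2(1) using us0[OF that] by simp
    qed
    have rest: "\<bar>\<Sum>j\<in>J - {j1}. R j\<bar> \<le> 2 * d * mu J"
    proof -
      have "\<bar>\<Sum>j\<in>J - {j1}. R j\<bar> \<le> (\<Sum>j\<in>J - {j1}. \<bar>R j\<bar>)" by (rule sum_abs)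
      also have "\<dots> \<le> (\<Sum>j\<in>J - {j1}. 2 * d * M)" by (rule sum_mono) (use R in auto)
      also have "\<dots> \<le> (\<Sum>j\<in>J. 2 * d * M)" by (rule sum_mono2) (use finJ M d in auto)
      finally show ?thesis using muJ[OF J] by (simp add: algebra_simps)
    qed
    show ?thesis
    proof (rule bexI[OF _ a], cases "Max (supp (fst a)) \<le> hi j1")
      case True
      have "dual_pair (fst a) (z j) = 0" if j: "j \<in> J - {j1}" for j
      proof (rule not_hits)
        show "\<not> hits (fst a) j"
        proof
          assume h: "hits (fst a) j"
          then have "j1 < j" using j1(3)[of j] j by auto
          obtain i where "i \<in> supp (fst a)" "lo j \<le> i" using h by (auto simp: hits_def)
          moreover from this have "i \<le> Max (supp (fst a))" using W(2)[of a] by (simp add: proper_def)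
          ultimately have "lo j \<le> hi j1" using True by linarith
          then show False using hi_less_lo[OF \<open>j1 < j\<close>] by simp
        qed
      qed (use j J in auto)
      then have "val (fst a) (J - {j1}) = 0" unfolding val_def by simp
      then have "val (list_sum as) (J - {j1}) = (\<Sum>j\<in>J - {j1}. R j)" using val_eq[of "J - {j1}"] by auto
      moreover have "\<bar>val (list_sum as) {j1}\<bar> \<le> M"
        using val_le_mu[of "{j1}"] family_sum_in_norming_set[OF fam] j1 J w by auto
      moreover have "val (list_sum as) J = val (list_sum as) {j1} + val (list_sum as) (J - {j1})"
        using j1 J by (intro val_Diff) auto
      ultimately show "\<bar>val (list_sum as) J\<bar> \<le> max M (\<bar>val (fst a) J\<bar> + 0) + 2 * d * mu J" using rest by linarith
    next
      case False
      have "R j1 = 0"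
        unfolding R_def
      proof (rule sum_list_zero)
        fix b assume b: "b \<in> set vs"
        have "\<not> hits (fst b) j1"
        proof
          assume "hits (fst b) j1"
          then obtain i where "i \<in> supp (fst b)" "i \<le> hi j1" by (auto simp: hits_def)
          then have "Max (supp (fst a)) < i" using vec_lessD[OF vl[OF b] W(2) W(2) proper_Max[OF W(2)]] b by simp
          then show False using False \<open>i \<le> hi j1\<close> by simp
        qed
        then show "dual_pair (fst b) (z j1) = 0" using not_hits j1 J by blast
      qed
      then have "(\<Sum>j\<in>J. R j) = (\<Sum>j\<in>J - {j1}. R j)" using j1 finJ by (simp add: sum.remove)
      then show "\<bar>val (list_sum as) J\<bar> \<le> max M (\<bar>val (fst a) J\<bar> + 0) + 2 * d * mu J"
        using rest val_eq[of J] by simp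
    qed
  qed
  \<comment> \<open>Here A = 4 * M and b = 8 * d: with these values the requirements 2 * d \<le> b /
    4 and b * M \<le> b / 4 * A hold with equality.\<close>
  have "\<bar>val f F\<bar> \<le> 4 * M + 8 * d * mu F"
    by (rule main_estimate[where ?E0.0 = M and E = 0 and d = "2 * d" and M = M]) (use M w d sch f in auto)
  also have "8 * d * mu F = 8 * M * (real (card F) * d)" using muJ[of F] by simp
  also have "\<dots> \<le> 8 * M * 1" using d M by (intro mult_left_mono) auto
  finally show ?thesis by simp
qed

text \<open>The blocks in which some average starts are collected in B. Averages starting in
  different blocks have increasing minima, so the ends of the blocks of B form an S_n set and B has
  mass at most \<epsilon>. Off B, different averages hit disjoint sets S c of blocks. A later
  average divides the mass of S c by its size, which is at least lo of a block hit by a, and loses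
  only the heaviest block of S c. These heaviest blocks, one for each average, again have total mass
  at most \<epsilon>.\<close>

lemma special_combination_estimate:
  assumes \<epsilon>: "0 \<le> \<epsilon>" "\<And>G. G \<subseteq> F \<Longrightarrow> hi ` G \<in> schreier n \<Longrightarrow> mu G \<le> \<epsilon>"
    and b: "0 < b" "\<And>j. j \<in> F \<Longrightarrow> 1 / real (lo j) \<le> b / 4"
    and f: "f \<in> norming_set n"
  shows "\<bar>val f F\<bar> \<le> 4 * \<epsilon> + 12 * \<epsilon> / b + b * mu F"
proof -
  have w_le: "w j \<le> \<epsilon>" if "j \<in> F" for j
    using \<epsilon>(2)[of "{j}"] that schreier_singleton[of "hi j" n] lo_ge_1[of j] lo_le_hi[of j] by simp
  have sch: "\<exists>a\<in>set as. \<bar>val (list_sum as) J\<bar> \<le> max 0 (\<bar>val (fst a) J\<bar> + 3 * \<epsilon>) + b / 4 * mu J"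
    if fam: "family n n as" and J: "J \<subseteq> F" for as J
    using fam J
  proof (cases rule: first_hit)
    case 1
    have "as \<noteq> []" using fam schreier_basic(2)[of "{}" n] by (auto simp: family_def)
    then have "hd as \<in> set as" by simp
    moreover have "val (list_sum as) J = 0" unfolding val_list_sum using 1 by (simp add: sum_list_zero)
    ultimately show ?thesis using b \<epsilon> mu_nonneg[OF J] by (intro bexI[of _ "hd as"]) auto
  next
    case (2 us a vs j0)
    let ?m = "\<lambda>c. Min (supp (fst c))"
    have finJ: "finite J" using J fin finite_subset by blast
    have a: "a \<in> set as" using 2 by simp
    have sub: "set (a # vs) \<subseteq> set as" using 2(1) by auto
    have sorted: "sorted_wrt growing (a # vs)" using fam 2(1) by (auto simp: family_def sorted_wrt_append)
    have W: "fst b \<in> norming_set n" "proper (fst b)" if "b \<in> set as" for b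
      using family_proper_fst[OF fam, of b] that by auto
    \<comment> \<open>If the blocks of G carry averages with increasing minima, none of them after
      the end of its block, then the spreading property puts the ends of the blocks of G into
      S_n.\<close>
    have transport: "mu G \<le> \<epsilon>" if G: "G \<subseteq> F" "\<And>g. g \<in> G \<Longrightarrow> \<psi> g \<in> set as \<and> ?m (\<psi> g) \<le> hi g"
      "\<And>g h. g \<in> G \<Longrightarrow> h \<in> G \<Longrightarrow> g < h \<Longrightarrow> ?m (\<psi> g) < ?m (\<psi> h)" for G \<psi>
    proof (cases "G = {}")
      case False
      have "hi ` G \<in> schreier n"
      proof (rule schreier_spread[of "?m ` set as" n G "\<lambda>g. ?m (\<psi> g)" hi])
        show "?m ` set as \<in> schreier n" using fam by (simp add: family_def)
        show "finite G" using G fin finite_subset by blast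
        show "strict_mono_on G (\<lambda>g. ?m (\<psi> g))" using G(3) by (rule strict_mono_onI)
        show "strict_mono_on G hi" using hi_less_lo lo_le_hi by (intro strict_mono_onI) (meson less_le_trans)
      qed (use G False in auto)
      then show ?thesis using \<epsilon>(2) G(1) by blast
    qed (use \<epsilon> in simp)
    let ?bad = "\<lambda>j b. b \<in> set as \<and> lo j \<le> ?m b \<and> ?m b \<le> hi j"
    define B where "B = {j \<in> J. \<exists>b. ?bad j b}"
    define K where "K = J - B"
    have BJ: "B \<subseteq> J" "B \<subseteq> F" and KJ: "K \<subseteq> J" "K \<subseteq> F" using J by (auto simp: B_def K_def)
    have finK: "finite K" using finJ by (simp add: K_def)
    have "\<forall>j\<in>B. \<exists>b. ?bad j b" by (simp add: B_def)
    from bchoice[OF this] obtain \<psi> where \<psi>: "\<And>j. j \<in> B \<Longrightarrow> ?bad j (\<psi> j)" by blast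
    have muB: "mu B \<le> \<epsilon>"
    proof (rule transport[OF BJ(2)])
      fix g h assume "g \<in> B" "h \<in> B" "g < h"
      then show "?m (\<psi> g) < ?m (\<psi> h)" using \<psi>[of g] \<psi>[of h] hi_less_lo[of g h] by linarith
    qed (use \<psi> in auto)
    define S where "S c = {j \<in> K. hits (fst c) j}" for c :: sized_average
    have SK: "S b \<subseteq> K" "finite (S b)" for b using finK by (auto simp: S_def)
    have order: "g \<le> h" if "growing c c'" "c \<in> set as" "c' \<in> set as" "g \<in> S c" "h \<in> S c'" for c c' g h
      using hits_order[of "fst c" "fst c'" g h] that W by (auto simp: growing_def S_def)
    \<comment> \<open>If two averages hit the same block, the later one starts inside its interval,
      which is excluded off B.\<close>
    have disj: "S c \<inter> S c' = {}" if c: "growing c c'" "c \<in> set as" "c' \<in> set as" for c c'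
    proof (rule ccontr)
      assume "S c \<inter> S c' \<noteq> {}"
      then obtain j where j: "j \<in> K" "hits (fst c) j" "hits (fst c') j" by (auto simp: S_def)
      then obtain i i' where i: "i \<in> supp (fst c)" "lo j \<le> i" "i' \<in> supp (fst c')" "i' \<le> hi j"
        by (auto simp: hits_def)
      have "i < ?m c'" using vec_lessD[of "fst c" "fst c'" i "?m c'"] c W i proper_Min by (simp add: growing_def)
      moreover have "?m c' \<le> i'" using i W(2)[OF c(3)] by (simp add: proper_def)
      ultimately have "?bad j c'" using i c by simp
      then show False using j(1) unfolding K_def B_def by blast
    qed
    have disj_sorted: "sorted_wrt (\<lambda>c c'. S c \<inter> S c' = {}) vs"
    proof (rule sorted_wrt_mono_rel[of vs growing])
      fix c c' assume "c \<in> set vs" "c' \<in> set vs" "growing c c'"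
      moreover from this have "c \<in> set as" "c' \<in> set as" using sub by auto
      ultimately show "S c \<inter> S c' = {}" using disj by blast
    qed (use sorted in simp)
    have "\<exists>j. S c \<noteq> {} \<longrightarrow> j \<in> S c \<and> (\<forall>k\<in>S c. w k \<le> w j)" for c
    proof (cases "S c = {}")
      case False
      then show ?thesis using Max_in[of "w ` S c"] Max_ge[of "w ` S c"] SK(2)[of c]
        by (metis (no_types, lifting) finite_imageI imageE imageI image_is_empty)
    qed simp
    then have "\<forall>c. \<exists>j. S c \<noteq> {} \<longrightarrow> j \<in> S c \<and> (\<forall>k\<in>S c. w k \<le> w j)" by blast
    from choice[OF this] obtain top where
      top: "\<And>c. S c \<noteq> {} \<Longrightarrow> top c \<in> S c" "\<And>c k. k \<in> S c \<Longrightarrow> w k \<le> w (top c)" by blast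
    define T where "T c = (if S c = {} then {} else {top c})" for c
    have TS: "T c \<subseteq> S c" for c using top(1) by (simp add: T_def)
    have TF: "T c \<subseteq> F" for c using TS SK KJ by blast
    define G where "G = (\<Union>c\<in>set vs. T c)"
    have GF: "G \<subseteq> F" using TF by (auto simp: G_def)
    have muG: "mu G \<le> \<epsilon>"
    proof -
      have "\<forall>g\<in>G. \<exists>c. c \<in> set vs \<and> g \<in> T c" by (auto simp: G_def)
      from bchoice[OF this] obtain \<phi> where \<phi>: "\<And>g. g \<in> G \<Longrightarrow> \<phi> g \<in> set vs \<and> g \<in> T (\<phi> g)" by blast
      show ?thesis
      proof (rule transport[OF GF])
        fix g assume g: "g \<in> G"
        then have "g \<in> S (\<phi> g)" using \<phi> TS by blast
        have as: "\<phi> g \<in> set as" using \<phi>[OF g] sub by auto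
        obtain i where "i \<in> supp (fst (\<phi> g))" "i \<le> hi g"
          using \<open>g \<in> S (\<phi> g)\<close> by (auto simp: S_def hits_def)
        then show "\<phi> g \<in> set as \<and> ?m (\<phi> g) \<le> hi g"
          using as W(2)[OF as] by (auto simp: proper_def intro: order_trans[OF Min_le])
      next
        fix g h assume gh: "g \<in> G" "h \<in> G" "g < h"
        have in_as: "\<phi> g \<in> set as" "\<phi> h \<in> set as" using \<phi>[OF gh(1)] \<phi>[OF gh(2)] sub by auto
        have in_S: "g \<in> S (\<phi> g)" "h \<in> S (\<phi> h)" using \<phi> gh TS by blast+
        have "\<phi> g \<noteq> \<phi> h" using \<phi>[OF gh(1)] \<phi>[OF gh(2)] gh(3) by (auto simp: T_def split: if_splits)
        moreover have "\<not> growing (\<phi> h) (\<phi> g)" using order[of "\<phi> h" "\<phi> g" h g] in_as in_S gh(3) by auto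
        moreover have "\<phi> g = \<phi> h \<or> growing (\<phi> g) (\<phi> h) \<or> growing (\<phi> h) (\<phi> g)"
        proof (rule sorted_wrt_cases)
          show "sorted_wrt growing vs" using sorted by simp
          show "\<phi> g \<in> set vs" "\<phi> h \<in> set vs" using \<phi>[OF gh(1)] \<phi>[OF gh(2)] by auto
        qed
        ultimately have "growing (\<phi> g) (\<phi> h)" by blast
        then show "?m (\<phi> g) < ?m (\<phi> h)" by (rule growing_Min_less[OF _ W(2) W(2), OF _ in_as])
      qed
    qed
    have est: "\<bar>val (fst c) K\<bar> \<le> mu (T c) + b / 4 * mu (S c)" if c: "c \<in> set vs" for c
    proof -
      obtain fs where fs: "average_of (norming_set n) c fs" using fam c sub by (auto simp: family_def)
      have bd: "\<bar>val (fst c) (S c)\<bar> \<le> 0 + 1 * (mu (S c) / real (snd c) + mu (T c))"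
      proof (rule average_estimate[OF fs])
        show "S c \<subseteq> F" using SK KJ by blast
        show "0 \<le> mu (T c)" using mu_nonneg TF by blast
        show "w j \<le> mu (T c)" if "j \<in> S c" for j using top(2)[OF that] that by (auto simp: T_def)
        fix g J' assume "g \<in> set fs" "J' \<subseteq> S c"
        then show "\<bar>val g J'\<bar> \<le> 0 + 1 * mu J'"
          using val_le_mu[of J' g] fs SK(1)[of c] KJ by (auto simp: average_of_def)
      qed auto
      have "1 / real (snd c) \<le> b / 4"
      proof -
        obtain i where i: "i \<in> supp (fst a)" "lo j0 \<le> i" using 2(4) by (auto simp: hits_def)
        have "i \<le> Max (supp (fst a))" using i W(2)[OF a] by (simp add: proper_def)
        then have "lo j0 \<le> snd c" using i sorted c by (auto simp: growing_def)
        then have "1 / real (snd c) \<le> 1 / real (lo j0)" using lo_ge_1[of j0] by (intro divide_left_mono) auto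
        then show ?thesis using b(2)[of j0] 2(3) J by auto
      qed
      then have "mu (S c) * (1 / real (snd c)) \<le> mu (S c) * (b / 4)"
        using mu_nonneg[of "S c"] SK(1)[of c] KJ by (intro mult_left_mono) auto
      then have "mu (S c) / real (snd c) \<le> b / 4 * mu (S c)" by (simp add: mult.commute)
      moreover have "val (fst c) K = val (fst c) (S c)" using val_hits[OF KJ(2)] by (simp add: S_def)
      moreover have "\<bar>val (fst c) (S c)\<bar> \<le> mu (S c) / real (snd c) + mu (T c)" using bd by simp
      ultimately show ?thesis by linarith
    qed
    have "\<bar>\<Sum>c\<leftarrow>vs. val (fst c) K\<bar> \<le> (\<Sum>c\<leftarrow>vs. \<bar>val (fst c) K\<bar>)" by (rule sum_list_abs_le)
    also have "\<dots> \<le> (\<Sum>c\<leftarrow>vs. mu (T c) + b / 4 * mu (S c))" by (rule sum_list_mono_on) (rule est)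
    also have "\<dots> = (\<Sum>c\<leftarrow>vs. mu (T c)) + b / 4 * (\<Sum>c\<leftarrow>vs. mu (S c))"
      by (simp only: sum_list_addf sum_list_const_mult)
    also have "(\<Sum>c\<leftarrow>vs. mu (T c)) \<le> mu G"
    proof (rule sum_list_disjoint_le)
      show "sorted_wrt (\<lambda>c c'. T c \<inter> T c' = {}) vs"
        by (rule sorted_wrt_mono_rel[OF _ disj_sorted]) (use TS in blast)
      show "T c \<subseteq> G" if "c \<in> set vs" for c using that by (auto simp: G_def)
      show "finite G" using GF fin finite_subset by blast
      show "0 \<le> w j" if "j \<in> G" for j using that GF w_nonneg by blast
    qed
    also have "(\<Sum>c\<leftarrow>vs. mu (S c)) \<le> mu K"
      by (rule sum_list_disjoint_le[OF disj_sorted SK(1) finK]) (use KJ w_nonneg in blast)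
    also have "mu K \<le> mu J" by (rule mu_mono[OF KJ(1) J])
    finally have tail: "\<bar>\<Sum>c\<leftarrow>vs. val (fst c) K\<bar> \<le> \<epsilon> + b / 4 * mu J" using muG b(1) by simp
    have us0: "(\<Sum>c\<leftarrow>us. val (fst c) K) = 0"
      by (rule sum_list_zero) (use 2(2) KJ in blast)
    have "val (list_sum as) K = val (fst a) K + (\<Sum>c\<leftarrow>vs. val (fst c) K)"
      unfolding val_list_sum 2(1) using us0 by simp
    moreover have "val (list_sum as) J = val (list_sum as) B + val (list_sum as) K"
      "val (fst a) J = val (fst a) B + val (fst a) K"
      unfolding K_def by (rule val_Diff[OF BJ(1) J])+
    moreover have "\<bar>val (list_sum as) B\<bar> \<le> \<epsilon>" "\<bar>val (fst a) B\<bar> \<le> \<epsilon>"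
      using val_le_mu[OF BJ(2) family_sum_in_norming_set[OF fam]] val_le_mu[OF BJ(2) W(1)[OF a]] muB by auto
    \<comment> \<open>One \<epsilon> comes from the heaviest blocks and two from B, which is removed
      from the sum and put back for \<open>a\<close>.\<close>
    ultimately have "\<bar>val (list_sum as) J\<bar> \<le> \<bar>val (fst a) J\<bar> + 3 * \<epsilon> + b / 4 * mu J" using tail by linarith
    then show ?thesis using a by (intro bexI[of _ a]) auto
  qed
  \<comment> \<open>Singletons are S_n sets, so M = \<epsilon>. The value A = 4 * \<epsilon> + 12 *
    \<epsilon> / b solves b * \<epsilon> + 3 * \<epsilon> = b / 4 * A.\<close>
  show ?thesis
    by (rule main_estimate[where ?E0.0 = 0 and E = "3 * \<epsilon>" and d = "b / 4" and M = \<epsilon>])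
      (use \<epsilon> b w_le sch f in \<open>auto simp: field_simps\<close>)
qed

end

section \<open>Spreading models of block sequences\<close>

text \<open>Schreier sets are stable under strictly increasing maps; the coefficients are carried to
  the image of F through the inverse of r.\<close>

lemma C_equivalent_l1_subsequence:
  assumes "\<And>F. F \<in> schreier k \<Longrightarrow> C_equivalent C F x (\<lambda>a. \<Sum>i\<in>F. \<bar>a i\<bar>)" "strict_mono r"
    and F: "F \<in> schreier k"
  shows "C_equivalent C F (x \<circ> r) (\<lambda>a. \<Sum>i\<in>F. \<bar>a i\<bar>)"
  unfolding C_equivalent_def
proof
  fix a
  have inj: "inj_on r A" for A using assms(2) by (simp add: strict_mono_imp_inj_on inj_on_subset[OF _ subset_UNIV])
  have *: "C_equivalent C (r ` F) x (\<lambda>a. \<Sum>i\<in>r ` F. \<bar>a i\<bar>)"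
    by (rule assms(1)[OF schreier_strict_mono_image[OF F assms(2)]])
  have inv: "the_inv_into UNIV r (r i) = i" for i using inj by (simp add: the_inv_into_f_f)
  show "1 / C * (\<Sum>i\<in>F. \<bar>a i\<bar>) \<le> norm (\<Sum>i\<in>F. a i *\<^sub>R (x \<circ> r) i) \<and>
    norm (\<Sum>i\<in>F. a i *\<^sub>R (x \<circ> r) i) \<le> C * (\<Sum>i\<in>F. \<bar>a i\<bar>)"
    using *[unfolded C_equivalent_def, rule_format, of "a \<circ> the_inv_into UNIV r"]
    by (simp add: sum.reindex[OF inj] inv)
qed

lemma norm_sum_perturb:
  fixes u v :: "nat \<Rightarrow> 'a::real_normed_vector"
  assumes "\<And>j. j \<in> F \<Longrightarrow> norm (u j - v j) \<le> \<eta> j"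
  shows "\<bar>norm (\<Sum>j\<in>F. a j *\<^sub>R u j) - norm (\<Sum>j\<in>F. a j *\<^sub>R v j)\<bar> \<le> (\<Sum>j\<in>F. \<bar>a j\<bar> * \<eta> j)"
proof -
  have "\<bar>norm (\<Sum>j\<in>F. a j *\<^sub>R u j) - norm (\<Sum>j\<in>F. a j *\<^sub>R v j)\<bar>
      \<le> norm ((\<Sum>j\<in>F. a j *\<^sub>R u j) - (\<Sum>j\<in>F. a j *\<^sub>R v j))" by (rule norm_triangle_ineq3)
  also have "\<dots> = norm (\<Sum>j\<in>F. a j *\<^sub>R (u j - v j))" by (simp add: sum_subtractf scaleR_diff_right)
  also have "\<dots> \<le> (\<Sum>j\<in>F. \<bar>a j\<bar> * \<eta> j)"
    by (rule sum_norm_le) (use assms in \<open>auto intro: mult_left_mono\<close>)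
  finally show ?thesis .
qed

lemma sorted_wrt_concat_map:
  assumes "sorted_wrt (<) ms" "\<And>m. m \<in> set ms \<Longrightarrow> sorted_wrt R (g m)"
    "\<And>m m' a b. m \<in> set ms \<Longrightarrow> m' \<in> set ms \<Longrightarrow> m < m' \<Longrightarrow> a \<in> set (g m) \<Longrightarrow> b \<in> set (g m') \<Longrightarrow> R a b"
  shows "sorted_wrt R (concat (map g ms))"
  using assms
proof (induction ms)
  case (Cons m ms)
  have "sorted_wrt R (concat (map g ms))"
  proof (rule Cons.IH)
    show "R a b" if "m1 \<in> set ms" "m2 \<in> set ms" "m1 < m2" "a \<in> set (g m1)" "b \<in> set (g m2)" for m1 m2 a b
      by (rule Cons.prems(3)[of m1 m2]) (use that in auto)
  qed (use Cons.prems(1,2) in auto)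
  moreover have "R a b" if "a \<in> set (g m)" "m' \<in> set ms" "b \<in> set (g m')" for m' a b
    by (rule Cons.prems(3)[of m m']) (use that Cons.prems(1) in auto)
  ultimately show ?case using Cons.prems(2) by (auto simp: sorted_wrt_append)
qed simp

text \<open>Negation is \<open>clip\<close> with sign -1 and no restriction, where the filter
  removes nothing.\<close>

lemma family_uminus:
  assumes "family n k bs"
  shows "family n k (map (\<lambda>b. (\<lambda>i. - fst b i, snd b)) bs)"
proof -
  have eq: "clip (-1) UNIV f = (\<lambda>i. - f i)" for f by (rule ext) (simp add: clip_def)
  have "filter (\<lambda>b. supp (fst b) \<noteq> {}) (map (\<lambda>a. (clip (-1) UNIV (fst a), snd a)) bs)
      = map (\<lambda>a. (clip (-1) UNIV (fst a), snd a)) bs"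
    using family_proper[OF assms] clip_supp[of "-1" UNIV]
    by (intro filter_True) (auto simp: proper_def simp del: ex_in_conv)
  moreover have "bs \<noteq> []" using assms schreier_basic(2)[of "{}" k] by (auto simp: family_def)
  ultimately show ?thesis
    using family_clip[OF assms, of "\<lambda>_. -1" _ UNIV] by (simp add: eq)
qed

locale block_sequence = X01_completion n J for n and J :: "(nat \<Rightarrow> real) \<Rightarrow> 'a::banach" +
  fixes y :: "nat \<Rightarrow> nat \<Rightarrow> real" and lo hi :: "nat \<Rightarrow> nat" and B :: real
  assumes y_c00: "y i \<in> c00" and y_supp: "supp (y i) \<subseteq> {lo i..hi i}"
    and y_lo: "1 \<le> lo i" and y_lo_hi: "lo i \<le> hi i" and y_step: "hi i < lo (Suc i)"
    and y_bound: "norm (J (y i)) \<le> B"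
begin

lemma hi_lo: "i < j \<Longrightarrow> hi i < lo j"
proof (induction j)
  case (Suc j)
  then show ?case using y_step[of j] y_lo_hi[of j] by (cases "i = j") auto
qed simp

lemma less_lo: "i < lo i"
proof (induction i)
  case 0
  then show ?case using y_lo[of 0] by simp
next
  case (Suc i)
  then show ?case using y_step[of i] y_lo_hi[of i] by simp
qed

lemma strict_mono_hi: "strict_mono hi"
  using y_step y_lo_hi by (intro strict_mono_Suc_iff[THEN iffD2]) (meson less_le_trans)

lemma y_dual_pair: "f \<in> norming_set n \<Longrightarrow> \<bar>dual_pair f (y i)\<bar> \<le> B"
  using dual_pair_le_norm[of f n "y i"] y_bound[of i] J_norm[OF y_c00, of i] by simp

lemma B_nonneg: "0 \<le> B"
  using y_bound[of 0] norm_ge_zero order_trans by blast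

lemma dual_pair_scale: "v \<in> c00 \<Longrightarrow> dual_pair f (\<lambda>i. t * v i) = t * dual_pair f v"
  using dual_pair_sum[of "{0::nat}" "\<lambda>_. v" f "\<lambda>_. t"] by simp

lemma blocks_scaled:
  assumes "finite F" "strict_mono s" "\<And>j. j \<in> F \<Longrightarrow> \<bar>a j\<bar> * B \<le> w j"
  shows "blocks n (\<lambda>j. lo (s j)) (\<lambda>j. hi (s j)) (\<lambda>j i. a j * y (s j) i) w F"
proof
  fix j f assume "j \<in> F" "f \<in> norming_set n"
  then have "\<bar>a j\<bar> * \<bar>dual_pair f (y (s j))\<bar> \<le> w j"
    using y_dual_pair[of f "s j"] assms(3)[of j] by (meson abs_ge_zero mult_left_mono order_trans)
  then show "\<bar>dual_pair f (\<lambda>i. a j * y (s j) i)\<bar> \<le> w j" using dual_pair_scale[OF y_c00] by (simp add: abs_mult)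
next
  fix j show "supp (\<lambda>i. a j * y (s j) i) \<subseteq> {lo (s j)..hi (s j)}"
    using y_supp[of "s j"] by (auto simp: supp_def)
qed (use assms y_lo y_lo_hi hi_lo in \<open>auto simp: strict_mono_less\<close>)

lemma norm_blocks_le:
  assumes "finite F" "\<And>f. f \<in> norming_set n \<Longrightarrow> \<bar>\<Sum>j\<in>F. dual_pair f (\<lambda>i. a j * y (s j) i)\<bar> \<le> K"
  shows "norm (\<Sum>j\<in>F. a j *\<^sub>R J (y (s j))) \<le> K"
  unfolding norm_J_sum[OF assms(1) y_c00]
proof (rule norm_le_dual_pair)
  fix f assume "f \<in> norming_set n"
  from assms(2)[OF this] show "dual_pair f (\<lambda>i. \<Sum>j\<in>F. a j * y (s j) i) \<le> K"
    using dual_pair_sum[OF assms(1) y_c00, where f = f and a = a] dual_pair_scale[OF y_c00] by simp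
qed

text \<open>First b is fixed so that the proportional term b * D is \<delta> / 2. Only then is the
  smallness e on S_n sets chosen, so that the remaining terms, which contain 1 / b, give the other
  half. The blocks are majorized by D * w j, hence the weights have to be small up to e / D.\<close>

lemma norm_special_combination_small:
  assumes "0 < \<delta>"
  shows "\<exists>F w. F \<in> schreier (Suc n) \<and> (\<forall>i. 0 \<le> w i) \<and> sum w F = 1 \<and>
    norm (\<Sum>j\<in>F. w j *\<^sub>R J (y j)) \<le> \<delta>"
proof -
  define D where "D = B + 1"
  have D: "0 < D" "B \<le> D" using B_nonneg by (auto simp: D_def)
  define b where "b = \<delta> / (2 * D)"
  define e where "e = \<delta> / (2 * (4 + 12 / b))"
  have b: "0 < b" "b * D = \<delta> / 2" using D assms by (auto simp: b_def)
  have pos: "0 < 4 + 12 / b" using b by (simp add: add_pos_pos)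
  then have e: "0 < e" "e * (4 + 12 / b) = \<delta> / 2" using assms by (auto simp: e_def field_simps)
  \<comment> \<open>Beyond N one has 1 / lo j \<le> b / 4, which is the gain from the sizes of the
    later averages.\<close>
  obtain N where N: "4 / b < real N" using reals_Archimedean2 by blast
  have "\<And>i. i < hi i" using less_lo y_lo_hi less_le_trans by blast
  from special_convex_combination[OF strict_mono_hi this, of "e / D" n N] e D
  obtain F w where F: "F \<in> schreier (Suc n)" "N \<le> Min F" "\<forall>i. 0 \<le> w i" "sum w F = 1"
    "\<forall>G\<subseteq>F. hi ` G \<in> schreier n \<longrightarrow> sum w G \<le> e / D" by auto
  note finF = schreier_basic(1)[OF F(1)]
  interpret bl: blocks n "\<lambda>j. lo (id j)" "\<lambda>j. hi (id j)" "\<lambda>j i. w j * y (id j) i" "\<lambda>j. D * w j" F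
  proof (rule blocks_scaled)
    show "\<bar>w j\<bar> * B \<le> D * w j" for j
      using mult_right_mono[OF D(2), of "w j"] F(3) by (simp add: mult.commute)
  qed (use finF in \<open>auto simp: strict_mono_def\<close>)
  have "norm (\<Sum>j\<in>F. w j *\<^sub>R J (y (id j))) \<le> \<delta>"
  proof (rule norm_blocks_le[OF finF])
    fix f assume f: "f \<in> norming_set n"
    have "\<bar>bl.val f F\<bar> \<le> 4 * e + 12 * e / b + b * sum (\<lambda>j. D * w j) F"
    proof (rule bl.special_combination_estimate)
      fix G assume G: "G \<subseteq> F" "(\<lambda>j. hi (id j)) ` G \<in> schreier n"
      then have "sum w G \<le> e / D" using F(5) by simp
      then show "(\<Sum>j\<in>G. D * w j) \<le> e" using D by (simp add: sum_distrib_left[symmetric] field_simps)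
    next
      fix j assume "j \<in> F"
      then have "N \<le> j" using F(2) finF by (meson Min_le order_trans)
      then have "4 / b < real (lo j)" using N less_lo[of j] by linarith
      moreover have "0 < real (lo j)" using y_lo[of j] by simp
      ultimately show "1 / real (lo (id j)) \<le> b / 4" using b by (simp add: field_simps)
    qed (use e b f in auto)
    also have "\<dots> = e * (4 + 12 / b) + b * D" using F(4) by (simp add: sum_distrib_left[symmetric] algebra_simps)
    also have "\<dots> = \<delta>" using e b by simp
    finally show "\<bar>\<Sum>j\<in>F. dual_pair f (\<lambda>i. w j * y (id j) i)\<bar> \<le> \<delta>" unfolding bl.val_def .
  qed
  then show ?thesis using F by auto
qed

text \<open>A functional restricted to the interval of one block stays in W, if anything remains of
  it, and annihilates the other blocks. This gives the lower c_0 estimate.\<close>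

lemma norm_block_le_norm_sum:
  fixes s :: "nat \<Rightarrow> nat"
  assumes "finite F" "strict_mono s" "k \<in> F"
  shows "\<bar>a k\<bar> * norm (J (y (s k))) \<le> norm (\<Sum>j\<in>F. a j *\<^sub>R J (y (s j)))"
proof (cases "a k = 0")
  case False
  let ?u = "\<lambda>i. \<Sum>j\<in>F. a j * y (s j) i"
  have "X01_norm n (y (s k)) \<le> X01_norm n ?u / \<bar>a k\<bar>"
  proof (rule norm_le_dual_pair)
    fix f assume f: "f \<in> norming_set n"
    define g where "g = clip 1 {lo (s k)..hi (s k)} f"
    have gf: "dual_pair g (y (s k)) = dual_pair f (y (s k))"
      using dual_pair_clip[OF y_supp, of 1] by (simp add: g_def)
    have "\<bar>a k\<bar> * \<bar>dual_pair f (y (s k))\<bar> \<le> X01_norm n ?u"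
    proof (cases "supp g = {}")
      case True
      then have "dual_pair f (y (s k)) = 0" using dual_pair_zero[of g "y (s k)"] gf by simp
      then show ?thesis
        using dual_pair_le_norm[OF f, of ?u] by simp
    next
      case False
      then have gW: "g \<in> norming_set n" using clip_in_norming_set[OF f] by (simp add: g_def)
      have zero: "dual_pair g (y (s j)) = 0" if "j \<noteq> k" for j
      proof (rule dual_pair_zero)
        have "supp g \<subseteq> {lo (s k)..hi (s k)}" using clip_supp[of 1] by (simp add: g_def)
        moreover have "{lo (s k)..hi (s k)} \<inter> {lo (s j)..hi (s j)} = {}"
          using that hi_lo[of "s k" "s j"] hi_lo[of "s j" "s k"] strict_mono_less[OF assms(2), of k j]
            strict_mono_less[OF assms(2), of j k] by (cases j k rule: linorder_cases) auto
        ultimately show "supp g \<inter> supp (y (s j)) = {}" using y_supp[of "s j"] by blast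
      qed
      have "dual_pair g ?u = (\<Sum>j\<in>F. a j * dual_pair g (y (s j)))"
        by (rule dual_pair_sum[OF assms(1) y_c00])
      also have "\<dots> = a k * dual_pair g (y (s k))"
        using assms(1,3) zero by (subst sum.remove[of F k]) (auto intro!: sum.neutral)
      finally show ?thesis using dual_pair_le_norm[OF gW, of ?u] gf by (simp add: abs_mult)
    qed
    then have "\<bar>dual_pair f (y (s k))\<bar> \<le> X01_norm n ?u / \<bar>a k\<bar>" using False by (simp add: field_simps)
    then show "dual_pair f (y (s k)) \<le> X01_norm n ?u / \<bar>a k\<bar>" by linarith
  qed
  then show ?thesis using False unfolding norm_J_sum[OF assms(1) y_c00] J_norm[OF y_c00] by (simp add: field_simps)
qed simp

section \<open>The dichotomy for the action of S_p families on the blocks\<close>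

text \<open>The negation of this condition for every \<open>\<epsilon> > 0\<close> says that the \<open>\<alpha>\<^sub>p\<close>-index of the block sequence is zero.\<close>

definition large_index :: "nat \<Rightarrow> real \<Rightarrow> bool" where
  "large_index p \<epsilon> \<longleftrightarrow> (\<forall>N. \<exists>i\<ge>N. \<exists>as. family n p as \<and> (\<forall>a\<in>set as. N < snd a) \<and>
    \<epsilon> < (\<Sum>a\<leftarrow>as. \<bar>dual_pair (fst a) (y i)\<bar>))"

text \<open>Each average is restricted to the interval of the block and given the sign that makes
  its action nonnegative, so that the sum of absolute values becomes the value of one functional.
  Positivity of \<epsilon> ensures that something survives the restriction.\<close>

lemma large_indexE:
  assumes "large_index p \<epsilon>" "0 < \<epsilon>"
  obtains i bs where "N \<le> i" "family n p bs" "\<And>b. b \<in> set bs \<Longrightarrow> N < snd b"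
    "\<And>b. b \<in> set bs \<Longrightarrow> supp (fst b) \<subseteq> {lo i..hi i}" "\<epsilon> < dual_pair (list_sum bs) (y i)"
proof -
  obtain i as where i: "N \<le> i" "family n p as" "\<forall>a\<in>set as. N < snd a"
    "\<epsilon> < (\<Sum>a\<leftarrow>as. \<bar>dual_pair (fst a) (y i)\<bar>)" using assms(1) unfolding large_index_def by blast
  let ?I = "{lo i..hi i}"
  define s :: "sized_average \<Rightarrow> real" where "s = (\<lambda>a. if dual_pair (fst a) (y i) < 0 then -1 else 1)"
  define bs where "bs = filter (\<lambda>b. supp (fst b) \<noteq> {}) (map (\<lambda>a. (clip (s a) ?I (fst a), snd a)) as)"
  have "dual_pair (list_sum bs) (y i) = (\<Sum>a\<leftarrow>as. dual_pair (clip (s a) ?I (fst a)) (y i))"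
    unfolding clip_list_sum[OF bs_def] by (rule dual_pair_list_sum)
  also have "\<dots> = (\<Sum>a\<leftarrow>as. \<bar>dual_pair (fst a) (y i)\<bar>)"
    by (intro arg_cong[where f = sum_list] map_cong refl) (simp add: dual_pair_clip[OF y_supp] s_def)
  finally have sum: "\<epsilon> < dual_pair (list_sum bs) (y i)" using i by simp
  have "bs \<noteq> []"
  proof
    assume "bs = []"
    then show False using sum assms(2) by (simp add: dual_pair_def)
  qed
  then have "family n p bs" by (intro family_clip[OF i(2) _ bs_def]) (auto simp: s_def)
  then show ?thesis
  proof (rule that[OF i(1)])
    fix b assume "b \<in> set bs"
    then have "b \<in> (\<lambda>a. (clip (s a) ?I (fst a), snd a)) ` set as" by (simp add: bs_def)
    then obtain a where a: "a \<in> set as" "b = (clip (s a) ?I (fst a), snd a)" by blast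
    show "N < snd b" using a i by simp
    show "supp (fst b) \<subseteq> ?I" using a clip_supp[of "s a" ?I "fst a"] by (simp add: s_def)
  qed (rule sum)
qed

text \<open>The family of each m in F is multiplied by the sign of a m, and the results are
  concatenated. There are card F \<le> Min F families, and the first support starts beyond Min F, so
  a union of S_p sets becomes an S_n set. The hypothesis \<open>size\<close> makes the concatenation
  very fast growing.\<close>

lemma l1_lower_estimate:
  assumes n: "n = Suc p" and s: "strict_mono s" and fam: "\<And>m. family n p (bs m)"
    and supp: "\<And>m b. b \<in> set (bs m) \<Longrightarrow> supp (fst b) \<subseteq> {lo (s m)..hi (s m)}"
    and val: "\<And>m. \<epsilon> < dual_pair (list_sum (bs m)) (y (s m))"
    and size: "\<And>m m' b b'. m < m' \<Longrightarrow> b \<in> set (bs m) \<Longrightarrow> b' \<in> set (bs m') \<Longrightarrow> snd b < snd b' \<and> hi (s m) < snd b'"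
    and F: "F \<in> schreier (Suc 0)"
  shows "\<epsilon> * (\<Sum>m\<in>F. \<bar>a m\<bar>) \<le> norm (\<Sum>m\<in>F. a m *\<^sub>R J (y (s m)))"
proof -
  have finF: "finite F" "F \<noteq> {}" "card F \<le> Min F" using F by auto
  define neg :: "sized_average list \<Rightarrow> sized_average list" where "neg = map (\<lambda>b. (\<lambda>i. - fst b i, snd b))"
  define tb where "tb m = (if a m < 0 then neg (bs m) else bs m)" for m
  have tb_fam: "family n p (tb m)" for m
    using fam family_uminus[OF fam] by (simp add: tb_def neg_def)
  have tb_supp: "supp (fst b) \<subseteq> {lo (s m)..hi (s m)}" if b: "b \<in> set (tb m)" for b m
  proof -
    have "supp (\<lambda>i. - f i) = supp f" for f by (auto simp: supp_def)
    then obtain c where "c \<in> set (bs m)" "supp (fst b) = supp (fst c)"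
      using b by (auto simp: tb_def neg_def split: if_splits)
    then show ?thesis using supp by simp
  qed
  have tb_size: "\<exists>b\<in>set (bs m). snd c = snd b" if "c \<in> set (tb m)" for c m
    using that by (force simp: tb_def neg_def split: if_splits)
  have neg_sum: "(\<lambda>i. \<Sum>b\<leftarrow>neg cs. fst b i) = (\<lambda>i. - (\<Sum>b\<leftarrow>cs. fst b i))" for cs
    by (rule ext, induction cs) (simp_all add: neg_def)
  have tb_val: "\<epsilon> * \<bar>a m\<bar> \<le> a m * dual_pair (list_sum (tb m)) (y (s m))" for m
  proof (cases "a m < 0")
    case True
    then show ?thesis using val[of m] by (simp add: tb_def neg_sum dual_pair_uminus mult.commute)
  next
    case False
    then show ?thesis
      using mult_right_mono[OF less_imp_le[OF val[of m]], of "a m"] by (simp add: tb_def mult.commute)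
  qed
  define ms where "ms = sorted_list_of_set F"
  have ms: "set ms = F" "sorted_wrt (<) ms" "ms \<noteq> []" "hd ms = Min F" "length ms = card F" "distinct ms"
  proof -
    show "hd ms = Min F" unfolding ms_def sorted_list_of_set_nonempty[OF finF(1,2)] by simp
    show "ms \<noteq> []" unfolding ms_def using finF(1,2) by simp
  qed (use finF(1) in \<open>simp_all add: ms_def\<close>)
  let ?min = "\<lambda>b. Min (supp (fst b))"
  define as where "as = concat (map tb ms)"
  have pr: "proper (fst b)" if "b \<in> set (tb m)" for b m using family_proper[OF tb_fam that] .
  have min_in: "lo (s m) \<le> ?min b \<and> Max (supp (fst b)) \<le> hi (s m)" if "b \<in> set (tb m)" for b m
    using proper_Min[OF pr[OF that]] proper_Max[OF pr[OF that]] tb_supp[OF that] by auto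
  have sep: "hi (s m) < lo (s m')" if "m < m'" for m m' using hi_lo s that by (simp add: strict_mono_less)
  have sorted: "sorted_wrt growing as"
    unfolding as_def
  proof (rule sorted_wrt_concat_map[OF ms(2)])
    fix m m' b b' assume *: "m < m'" "b \<in> set (tb m)" "b' \<in> set (tb m')"
    have "vec_less (fst b) (fst b')"
      by (rule vec_lessI[OF pr[OF *(2)] pr[OF *(3)]]) (use tb_supp[OF *(2)] tb_supp[OF *(3)] sep[OF *(1)] in fastforce)
    moreover obtain c c' where "c \<in> set (bs m)" "snd b = snd c" "c' \<in> set (bs m')" "snd b' = snd c'"
      using tb_size[OF *(2)] tb_size[OF *(3)] by blast
    ultimately show "growing b b'" using size[OF *(1)] min_in[OF *(2)] by (fastforce simp: growing_def)
  qed (use tb_fam in \<open>auto simp: family_def\<close>)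
  have "?min ` set as \<in> schreier (Suc p)"
    unfolding schreier_Suc
  proof (intro exI[of _ "map (\<lambda>m. ?min ` set (tb m)) ms"] conjI)
    show "set (map (\<lambda>m. ?min ` set (tb m)) ms) \<subseteq> schreier p" using tb_fam by (auto simp: family_def)
    have sch: "?min ` set (tb m) \<in> schreier p" for m using tb_fam by (simp add: family_def)
    show "sorted_wrt set_less (map (\<lambda>m. ?min ` set (tb m)) ms)"
      unfolding sorted_wrt_map
    proof (rule sorted_wrt_mono_rel[OF _ ms(2)])
      fix m m' :: nat assume "m < m'"
      show "set_less (?min ` set (tb m)) (?min ` set (tb m'))"
      proof (rule set_lessI)
        fix e f assume "e \<in> ?min ` set (tb m)" "f \<in> ?min ` set (tb m')"
        then obtain b b' where b: "b \<in> set (tb m)" "e = ?min b" "b' \<in> set (tb m')" "f = ?min b'" by blast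
        have "?min b \<le> Max (supp (fst b))" using pr[OF b(1)] by (simp add: proper_def)
        then show "e < f" using b min_in[OF b(1)] min_in[OF b(3)] sep[OF \<open>m < m'\<close>] by linarith
      qed (use schreier_basic[OF sch] in auto)
    qed
    have "Min F \<le> Min (?min ` set (tb (Min F)))"
    proof (rule Min.boundedI)
      fix e assume "e \<in> ?min ` set (tb (Min F))"
      then have "lo (s (Min F)) \<le> e" using min_in by blast
      then show "Min F \<le> e" using less_lo[of "s (Min F)"] strict_mono_imp_increasing[OF s, of "Min F"] by linarith
    qed (use schreier_basic[OF sch] in auto)
    then show "length (map (\<lambda>m. ?min ` set (tb m)) ms) \<le> Min (hd (map (\<lambda>m. ?min ` set (tb m)) ms))"
      using ms finF(3) by (simp add: hd_map)
  qed (use ms in \<open>auto simp: as_def\<close>)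
  then have "family n n as"
    using sorted tb_fam n by (auto simp: family_def as_def)
  from family_sum_in_norming_set[OF this] have gW: "list_sum as \<in> norming_set n" .
  have g: "list_sum as = (\<lambda>i. \<Sum>m\<leftarrow>ms. list_sum (tb m) i)"
    unfolding as_def by (rule ext, induction ms) simp_all
  have cross: "dual_pair (list_sum (tb m')) (y (s m)) = 0" if "m \<noteq> m'" for m m'
  proof (rule trans[OF dual_pair_list_sum], rule sum_list_zero)
    fix b assume b: "b \<in> set (tb m')"
    have "{lo (s m)..hi (s m)} \<inter> {lo (s m')..hi (s m')} = {}"
      using that sep[of m m'] sep[of m' m] by (cases m m' rule: linorder_cases) auto
    then show "dual_pair (fst b) (y (s m)) = 0"
      using tb_supp[OF b] y_supp[of "s m"] by (intro dual_pair_zero) blast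
  qed
  have diag: "dual_pair (list_sum as) (y (s m)) = dual_pair (list_sum (tb m)) (y (s m))" if m: "m \<in> F" for m
  proof -
    have "dual_pair (list_sum as) (y (s m)) = (\<Sum>m'\<leftarrow>ms. dual_pair (list_sum (tb m')) (y (s m)))"
      unfolding g by (rule dual_pair_list_sum)
    also have "\<dots> = (\<Sum>m'\<in>F. dual_pair (list_sum (tb m')) (y (s m)))"
      using ms by (simp add: sum_list_distinct_conv_sum_set)
    also have "\<dots> = dual_pair (list_sum (tb m)) (y (s m))"
      using finF m cross by (subst sum.remove[of F m]) (auto intro!: sum.neutral)
    finally show ?thesis .
  qed
  have "\<epsilon> * (\<Sum>m\<in>F. \<bar>a m\<bar>) \<le> (\<Sum>m\<in>F. a m * dual_pair (list_sum as) (y (s m)))"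
    unfolding sum_distrib_left by (rule sum_mono) (use diag tb_val in auto)
  also have "\<dots> = dual_pair (list_sum as) (\<lambda>i. \<Sum>m\<in>F. a m * y (s m) i)"
    by (rule dual_pair_sum[OF finF(1) y_c00, symmetric])
  also have "\<dots> \<le> norm (\<Sum>m\<in>F. a m *\<^sub>R J (y (s m)))"
    unfolding norm_J_sum[OF finF(1) y_c00] using dual_pair_le_norm[OF gW] abs_le_D1 by blast
  finally show ?thesis .
qed

text \<open>Families are chosen one after another with sizes beyond everything used so far, as very
  fast growth across the blocks requires. The freedom in N later makes the distance between blocks
  and original sequence small.\<close>

lemma large_index_imp_l1:
  assumes "n = Suc p" "large_index p \<epsilon>" "0 < \<epsilon>"
  obtains s where "strict_mono s" "N \<le> s 0"
    "\<And>F a. F \<in> schreier (Suc 0) \<Longrightarrow> \<epsilon> * (\<Sum>m\<in>F. \<bar>a m\<bar>) \<le> norm (\<Sum>m\<in>F. a m *\<^sub>R J (y (s m)))"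
proof -
  define P where "P = (\<lambda>(i, bs). N \<le> i \<and> family n p bs \<and> (\<forall>b\<in>set bs. supp (fst b) \<subseteq> {lo i..hi i}) \<and>
    \<epsilon> < dual_pair (list_sum bs) (y i))"
  define Q where "Q = (\<lambda>(i, bs :: sized_average list) (i', bs' :: sized_average list). i < i' \<and>
    (\<forall>b\<in>set bs. \<forall>b'\<in>set bs'. snd b < snd b') \<and> (\<forall>b'\<in>set bs'. hi i < snd b'))"
  have step: "\<exists>t. P t \<and> Q (i, bs) t" for i bs
  proof -
    \<comment> \<open>The sum of the sizes dominates each single size.\<close>
    let ?N = "N + Suc i + hi i + sum_list (map snd bs)"
    obtain i' bs' where *: "?N \<le> i'" "family n p bs'" "\<And>b. b \<in> set bs' \<Longrightarrow> ?N < snd b"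
      "\<And>b. b \<in> set bs' \<Longrightarrow> supp (fst b) \<subseteq> {lo i'..hi i'}" "\<epsilon> < dual_pair (list_sum bs') (y i')"
      using large_indexE[OF assms(2,3), of ?N] by blast
    have le: "snd b \<le> ?N" if "b \<in> set bs" for b
      using member_le_sum_list[of "snd b" "map snd bs"] that by simp
    have "P (i', bs')" using * by (simp add: P_def)
    moreover have "Q (i, bs) (i', bs')"
      unfolding Q_def prod.case
    proof (intro conjI ballI)
      show "i < i'" using *(1) by simp
      show "snd b < snd b'" if "b \<in> set bs" "b' \<in> set bs'" for b b'
        using le[OF that(1)] *(3)[OF that(2)] by simp
      show "hi i < snd b'" if "b' \<in> set bs'" for b' using *(3)[OF that] by simp
    qed
    ultimately show ?thesis by blast
  qed
  have "\<exists>t. \<forall>m :: nat. P (t m) \<and> Q (t m) (t (Suc m))"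
  proof (rule dependent_nat_choice)
    show "\<exists>t. P t" using step by blast
    show "\<exists>t'. P t' \<and> Q t t'" for t and m :: nat using step by (cases t) blast
  qed
  then obtain t where t: "\<And>m. P (t m)" "\<And>m. Q (t m) (t (Suc m))" by blast
  define s where "s m = fst (t m)" for m
  define bs where "bs m = snd (t m)" for m
  have P: "N \<le> s m" "family n p (bs m)" "\<And>b. b \<in> set (bs m) \<Longrightarrow> supp (fst b) \<subseteq> {lo (s m)..hi (s m)}"
    "\<epsilon> < dual_pair (list_sum (bs m)) (y (s m))" for m
    using t(1)[of m] by (auto simp: P_def s_def bs_def case_prod_beta)
  have Q: "s m < s (Suc m)" "\<And>b b'. b \<in> set (bs m) \<Longrightarrow> b' \<in> set (bs (Suc m)) \<Longrightarrow> snd b < snd b'"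
    "\<And>b'. b' \<in> set (bs (Suc m)) \<Longrightarrow> hi (s m) < snd b'" for m
    using t(2)[of m] by (auto simp: Q_def s_def bs_def case_prod_beta)
  have ne: "bs m \<noteq> []" for m using P(2)[of m] schreier_basic(2)[of "{}" p] by (auto simp: family_def)
  have size: "snd b < snd b' \<and> hi (s m) < snd b'" if "m < m'" "b \<in> set (bs m)" "b' \<in> set (bs m')" for m m' b b'
    using that(1,3)
  proof (induction m' arbitrary: b')
    case (Suc m')
    show ?case
    proof (cases "m = m'")
      case True
      then show ?thesis using Q(2,3) that(2) Suc.prems by blast
    next
      case False
      obtain c where c: "c \<in> set (bs m')" using ne[of m'] by (meson last_in_set)
      then have "snd b < snd c \<and> hi (s m) < snd c" using Suc.IH False Suc.prems by simp
      then show ?thesis using Q(2)[OF c Suc.prems(2)] by linarith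
    qed
  qed simp
  have mono: "strict_mono s" using Q(1) by (simp add: strict_mono_Suc_iff)
  show ?thesis
    by (rule that[OF mono P(1)], rule l1_lower_estimate[OF assms(1) mono P(2,3,4) size]) auto
qed

text \<open>The tolerance at index j has to beat the hi (s i) many S_p families that a functional
  starting at an earlier block i may bring, and it has to decay like 1 / j, because the errors of
  card F \<le> Min F blocks are added.\<close>

lemma small_index_imp_c0:
  assumes n: "n = Suc p" and small: "\<And>\<epsilon>. 0 < \<epsilon> \<Longrightarrow> \<not> large_index p \<epsilon>"
  obtains s where "strict_mono s"
    "\<And>F a m. F \<in> schreier (Suc 0) \<Longrightarrow> (\<And>j. j \<in> F \<Longrightarrow> \<bar>a j\<bar> \<le> m) \<Longrightarrow> norm (\<Sum>j\<in>F. a j *\<^sub>R J (y (s j))) \<le> 12 * (B + 1) * m"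
proof -
  have "\<exists>N. \<forall>i\<ge>N. \<forall>as. family n p as \<longrightarrow> (\<forall>a\<in>set as. N < snd a) \<longrightarrow>
      (\<Sum>a\<leftarrow>as. \<bar>dual_pair (fst a) (y i)\<bar>) \<le> \<epsilon>" if "0 < \<epsilon>" for \<epsilon>
    using small[OF that] unfolding large_index_def by (meson not_le_imp_less)
  then obtain N where N: "\<And>\<epsilon> i as. 0 < \<epsilon> \<Longrightarrow> N \<epsilon> \<le> i \<Longrightarrow> family n p as \<Longrightarrow> (\<And>a. a \<in> set as \<Longrightarrow> N \<epsilon> < snd a) \<Longrightarrow>
      (\<Sum>a\<leftarrow>as. \<bar>dual_pair (fst a) (y i)\<bar>) \<le> \<epsilon>"
    by metis
  \<comment> \<open>The tolerance for the next block uses hi of the current one and is therefore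
    fixed before that block is chosen; \<open>e\<close> below gives these tolerances their
    names.\<close>
  define s where "s = rec_nat (N 1) (\<lambda>m q. max (Suc q) (N (1 / ((real m + 2) * (1 + real (hi q))))))"
  have s0: "s 0 = N 1" and sSuc: "s (Suc m) = max (Suc (s m)) (N (1 / ((real m + 2) * (1 + real (hi (s m))))))" for m
    by (simp_all add: s_def)
  define e where "e m = (case m of 0 \<Rightarrow> 1 | Suc q \<Rightarrow> 1 / ((real q + 2) * (1 + real (hi (s q)))))" for m
  have mono: "strict_mono s" by (simp add: strict_mono_Suc_iff sSuc less_max_iff_disj)
  have sN: "N (e m) \<le> s m" for m by (cases m) (simp_all add: e_def s0 sSuc)
  have e_pos: "0 < e m" for m by (cases m) (simp_all add: e_def)
  have e_le: "e m * (real m + 1) \<le> 1" for m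
  proof (cases m)
    case (Suc q)
    have "e m * (real m + 1) = (real q + 2) / ((real q + 2) * (1 + real (hi (s q))))"
      by (simp add: e_def Suc add.commute)
    also have "\<dots> \<le> 1" by simp
    finally show ?thesis .
  qed (simp add: e_def)
  have e_hi: "real (hi (s i)) * e j * (real j + 1) \<le> 1" if "i < j" for i j
  proof -
    define q where "q = j - 1"
    have q: "j = Suc q" "i \<le> q" using that by (auto simp: q_def)
    have "hi (s i) \<le> hi (s q)" using q(2) mono strict_mono_hi by (simp add: strict_mono_less_eq)
    then have "real (hi (s i)) \<le> 1 + real (hi (s q))" by simp
    then have "real (hi (s i)) / (1 + real (hi (s q))) \<le> 1" by simp
    moreover have "real (hi (s i)) * e j * (real j + 1) = real (hi (s i)) / (1 + real (hi (s q)))"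
    proof -
      define u where "u = real q + 2"
      have "real j + 1 = u" "u \<noteq> 0" "e j = 1 / (u * (1 + real (hi (s q))))"
        by (simp_all add: u_def q(1) e_def)
      then show ?thesis by simp
    qed
    ultimately show ?thesis by simp
  qed
  show ?thesis
  proof (rule that[OF mono])
    fix F and a :: "nat \<Rightarrow> real" and m
    assume F: "F \<in> schreier (Suc 0)" and a: "\<And>j. j \<in> F \<Longrightarrow> \<bar>a j\<bar> \<le> m"
    have finF: "finite F" "F \<noteq> {}" "card F \<le> Min F" using F by auto
    have m: "0 \<le> m" using a finF(2) by (meson abs_ge_zero all_not_in_conv order_trans)
    \<comment> \<open>With B + 1 in place of B, M dominates the block norms and also the
      coefficients themselves; the latter is used for the smallness hypothesis of
      \<open>c0_estimate\<close>.\<close>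
    define M where "M = (B + 1) * m"
    have M: "0 \<le> M" "m \<le> M" using m B_nonneg by (auto simp: M_def algebra_simps)
    \<comment> \<open>For j in F the tolerance is at most 1 / (j + 1) \<le> d, while card F * d
      \<le> 1 because F is a Schreier set.\<close>
    define d where "d = 1 / real (Min F)"
    have MinF: "1 \<le> Min F" using schreier_basic[OF F] Min_in[of F] by (metis One_nat_def Suc_leI gr0I)
    have le_d: "t \<le> d" if "t * (real j + 1) \<le> 1" "0 \<le> t" "j \<in> F" for t j
    proof -
      have "Min F \<le> j" using finF that by simp
      then have "t * real (Min F) \<le> t * (real j + 1)" using that by (intro mult_left_mono) auto
      then show ?thesis using that MinF by (simp add: d_def field_simps)
    qed
    interpret bl: blocks n "\<lambda>j. lo (s j)" "\<lambda>j. hi (s j)" "\<lambda>j i. a j * y (s j) i" "\<lambda>j. M" F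
    proof (rule blocks_scaled[OF finF(1) mono])
      fix j assume "j \<in> F"
      then have "\<bar>a j\<bar> * B \<le> m * B" using a B_nonneg by (intro mult_right_mono)
      then show "\<bar>a j\<bar> * B \<le> M" using m by (simp add: M_def algebra_simps)
    qed
    have "norm (\<Sum>j\<in>F. a j *\<^sub>R J (y (s j))) \<le> 12 * M"
    proof (rule norm_blocks_le[OF finF(1)])
      fix f assume f: "f \<in> norming_set n"
      have "\<bar>bl.val f F\<bar> \<le> 12 * M"
      proof (rule bl.c0_estimate[OF n, where \<epsilon> = e and d = d])
        show "e i \<le> d" if "i \<in> F" for i using le_d[OF e_le _ that] e_pos[of i] by simp
        show "real (hi (s i)) * e j \<le> d" if "i \<in> F" "j \<in> F" "i < j" for i j
          using le_d[OF e_hi[OF that(3)] _ that(2)] e_pos[of j] by simp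
        have "real (card F) \<le> real (Min F)" "0 < real (Min F)" using finF(3) MinF by linarith+
        then show "real (card F) * d \<le> 1"
          using divide_le_eq_1_pos[of "real (Min F)" "real (card F)"] by (simp only: d_def times_divide_eq_right mult_1_right)
        fix i j bs assume *: "i \<in> F" "j \<in> F" "i \<le> j" "family n p bs" "\<And>b. b \<in> set bs \<Longrightarrow> lo (s i) < snd b"
        have "(\<Sum>b\<leftarrow>bs. \<bar>dual_pair (fst b) (y (s j))\<bar>) \<le> e i"
        proof (rule N[OF e_pos _ *(4)])
          show "N (e i) \<le> s j" using sN[of i] mono *(3) by (meson order_trans strict_mono_less_eq)
          show "N (e i) < snd b" if "b \<in> set bs" for b using sN[of i] less_lo[of "s i"] *(5)[OF that] by simp
        qed
        then have "\<bar>a j\<bar> * (\<Sum>b\<leftarrow>bs. \<bar>dual_pair (fst b) (y (s j))\<bar>) \<le> M * e i"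
          using a[OF *(2)] M e_pos[of i] by (intro mult_mono) (auto intro!: sum_list_nonneg)
        then show "(\<Sum>b\<leftarrow>bs. \<bar>dual_pair (fst b) (\<lambda>i. a j * y (s j) i)\<bar>) \<le> M * e i"
          by (simp add: dual_pair_scale[OF y_c00] abs_mult sum_list_const_mult)
      qed (use M e_pos f less_imp_le in \<open>auto simp: d_def\<close>)
      then show "\<bar>\<Sum>j\<in>F. dual_pair f (\<lambda>i. a j * y (s j) i)\<bar> \<le> 12 * M" unfolding bl.val_def .
    qed
    then show "norm (\<Sum>j\<in>F. a j *\<^sub>R J (y (s j))) \<le> 12 * (B + 1) * m" by (simp only: M_def mult.assoc)
  qed
qed

end

section \<open>From block sequences to weakly null sequences\<close>

context X01_completion
begin

text \<open>A special combination of the approximating blocks has norm at most \<delta>, hence that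
  of the sequence at most 2 * \<delta> < 1 / K, against the lower l_1 estimate. A constant
  perturbation \<delta> suffices because the weights add up to 1.\<close>

lemma not_generates_l1_Suc:
  fixes x :: "nat \<Rightarrow> 'a"
  assumes "seminormalized x" "weakly_null x"
  shows "\<not> generates_l1_spreading_model (Suc n) x"
proof
  assume "generates_l1_spreading_model (Suc n) x"
  then obtain K where K: "K \<ge> 1" "\<And>F. F \<in> schreier (Suc n) \<Longrightarrow> C_equivalent K F x (\<lambda>a. \<Sum>i\<in>F. \<bar>a i\<bar>)"
    by (auto simp: generates_l1_spreading_model_def)
  obtain C where C: "\<forall>i\<ge>1. norm (x i) \<le> C"
    using assms(1) unfolding seminormalized_def by blast
  define \<delta> where "\<delta> = 1 / (4 * K)"
  have \<delta>: "0 < \<delta>" using K(1) by (simp add: \<delta>_def)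
  obtain r y lo hi where r: "strict_mono r" "1 \<le> r 0" and y: "\<And>i. y i \<in> c00" "\<And>i. supp (y i) \<subseteq> {lo i..hi i}"
    "\<And>i. 1 \<le> lo i" "\<And>i. lo i \<le> hi i" "\<And>i. hi i < lo (Suc i)"
    and close: "\<And>i. norm (x (r i) - J (y i)) \<le> \<delta>"
    by (rule gliding_hump[OF assms(2), of "\<lambda>_. \<delta>"]) (use \<delta> in auto)
  have r1: "1 \<le> r i" for i using r by (meson le0 order_trans strict_mono_less_eq)
  interpret block_sequence n J y lo hi "C + \<delta>"
  proof
    show "norm (J (y i)) \<le> C + \<delta>" for i
      using norm_triangle_sub[of "J (y i)" "x (r i)"] close[of i] C[rule_format, OF r1[of i]]
      by (simp add: norm_minus_commute)
  qed (use y in auto)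
  obtain F w where F: "F \<in> schreier (Suc n)" "\<forall>i. 0 \<le> w i" "sum w F = 1"
    "norm (\<Sum>j\<in>F. w j *\<^sub>R J (y j)) \<le> \<delta>" using norm_special_combination_small[OF \<delta>] by blast
  have "1 / K * (\<Sum>i\<in>F. \<bar>w i\<bar>) \<le> norm (\<Sum>i\<in>F. w i *\<^sub>R (x \<circ> r) i)"
    using C_equivalent_l1_subsequence[OF K(2) r(1) F(1)] unfolding C_equivalent_def by blast
  then have "1 / K \<le> norm (\<Sum>i\<in>F. w i *\<^sub>R x (r i))" using F(2,3) by simp
  moreover have "\<bar>norm (\<Sum>j\<in>F. w j *\<^sub>R x (r j)) - norm (\<Sum>j\<in>F. w j *\<^sub>R J (y j))\<bar> \<le> (\<Sum>j\<in>F. \<bar>w j\<bar> * \<delta>)"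
    by (rule norm_sum_perturb) (rule close)
  moreover have "(\<Sum>j\<in>F. \<bar>w j\<bar> * \<delta>) = \<delta>" using F(2,3) by (simp add: sum_distrib_right[symmetric])
  ultimately have "1 / K \<le> 2 * \<delta>" using F(4) by linarith
  moreover have "2 * \<delta> < 1 / K" using K(1) by (simp add: \<delta>_def field_simps)
  ultimately show False by simp
qed

lemma not_admits_l1_Suc:
  fixes x :: "nat \<Rightarrow> 'a"
  assumes "seminormalized x" "weakly_null x"
  shows "\<not> admits_l1_spreading_model (Suc n) x"
proof
  assume "admits_l1_spreading_model (Suc n) x"
  then obtain r where r: "strict_mono r" "generates_l1_spreading_model (Suc n) (x \<circ> r)"
    by (auto simp: admits_l1_spreading_model_def)
  have "1 \<le> r i" if "1 \<le> i" for i using strict_mono_imp_increasing[OF r(1), of i] that by simp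
  then have "seminormalized (x \<circ> r)" using assms(1) by (auto simp: seminormalized_def)
  moreover have "weakly_null (x \<circ> r)"
    using assms(2) LIMSEQ_subseq_LIMSEQ[OF _ r(1)] by (fastforce simp: weakly_null_def comp_def)
  ultimately show False using not_generates_l1_Suc r(2) by blast
qed

text \<open>One sequence \<eta> serves both alternatives. For l_1 it is enough to start so late that
  \<eta> is below \<epsilon> / 2; the upper estimate is the triangle inequality. For c_0 the decay 1
  / (i + 1) makes the errors over a Schreier set F add up to at most c / 4 times the largest
  coefficient, since there are at most Min F of them.\<close>

lemma admits_c0_or_l1:
  fixes x :: "nat \<Rightarrow> 'a"
  assumes n: "n = Suc p" and "seminormalized x" "weakly_null x"
  shows "admits_c0_spreading_model 1 x \<or> admits_l1_spreading_model 1 x"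
proof -
  obtain c C where c: "0 < c" "\<And>i. 1 \<le> i \<Longrightarrow> c \<le> norm (x i)" "\<And>i. 1 \<le> i \<Longrightarrow> norm (x i) \<le> C"
    using assms(2) by (auto simp: seminormalized_def)
  define \<eta> where "\<eta> i = c / (4 * (real i + 1))" for i :: nat
  have \<eta>: "0 < \<eta> i" "\<eta> i \<le> c / 4" for i using c(1) by (auto simp: \<eta>_def field_simps)
  obtain r y lo hi where r: "strict_mono r" "1 \<le> r 0" and y: "\<And>i. y i \<in> c00" "\<And>i. supp (y i) \<subseteq> {lo i..hi i}"
    "\<And>i. 1 \<le> lo i" "\<And>i. lo i \<le> hi i" "\<And>i. hi i < lo (Suc i)"
    and close: "\<And>i. norm (x (r i) - J (y i)) \<le> \<eta> i"
    by (rule gliding_hump[OF assms(3), of \<eta>]) (use \<eta> in auto)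
  have r1: "1 \<le> r i" for i using r by (meson le0 order_trans strict_mono_less_eq)
  interpret block_sequence n J y lo hi "C + c"
  proof
    show "norm (J (y i)) \<le> C + c" for i
      using norm_triangle_sub[of "J (y i)" "x (r i)"] close[of i] c(3)[OF r1[of i]] \<eta>(2)[of i] c(1)
      by (simp add: norm_minus_commute)
  qed (use y in auto)
  have C: "0 < C" using c(1) c(2,3)[of 1] by simp
  show ?thesis
  proof (cases "\<exists>\<epsilon>>0. large_index p \<epsilon>")
    case True
    then obtain \<epsilon> where \<epsilon>: "0 < \<epsilon>" "large_index p \<epsilon>" by blast
    obtain N where N: "c / \<epsilon> < real N" using reals_Archimedean2 by blast
    obtain s where s: "strict_mono s" "N \<le> s 0"
      "\<And>F a. F \<in> schreier (Suc 0) \<Longrightarrow> \<epsilon> * (\<Sum>m\<in>F. \<bar>a m\<bar>) \<le> norm (\<Sum>m\<in>F. a m *\<^sub>R J (y (s m)))"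
      by (rule large_index_imp_l1[OF n \<epsilon>(2,1), of N]) blast
    have \<eta>s: "\<eta> (s m) \<le> \<epsilon> / 2" for m
    proof -
      have "N \<le> s m" using s(1,2) by (meson le0 order_trans strict_mono_less_eq)
      then have "c < \<epsilon> * (real (s m) + 1)"
        using N \<epsilon>(1) mult_left_mono[of "real N" "real (s m) + 1" \<epsilon>] by (simp add: field_simps)
      then have "c / (real (s m) + 1) < \<epsilon>" by (simp add: pos_divide_less_eq)
      moreover have "\<eta> (s m) = c / (real (s m) + 1) / 4" by (simp add: \<eta>_def)
      moreover have "t / 4 \<le> \<epsilon> / 2" if "t < \<epsilon>" for t using that \<epsilon>(1) by linarith
      ultimately show ?thesis by metis
    qed
    define K where "K = Max {1, C, 2 / \<epsilon>}"
    have K: "1 \<le> K" "C \<le> K" "2 / \<epsilon> \<le> K" by (auto simp: K_def)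
    have inv: "1 / K \<le> \<epsilon> / 2" using K(1,3) \<epsilon>(1) by (simp add: field_simps)
    have "C_equivalent K F (x \<circ> (r \<circ> s)) (\<lambda>a. \<Sum>i\<in>F. \<bar>a i\<bar>)" if F: "F \<in> schreier (Suc 0)" for F
      unfolding C_equivalent_def
    proof (intro allI conjI)
      fix a :: "nat \<Rightarrow> real"
      let ?S = "\<Sum>i\<in>F. \<bar>a i\<bar>"
      have S: "0 \<le> ?S" by (simp add: sum_nonneg)
      have "\<bar>norm (\<Sum>m\<in>F. a m *\<^sub>R x (r (s m))) - norm (\<Sum>m\<in>F. a m *\<^sub>R J (y (s m)))\<bar> \<le> (\<Sum>m\<in>F. \<bar>a m\<bar> * \<eta> (s m))"
        by (rule norm_sum_perturb) (rule close)
      also have "\<dots> \<le> (\<Sum>m\<in>F. \<bar>a m\<bar> * (\<epsilon> / 2))" by (intro sum_mono mult_left_mono \<eta>s) simp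
      also have "\<dots> = \<epsilon> / 2 * ?S" by (simp add: sum_distrib_left mult.commute)
      finally have "\<epsilon> / 2 * ?S \<le> norm (\<Sum>m\<in>F. a m *\<^sub>R x (r (s m)))" using s(3)[OF F, of a] by linarith
      moreover have "1 / K * ?S \<le> \<epsilon> / 2 * ?S" by (rule mult_right_mono[OF inv S])
      ultimately show "1 / K * ?S \<le> norm (\<Sum>i\<in>F. a i *\<^sub>R (x \<circ> (r \<circ> s)) i)"
        unfolding comp_apply by (rule order_trans[rotated])
      have "norm (\<Sum>i\<in>F. a i *\<^sub>R x (r (s i))) \<le> (\<Sum>i\<in>F. \<bar>a i\<bar> * C)"
        by (rule sum_norm_le) (use c(3)[OF r1] in \<open>auto intro: mult_left_mono\<close>)
      also have "\<dots> = C * ?S" by (simp add: sum_distrib_left mult.commute)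
      also have "\<dots> \<le> K * ?S" by (rule mult_right_mono[OF K(2) S])
      finally show "norm (\<Sum>i\<in>F. a i *\<^sub>R (x \<circ> (r \<circ> s)) i) \<le> K * ?S" by simp
    qed
    then have "generates_l1_spreading_model 1 (x \<circ> (r \<circ> s))"
      unfolding generates_l1_spreading_model_def One_nat_def using K(1) by blast
    moreover have "strict_mono (r \<circ> s)" using r(1) s(1) by (simp add: strict_mono_o)
    ultimately show ?thesis unfolding admits_l1_spreading_model_def by blast
  next
    case False
    obtain s where s: "strict_mono s"
      "\<And>F a m. F \<in> schreier (Suc 0) \<Longrightarrow> (\<And>j. j \<in> F \<Longrightarrow> \<bar>a j\<bar> \<le> m) \<Longrightarrow>
        norm (\<Sum>j\<in>F. a j *\<^sub>R J (y (s j))) \<le> 12 * (C + c + 1) * m"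
      by (rule small_index_imp_c0[OF n]) (use False in blast)+
    define K where "K = Max {1, 12 * (C + c + 1) + c, 4 / c}"
    have K: "1 \<le> K" "12 * (C + c + 1) + c \<le> K" "4 / c \<le> K" by (auto simp: K_def)
    have inv: "1 / K \<le> c / 4" using K(1,3) c(1) by (simp add: field_simps)
    have "C_equivalent K F (x \<circ> (r \<circ> s)) (\<lambda>a. Max ((\<lambda>i. \<bar>a i\<bar>) ` F))" if F: "F \<in> schreier (Suc 0)" for F
      unfolding C_equivalent_def
    proof (intro allI conjI)
      fix a :: "nat \<Rightarrow> real"
      have finF: "finite F" "F \<noteq> {}" "card F \<le> Min F" using F by auto
      define m where "m = Max ((\<lambda>i. \<bar>a i\<bar>) ` F)"
      have m: "\<bar>a j\<bar> \<le> m" if "j \<in> F" for j using finF that by (auto simp: m_def)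
      have "m \<in> (\<lambda>i. \<bar>a i\<bar>) ` F" unfolding m_def using finF by (intro Max_in) auto
      then obtain k where k: "k \<in> F" "m = \<bar>a k\<bar>" by blast
      have m0: "0 \<le> m" using k by simp
      have "\<bar>norm (\<Sum>j\<in>F. a j *\<^sub>R x (r (s j))) - norm (\<Sum>j\<in>F. a j *\<^sub>R J (y (s j)))\<bar> \<le> (\<Sum>j\<in>F. \<bar>a j\<bar> * \<eta> (s j))"
        by (rule norm_sum_perturb) (rule close)
      also have "\<dots> \<le> (\<Sum>j\<in>F. m * (c / (4 * (real (Min F) + 1))))"
      proof (intro sum_mono mult_mono)
        fix j assume j: "j \<in> F"
        have "Min F \<le> s j" using Min_le[OF finF(1) j] strict_mono_imp_increasing[OF s(1), of j] by linarith
        then show "\<eta> (s j) \<le> c / (4 * (real (Min F) + 1))"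
          unfolding \<eta>_def using c(1) by (intro divide_left_mono) auto
      qed (use m m0 \<eta>(1) in \<open>auto simp: less_imp_le\<close>)
      also have "\<dots> = (real (card F) / (real (Min F) + 1)) * (m * c / 4)" by (simp add: field_simps)
      also have "\<dots> \<le> 1 * (m * c / 4)"
      proof (rule mult_right_mono)
        have "real (card F) \<le> real (Min F) + 1" using finF(3) by linarith
        then show "real (card F) / (real (Min F) + 1) \<le> 1" 
          by (intro divide_le_eq_1_pos[THEN iffD2]) linarith+
      qed (use m0 c(1) in simp)
      finally have err: "\<bar>norm (\<Sum>j\<in>F. a j *\<^sub>R x (r (s j))) - norm (\<Sum>j\<in>F. a j *\<^sub>R J (y (s j)))\<bar> \<le> m * c / 4" by simp
      \<comment> \<open>Of the lower bound c, the perturbation takes at most c / 4 on the single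
        block, and c / 2 is kept; the perturbation of the whole sum takes another c / 4, so c / 4
        remains.\<close>
      have "c / 2 \<le> norm (J (y (s k)))"
        using norm_triangle_sub[of "x (r (s k))" "J (y (s k))"] close[of "s k"] \<eta>(2)[of "s k"] c(1) c(2)[OF r1[of "s k"]]
        by linarith
      then have "m * (c / 2) \<le> m * norm (J (y (s k)))" using m0 by (rule mult_left_mono)
      also have "\<dots> \<le> norm (\<Sum>j\<in>F. a j *\<^sub>R J (y (s j)))"
        unfolding k(2) by (rule norm_block_le_norm_sum[OF finF(1) s(1) k(1)])
      finally have "m * c / 4 \<le> norm (\<Sum>j\<in>F. a j *\<^sub>R x (r (s j)))" using err by linarith
      moreover have "1 / K * m \<le> c / 4 * m" by (rule mult_right_mono[OF inv m0])
      moreover have "c / 4 * m = m * c / 4" by simp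
      ultimately have "1 / K * m \<le> norm (\<Sum>j\<in>F. a j *\<^sub>R x (r (s j)))" by linarith
      then show "1 / K * Max ((\<lambda>i. \<bar>a i\<bar>) ` F) \<le> norm (\<Sum>i\<in>F. a i *\<^sub>R (x \<circ> (r \<circ> s)) i)"
        unfolding comp_apply m_def[symmetric] .
      have "norm (\<Sum>j\<in>F. a j *\<^sub>R J (y (s j))) \<le> 12 * (C + c + 1) * m" by (rule s(2)[OF F m])
      moreover have "m * c / 4 \<le> c * m" using m0 c(1) by simp
      moreover have "(12 * (C + c + 1) + c) * m \<le> K * m" by (rule mult_right_mono[OF K(2) m0])
      moreover have "(12 * (C + c + 1) + c) * m = 12 * (C + c + 1) * m + c * m" by (rule distrib_right)
      ultimately have "norm (\<Sum>j\<in>F. a j *\<^sub>R x (r (s j))) \<le> K * m" using err by linarith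
      then show "norm (\<Sum>i\<in>F. a i *\<^sub>R (x \<circ> (r \<circ> s)) i) \<le> K * Max ((\<lambda>i. \<bar>a i\<bar>) ` F)"
        unfolding comp_apply m_def[symmetric] .
    qed
    then have "generates_c0_spreading_model 1 (x \<circ> (r \<circ> s))"
      unfolding generates_c0_spreading_model_def One_nat_def using K(1) by blast
    moreover have "strict_mono (r \<circ> s)" using r(1) s(1) by (simp add: strict_mono_o)
    ultimately show ?thesis unfolding admits_c0_spreading_model_def by blast
  qed
qed

end

theorem proposition0p2:
  fixes n :: nat
    and J :: "(nat \<Rightarrow> real) \<Rightarrow> 'a::banach"
    and x :: "nat \<Rightarrow> 'a"
  assumes "1 \<le> n"
    and "is_X01_completion n J"
    and "seminormalized x"
    and "weakly_null x"
  shows "admits_c0_spreading_model 1 x \<or>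
    (\<exists>k. 1 \<le> k \<and> k \<le> n \<and> admits_l1_spreading_model k x \<and> \<not> admits_l1_spreading_model (k + 1) x)"
proof -
  interpret X01_completion n J using assms(2) by unfold_locales
  \<comment> \<open>S_n is built from S_p by unions over Schreier sets, and the dichotomy is about
    S_p-admissible families.\<close>
  obtain p where p: "n = Suc p" using assms(1) by (cases n) auto
  consider "admits_c0_spreading_model 1 x" | "admits_l1_spreading_model 1 x"
    using admits_c0_or_l1[OF p assms(3,4)] by blast
  then show ?thesis
  proof cases
    case 2
    define A where "A = {k. 1 \<le> k \<and> k \<le> n \<and> admits_l1_spreading_model k x}"
    have A: "finite A" "1 \<in> A" using 2 assms(1) by (auto simp: A_def)
    then have "Max A \<in> A" by (intro Max_in) auto
    then have k: "1 \<le> Max A" "Max A \<le> n" "admits_l1_spreading_model (Max A) x" by (auto simp: A_def)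
    have "\<not> admits_l1_spreading_model (Max A + 1) x"
    proof (cases "Max A = n")
      case True
      then show ?thesis using not_admits_l1_Suc[OF assms(3,4)] by simp
    next
      case False
      show ?thesis
      proof
        assume "admits_l1_spreading_model (Max A + 1) x"
        then have "Max A + 1 \<in> A" using False k by (simp add: A_def)
        then show False using Max_ge[OF A(1)] by fastforce
      qed
    qed
    then show ?thesis using k by blast
  qed simp
qed

end
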